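(* Let $\mathcal M\subset\mathbb R^d$ be a compact set with positive reach $\eta_{\mathcal M}>0$, and let $W:\mathbb R^d\to\mathbb R$ be of class $C^2$, symmetric, semiconvex, bounded from below, with at-most-quadratic growth at infinity. Let $\rho^0\in\mathcal P(\mathcal M)$ and let $\rho\in AC^2([0,\infty);\mathcal P(\mathcal M))$ be the gradient flow for $E$ with $\rho(0)=\rho^0$. Fix $r\in(0,\eta_{\mathcal M})$ and let $\Pi_{\mathcal M}:\mathcal M_r\to\mathcal M$ be the closest-point projection, where $\mathcal M_r=\{x: d_{\mathcal M}(x)<r\}$. Let $R>0$ be such that $\{x-y: x,y\in\mathcal M_r\}\subset B_R$, and let $\tau_0>0$ be such that $\tau_0\le \eta_{\mathcal M}/(8\|\nabla W\|_{L^\infty(B_R)})$ and, for all $\nu\in\mathcal P(\mathcal M)$ and $t\in[0,\tau_0]$, $\operatorname{supp}((\Phi^\nu_t)_\#\nu)\subset\mathcal M_r$. For $\tau\in(0,\tau_0]$ define $\nu^\tau_0=\rho^0$, $\nu^\tau_{n+1}=(\Pi_{\mathcal M})_\#((\Phi^{\nu^\tau_n}_\tau)_\#\nu^\tau_n)$ for integers $n\ge0$, and the interpolation $\nu^\tau(0)=\rho^0$, $\nu^\tau(t)=(\Pi_{\mathcal M})_\#((\Phi^{\nu^\tau_n}_{t-n\tau})_\#\nu^\tau_n)$ for $t\in(n\tau,(n+1)\tau]$. Then for every $t\ge0$, $d_2(\nu^\tau(t),\rho(t))\to0$ as $\tau\to0$.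
   Context: $\mathcal P(\mathcal M)$: Borel probability measures supported in $\mathcal M$; $d_2$: quadratic Wasserstein distance; $d_{\mathcal M}$: Euclidean distance to $\mathcal M$; the reach $\eta_{\mathcal M}$ is the supremum of $r$ such that every point at distance $<r$ from $\mathcal M$ has a unique closest point in $\mathcal M$; $B_R$ is the open ball of radius $R$ centered at $0$. For $\nu\in\mathcal P(\mathcal M)$, $\Phi^\nu_t:\mathbb R^d\to\mathbb R^d$ denotes the flow map of the solution $\mu$ of the nonlocal-interaction equation on $\mathbb R^d$, $\partial_t\mu+\operatorname{div}(\mu v)=0$, $v=-\nabla W*\mu$, with $\mu(0)=\nu$: that is, $\frac{d}{dt}\Phi^\nu_t(x)=-(\nabla W*\mu(t))(\Phi^\nu_t(x))$, $\Phi^\nu_0(x)=x$, and $\mu(t)=(\Phi^\nu_t)_\#\nu$, where $(\nabla W*\mu)(x)=\int\nabla W(x-y)\,d\mu(y)$. $E(\rho)=\frac12\int_{\mathcal M}\int_{\mathcal M}W(x-y)\,d\rho(y)\,d\rho(x)$ if $\rho\in\mathcal P(\mathcal M)$, $+\infty$ otherwise. Local slope: $|\partial E|(\rho)=\limsup_{\mu\to\rho}\frac{(E(\rho)-E(\mu))_+}{d_2(\rho,\mu)}$ for $\rho\in\mathcal P(\mathcal M)$, $+\infty$ otherwise. A gradient flow for $E$ is a curve $\rho\in AC^2([0,\infty);\mathcal P_2(\mathbb R^d))$ (i.e. $d_2(\rho(s),\rho(t))\le\int_s^t m$ for some $m\in L^2(0,\infty)$) such that $t\mapsto E(\rho(t))$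 is nonincreasing and $E(\rho(t))-E(\rho(s))+\frac12\int_s^t(|\partial E|(\rho)^2+|\rho'|^2)\le0$ for $0\le s\le t$, where $|\rho'|(t)=\lim_{h\to0}d_2(\rho(t),\rho(t+h))/|h|$. (Such a gradient flow exists and is unique; it corresponds to $\partial_t\rho+\operatorname{div}(\rho\,P_{\mathcal M}(-\nabla W*\rho))=0$ on $\mathcal M$, with $P_{\mathcal M}(x)$ the projection onto the Clarke tangent cone of $\mathcal M$ at $x$.) *)

theory Defs
  imports "HOL-Probability.Probability"
begin

text \<open>P(M): Borel probability measures supported in M (closed M: support in M iff M has full measure).\<close>
definition PM :: "'a::euclidean_space set \<Rightarrow> 'a measure set" where
  "PM M = {\<mu>. prob_space \<mu> \<and> sets \<mu> = sets borel \<and> emeasure \<mu> (UNIV - M) = 0}"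

definition P2 :: "'a::euclidean_space measure set" where
  "P2 = {\<mu>. prob_space \<mu> \<and> sets \<mu> = sets borel \<and> (\<integral>\<^sup>+ x. ennreal ((norm x)\<^sup>2) \<partial>\<mu>) < \<infinity>}"

definition couplings :: "'a::euclidean_space measure \<Rightarrow> 'a measure \<Rightarrow> ('a \<times> 'a) measure set" where
  "couplings \<mu> \<nu> = {\<gamma>. prob_space \<gamma> \<and> sets \<gamma> = sets borel \<and>
      distr \<gamma> borel fst = \<mu> \<and> distr \<gamma> borel snd = \<nu>}"

definition d2 :: "'a::euclidean_space measure \<Rightarrow> 'a measure \<Rightarrow> real" where
  "d2 \<mu> \<nu> = sqrt (enn2real (INF \<gamma>\<in>couplings \<mu> \<nu>.
       \<integral>\<^sup>+ p. ennreal ((norm (fst p - snd p))\<^sup>2) \<partial>\<gamma>))"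

definition msupp :: "'a::metric_space measure \<Rightarrow> 'a set" where
  "msupp \<mu> = {x. \<forall>e>0. emeasure \<mu> (ball x e) > 0}"

text \<open>Reach (possibly infinite, hence an extended real).\<close>
definition reach :: "'a::euclidean_space set \<Rightarrow> ereal" where
  "reach M = Sup {ereal r | r. \<forall>x. infdist x M < r \<longrightarrow> (\<exists>!y. y \<in> M \<and> dist x y = infdist x M)}"

text \<open>Closest-point projection onto M on the tube M_r; outside M_r the value is irrelevant (identity).\<close>
definition proj_on :: "'a::euclidean_space set \<Rightarrow> real \<Rightarrow> 'a \<Rightarrow> 'a" where
  "proj_on M r x = (if infdist x M < r then (THE y. y \<in> M \<and> dist x y = infdist x M) else x)"

definition grad :: "('a::euclidean_space \<Rightarrow> real) \<Rightarrow> 'a \<Rightarrow> 'a" where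
  "grad W x = (SOME D. GDERIV W x :> D)"

definition C2 :: "('a::euclidean_space \<Rightarrow> real) \<Rightarrow> bool" where
  "C2 W \<longleftrightarrow> (\<forall>x. W differentiable (at x)) \<and>
     (\<exists>D :: 'a \<Rightarrow> 'a \<Rightarrow>\<^sub>L 'a. continuous_on UNIV D \<and>
        (\<forall>x. (grad W has_derivative blinfun_apply (D x)) (at x)))"

definition convgrad :: "('a::euclidean_space \<Rightarrow> real) \<Rightarrow> 'a measure \<Rightarrow> 'a \<Rightarrow> 'a" where
  "convgrad W \<mu> z = (\<integral> y. grad W (z - y) \<partial>\<mu>)"

definition is_flow :: "('a::euclidean_space \<Rightarrow> real) \<Rightarrow> 'a measure \<Rightarrow> (real \<Rightarrow> 'a \<Rightarrow> 'a) \<Rightarrow> bool" where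
  "is_flow W \<nu> Phi \<longleftrightarrow>
     (\<forall>t\<ge>0. Phi t \<in> borel_measurable borel) \<and> (\<forall>x. Phi 0 x = x) \<and>
     (\<forall>x t. t \<ge> 0 \<longrightarrow>
        ((\<lambda>s. Phi s x) has_vector_derivative - convgrad W (distr \<nu> borel (Phi t)) (Phi t x))
          (at t within {0..}))"

definition energy :: "'a::euclidean_space set \<Rightarrow> ('a \<Rightarrow> real) \<Rightarrow> 'a measure \<Rightarrow> ereal" where
  "energy M W \<rho> = (if \<rho> \<in> PM M then ereal (1/2 * (\<integral> x. (\<integral> y. W (x - y) \<partial>\<rho>) \<partial>\<rho>)) else \<infinity>)"

text \<open>Local slope: limsup over mu -> rho (in d2) of (E rho - E mu)_+ / d2(rho,mu);
  measures outside P(M) have infinite energy and contribute 0.\<close>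
definition slope :: "'a::euclidean_space set \<Rightarrow> ('a \<Rightarrow> real) \<Rightarrow> 'a measure \<Rightarrow> ereal" where
  "slope M W \<rho> = (if \<rho> \<in> PM M then
      (INF \<delta>\<in>{0<..}. max 0 (SUP \<mu>\<in>{\<mu> \<in> PM M. 0 < d2 \<rho> \<mu> \<and> d2 \<rho> \<mu> < \<delta>}.
          (energy M W \<rho> - energy M W \<mu>) / ereal (d2 \<rho> \<mu>)))
    else \<infinity>)"

definition mderiv :: "(real \<Rightarrow> 'a::euclidean_space measure) \<Rightarrow> real \<Rightarrow> real" where
  "mderiv \<rho> t = Lim (at 0) (\<lambda>h. d2 (\<rho> t) (\<rho> (t + h)) / \<bar>h\<bar>)"

definition AC2 :: "(real \<Rightarrow> 'a::euclidean_space measure) \<Rightarrow> bool" where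
  "AC2 \<rho> \<longleftrightarrow> (\<forall>t\<ge>0. \<rho> t \<in> P2) \<and>
     (\<exists>m :: real \<Rightarrow> real. m \<in> borel_measurable lborel \<and> (\<forall>t. m t \<ge> 0) \<and>
        (\<integral>\<^sup>+ t\<in>{0..}. ennreal ((m t)\<^sup>2) \<partial>lborel) < \<infinity> \<and>
        (\<forall>s t. 0 \<le> s \<and> s \<le> t \<longrightarrow> ennreal (d2 (\<rho> s) (\<rho> t)) \<le> (\<integral>\<^sup>+ u\<in>{s..t}. ennreal (m u) \<partial>lborel)))"

definition grad_flow :: "'a::euclidean_space set \<Rightarrow> ('a \<Rightarrow> real) \<Rightarrow> (real \<Rightarrow> 'a measure) \<Rightarrow> bool" where
  "grad_flow M W \<rho> \<longleftrightarrow> AC2 \<rho> \<and>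
     (\<forall>s t. 0 \<le> s \<and> s \<le> t \<longrightarrow> energy M W (\<rho> t) \<le> energy M W (\<rho> s)) \<and>
     (\<forall>s t. 0 \<le> s \<and> s \<le> t \<longrightarrow>
        energy M W (\<rho> t) + ereal (1/2) * enn2ereal (\<integral>\<^sup>+ u\<in>{s..t}.
           (e2ennreal (slope M W (\<rho> u)))\<^sup>2 + ennreal ((mderiv \<rho> u)\<^sup>2) \<partial>lborel)
        \<le> energy M W (\<rho> s))"

primrec nu_seq :: "('a::euclidean_space measure \<Rightarrow> real \<Rightarrow> 'a \<Rightarrow> 'a) \<Rightarrow> ('a \<Rightarrow> 'a)
    \<Rightarrow> 'a measure \<Rightarrow> real \<Rightarrow> nat \<Rightarrow> 'a measure" where
  "nu_seq Phi P \<rho>0 \<tau> 0 = \<rho>0"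
| "nu_seq Phi P \<rho>0 \<tau> (Suc n) =
     distr (distr (nu_seq Phi P \<rho>0 \<tau> n) borel (Phi (nu_seq Phi P \<rho>0 \<tau> n) \<tau>)) borel P"

text \<open>Interpolation: for t in (n tau, (n+1) tau], n = ceiling(t/tau) - 1.\<close>
definition nu_interp :: "('a::euclidean_space measure \<Rightarrow> real \<Rightarrow> 'a \<Rightarrow> 'a) \<Rightarrow> ('a \<Rightarrow> 'a)
    \<Rightarrow> 'a measure \<Rightarrow> real \<Rightarrow> real \<Rightarrow> 'a measure" where
  "nu_interp Phi P \<rho>0 \<tau> t =
     (if t \<le> 0 then \<rho>0 else
        (let n = nat (\<lceil>t / \<tau>\<rceil> - 1); \<nu>n = nu_seq Phi P \<rho>0 \<tau> n in
           distr (distr \<nu>n borel (Phi \<nu>n (t - real n * \<tau>))) borel P))"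

end

(* A curve of maximal slope rho is compared with the scheme directly, without characterizing its velocity.
   With J_h(nu) = int (2h v.(z - x) - |z - x|^2) dnu, where v = - grad W * nu and z = Pi(x + h v), positive reach
   and the expansion of E give a discrete evolution variational inequality for one projected Euler step P_h:
     (1 - Ch) d^2(P_h nu, sigma) <= (1 + Ch) d^2(nu, sigma) + 2h (E(sigma) - E(nu)) + J_h(nu).
   Moreover h^-2 J_h(nu) <= |dE|^2(nu) + Ch.  Inserting nu = rho(t), sigma = rho(t + h) and the energy dissipation
   inequality, the metric derivative cancels and, with F = h^-2 J_h,
     d^2(P_h rho(t), rho(t + h)) <= 2h^2 (F(rho(t)) - average of F(rho) over [t, t + h]) + C h^3.
   Summed along t = kh + s the bracket is O(h) for a suitable offset s in [0, h], since the mean over s of the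
   Riemann sums is the integral; as P_h is (1 + Ch)-Lipschitz, the total error is O(sqrt h). *)
theory Submission
  imports Defs
begin

section \<open>Sets of positive reach\<close>

text \<open>The dissipation inequality bounds the slope only from above, so the slope needs a
  computable minorant. The competitors for it are the projections of the chord points x + s (z - x)
  as s tends to 0; positive reach keeps them within O(s |z - x|^2) of the chord. The slope need not
  be continuous along the curve, whereas \<open>F h\<close> is, for each fixed h. But its Lipschitz
  constant is of order 1/h, too large to make a Riemann sum of mesh h with a prescribed offset close
  to the integral. Hence the offset is chosen by averaging, and the scheme is compared with the flow
  on a shifted time grid. The rate comes from O(1/h) local errors whose squares sum to O(h^2): by
  Cauchy-Schwarz their sum is O(sqrt h). The definitions force two preliminaries.
  \<open>reach\<close> speaks only of unique nearest points, so the quadratic normal inequality has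
  to be derived. And \<open>mderiv\<close> is a \<open>Lim\<close>, so the metric derivative must be
  shown to exist almost everywhere before the dissipation inequality says anything about
  distances.\<close>

lemma convex_segment_nearest:
  fixes x0 x p :: "'a::euclidean_space"
  assumes pM: "p \<in> M" and near: "dist x p = infdist x M"
    and c: "0 \<le> c" "c \<le> 1" and x0: "x0 = (1 - c) *\<^sub>R x + c *\<^sub>R p"
  shows "dist x0 p = infdist x0 M"
proof (rule antisym)
  have x0p: "dist x0 p = (1 - c) * dist x p"
  proof -
    have "x0 - p = (1 - c) *\<^sub>R (x - p)" by (simp add: x0 algebra_simps)
    then show ?thesis using c by (simp add: dist_norm)
  qed
  have xx0: "dist x x0 = c * dist x p"
  proof -
    have "x - x0 = c *\<^sub>R (x - p)" by (simp add: x0 algebra_simps)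
    then show ?thesis using c by (simp add: dist_norm)
  qed
  have "infdist x M \<le> infdist x0 M + dist x x0" by (rule infdist_triangle)
  then show "dist x0 p \<le> infdist x0 M" using near x0p xx0 by (simp add: algebra_simps)
  show "infdist x0 M \<le> dist x0 p" by (rule infdist_le[OF pM])
qed

text \<open>The radius \<open>r0\<close> will exceed the tube radius of the theorem:
  \<open>normal_inequality\<close> is available at every \<open>t < r0\<close>, so it can be used
  with the tube radius itself.\<close>

locale unique_projection =
  fixes M :: "'a::euclidean_space set" and r0 :: real and P :: "'a \<Rightarrow> 'a"
  assumes M_compact: "compact M" and M_nonempty: "M \<noteq> {}"
    and P_in: "infdist x M < r0 \<Longrightarrow> P x \<in> M"
    and P_dist: "infdist x M < r0 \<Longrightarrow> dist x (P x) = infdist x M"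
    and P_unique: "infdist x M < r0 \<Longrightarrow> y \<in> M \<Longrightarrow> dist x y = infdist x M \<Longrightarrow> y = P x"
begin

text \<open>A map into a compact set is continuous as soon as its graph is closed. Uniqueness of the
  nearest point identifies the graph with a set of pairs cut out by closed conditions. For it to be
  closed in the whole product, the domain is a sublevel set \<open>infdist x M \<le> t\<close> with
  \<open>t\<close> strictly below \<open>r0\<close>.\<close>

lemma continuous_on_P: "continuous_on {x. infdist x M < r0} P"
proof (intro continuous_at_imp_continuous_on ballI)
  fix x assume "x \<in> {x. infdist x M < r0}"
  then obtain t where t: "infdist x M < t" "t < r0" using dense by auto
  let ?S = "{x. infdist x M \<le> t}"
  have "continuous_on ?S P"
  proof (rule continuous_from_closed_graph[OF M_compact])
    show "P \<in> ?S \<rightarrow> M" using P_in t by auto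
    have eq: "(\<lambda>x. (x, P x)) ` ?S
        = {p. infdist (fst p) M \<le> t \<and> snd p \<in> M \<and> dist (fst p) (snd p) = infdist (fst p) M}"
      using P_in P_dist P_unique t by (auto simp: image_iff)
    have "closed {p::'a \<times> 'a. snd p \<in> M}"
      using closed_vimage[OF compact_imp_closed[OF M_compact] continuous_on_snd[OF continuous_on_id]]
      by (simp add: vimage_def)
    then show "closed ((\<lambda>x. (x, P x)) ` ?S)"
      unfolding eq by (intro closed_Collect_conj closed_Collect_le closed_Collect_eq continuous_intros)
  qed
  then have "continuous_on {x. infdist x M < t} P"
    by (rule continuous_on_subset) auto
  moreover have "open {x. infdist x M < t}" by (intro open_Collect_less continuous_intros)
  ultimately show "isCont P x" using t by (simp add: continuous_on_eq_continuous_at)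
qed

text \<open>A Brouwer fixed point x of the map pushing x0 away from the projection of x has x0 on the
  segment from x to its projection, so x extends the normal ray through x0.\<close>
lemma normal_ray:
  assumes x0: "0 < infdist x0 M" and s: "0 < s" "infdist x0 M + s < r0"
  defines "u \<equiv> (x0 - P x0) /\<^sub>R norm (x0 - P x0)"
  shows "infdist (x0 + s *\<^sub>R u) M = infdist x0 M + s"
proof -
  let ?f = "\<lambda>x. x0 + s *\<^sub>R ((x0 - P x) /\<^sub>R norm (x0 - P x))"
  have sub: "cball x0 s \<subseteq> {x. infdist x M < r0}"
  proof
    fix x assume "x \<in> cball x0 s"
    then have "dist x x0 \<le> s" by (simp add: dist_commute)
    moreover have "infdist x M \<le> infdist x0 M + dist x x0" by (rule infdist_triangle)
    ultimately show "x \<in> {x. infdist x M < r0}" using s by simp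
  qed
  have ne: "x0 - P x \<noteq> 0" if "x \<in> cball x0 s" for x
  proof
    assume "x0 - P x = 0"
    then have "x0 \<in> M" using P_in[of x] sub that by auto
    then show False using x0 by simp
  qed
  obtain x where x: "x \<in> cball x0 s" and fx: "?f x = x"
  proof (rule brouwer_ball[OF s(1)])
    show "continuous_on (cball x0 s) ?f"
      using ne by (intro continuous_intros continuous_on_subset[OF continuous_on_P sub]) auto
    show "?f \<in> cball x0 s \<rightarrow> cball x0 s"
      using ne s by (auto simp: dist_norm)
  qed
  define l where "l = norm (x0 - P x)"
  have l: "l > 0" using ne[OF x] by (simp add: l_def)
  have dx: "infdist x M < r0" using x sub by auto
  \<comment> \<open>The fixed point places \<open>x0\<close> between \<open>x\<close> and
    \<open>P x\<close>, at distance \<open>s\<close> from the former and \<open>l\<close> from the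
    latter; \<open>c\<close> is the resulting weight.\<close>
  define c where "c = s / (l + s)"
  have eqx: "x0 - x = - (s / l) *\<^sub>R (x0 - P x)"
    using fx l by (simp add: l_def divide_inverse algebra_simps)
  have "x0 = (1 - c) *\<^sub>R x + c *\<^sub>R P x"
  proof -
    have "(1 - c) *\<^sub>R x + c *\<^sub>R P x - x0 = (1 - c) *\<^sub>R (x - x0) - c *\<^sub>R (x0 - P x)"
      by (simp add: algebra_simps)
    also have "x - x0 = (s / l) *\<^sub>R (x0 - P x)"
      using eqx by (metis minus_diff_eq scaleR_minus_left minus_minus)
    also have "(1 - c) *\<^sub>R (s / l) *\<^sub>R (x0 - P x) - c *\<^sub>R (x0 - P x)
        = ((1 - c) * (s / l) - c) *\<^sub>R (x0 - P x)"
      by (simp add: scaleR_left_diff_distrib)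
    also have "(1 - c) * (s / l) - c = 0"
      using l s by (simp add: c_def field_simps)
    finally show ?thesis by simp
  qed
  moreover have "0 \<le> c" "c \<le> 1" using l s by (auto simp: c_def)
  ultimately have "dist x0 (P x) = infdist x0 M"
    using convex_segment_nearest[OF P_in[OF dx] P_dist[OF dx]] by blast
  then have PP: "P x = P x0" using P_unique[of x0 "P x"] P_in[OF dx] s by auto
  have xu: "x = x0 + s *\<^sub>R u" using fx PP by (simp add: u_def)
  have "infdist x M = norm (x - P x)" using P_dist[OF dx] by (simp add: dist_norm)
  also have "x - P x = (1 + s / l) *\<^sub>R (x0 - P x)" using eqx by (simp add: algebra_simps)
  also have "norm \<dots> = l + s"
    unfolding norm_scaleR l_def[symmetric] using l s by (simp add: field_simps)
  also have "l = infdist x0 M" using PP P_dist[of x0] s by (simp add: l_def dist_norm)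
  finally show ?thesis using xu by simp
qed

text \<open>By \<open>normal_ray\<close>, the point \<open>x + (t - d) *\<^sub>R u\<close> is at
  distance \<open>t\<close> from M, so the open ball of radius \<open>t\<close> around it misses M
  while its boundary touches M at \<open>P x\<close>. Expanding the squared distance to
  \<open>y\<close> and multiplying by \<open>d\<close> gives the claim, which is Federer's normal
  inequality.\<close>

lemma normal_inequality:
  assumes x: "infdist x M < t" and t: "t < r0" and y: "y \<in> M"
  shows "2 * t * ((x - P x) \<bullet> (y - P x)) \<le> norm (x - P x) * (norm (y - P x))\<^sup>2"
proof (cases "infdist x M = 0")
  case True
  then have "x - P x = 0" using P_dist[of x] x t by (auto simp: dist_norm)
  then show ?thesis by simp
next
  case False
  define d where "d = infdist x M"
  have d: "d > 0" using False infdist_nonneg[of x M] by (simp add: d_def)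
  define u where "u = (x - P x) /\<^sub>R norm (x - P x)"
  have nd: "norm (x - P x) = d" using P_dist[of x] x t by (simp add: d_def dist_norm)
  have nu: "norm u = 1" using d nd by (simp add: u_def)
  have xd: "x - P x = d *\<^sub>R u" using nd d by (simp add: u_def)
  have "infdist (x + (t - d) *\<^sub>R u) M = t"
    using normal_ray[of x "t - d"] d x t by (simp add: d_def u_def)
  then have "t \<le> dist (x + (t - d) *\<^sub>R u) y" using infdist_le[OF y] by metis
  also have "x + (t - d) *\<^sub>R u - y = t *\<^sub>R u - (y - P x)"
    using xd by (simp add: algebra_simps)
  then have "dist (x + (t - d) *\<^sub>R u) y = norm (t *\<^sub>R u - (y - P x))" by (metis dist_norm)
  finally have "t\<^sup>2 \<le> (norm (t *\<^sub>R u - (y - P x)))\<^sup>2"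
    using d x by (intro power_mono) (auto simp: d_def)
  also have "\<dots> = t\<^sup>2 - 2 * t * (u \<bullet> (y - P x)) + (norm (y - P x))\<^sup>2"
    unfolding power2_norm_eq_inner using nu[unfolded norm_eq_1]
    by (simp add: inner_diff_left inner_diff_right inner_commute power2_eq_square algebra_simps)
  finally have "2 * t * (u \<bullet> (y - P x)) \<le> (norm (y - P x))\<^sup>2" by simp
  then have "d * (2 * t * (u \<bullet> (y - P x))) \<le> d * (norm (y - P x))\<^sup>2"
    using d by (intro mult_left_mono) auto
  then show ?thesis unfolding nd unfolding xd by (simp add: algebra_simps)
qed

end

lemma reach_unique_projection:
  assumes M: "compact M" "M \<noteq> {}" and r: "ereal r < reach M"
  obtains r0 where "r < r0" "unique_projection M r0 (\<lambda>x. THE y. y \<in> M \<and> dist x y = infdist x M)"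
proof -
  obtain r0 where r0: "ereal r < ereal r0"
    and u: "\<forall>x. infdist x M < r0 \<longrightarrow> (\<exists>!y. y \<in> M \<and> dist x y = infdist x M)"
    using r unfolding reach_def less_Sup_iff by auto
  have *: "(THE y. y \<in> M \<and> dist x y = infdist x M) \<in> M \<and>
      dist x (THE y. y \<in> M \<and> dist x y = infdist x M) = infdist x M" if "infdist x M < r0" for x
    using theI'[OF u[rule_format, OF that]] .
  show thesis
  proof (rule that)
    show "r < r0" using r0 by simp
    show "unique_projection M r0 (\<lambda>x. THE y. y \<in> M \<and> dist x y = infdist x M)"
    proof
      fix x y assume "infdist x M < r0" "y \<in> M" "dist x y = infdist x M"
      then show "y = (THE y. y \<in> M \<and> dist x y = infdist x M)"
        using u by (intro the1_equality[symmetric]) auto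
    qed (use M * in auto)
  qed
qed

section \<open>Lebesgue differentiation and metric derivatives on the line\<close>

text \<open>Henstock's lemma combined with Vitali covering. Each point of \<open>Bad e\<close> is an
  endpoint of arbitrarily short intervals on which the integral misses \<open>f x\<close> times the
  length by at least \<open>e\<close> times the length. Disjoint such intervals that are fine for
  the Henstock gauge form a tagged partial division, whose total error bounds their total length; by
  Vitali they cover \<open>Bad e\<close> up to a null set.\<close>

lemma negligible_lebesgue_differentiation:
  fixes f :: "real \<Rightarrow> real"
  assumes f: "f integrable_on {a..b}"
  shows "negligible {x \<in> {a<..<b}. \<not> ((\<lambda>u. integral {a..u} f) has_real_derivative f x) (at x)}"
proof -
  define F where "F u = integral {a..u} f" for u
  define Q where "Q x u \<longleftrightarrow> u \<in> {a..b} \<and> u \<noteq> x" for x u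
  define Bad where "Bad e = {x \<in> {a<..<b}. \<forall>d>0. \<exists>u. Q x u \<and> \<bar>u - x\<bar> < d \<and>
    e * \<bar>u - x\<bar> \<le> \<bar>F u - F x - f x * (u - x)\<bar>}" for e
  have FF: "integral {min x u..max x u} f = (if x \<le> u then F u - F x else F x - F u)"
    if "x \<in> {a..b}" "u \<in> {a..b}" for x u
  proof -
    have *: "integral {s..t} f = F t - F s" if "s \<in> {a..b}" "t \<in> {a..b}" "s \<le> t" for s t
    proof -
      have "f integrable_on {a..t}" using f that by (auto intro: integrable_subinterval_real)
      then have "integral {a..s} f + integral {s..t} f = integral {a..t} f"
        using that by (intro Henstock_Kurzweil_Integration.integral_combine) auto
      then show ?thesis by (simp add: F_def)
    qed
    show ?thesis using *[of x u] *[of u x] that by (auto simp: min_def max_def)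
  qed
  have BadD: "a < x" "x < b" if "x \<in> Bad e" for x e using that by (simp_all add: Bad_def)
  have neg: "negligible (Bad e)" if e: "e > 0" for e
  proof (rule iffD2[OF negligible_outer_le], intro allI impI)
    fix \<epsilon> :: real assume \<epsilon>: "\<epsilon> > 0"
    have f': "f integrable_on cbox a b" using f by simp
    \<comment> \<open>With tolerance \<open>\<epsilon> * e\<close>, intervals whose error is at
      least \<open>e\<close> times their length have total length below
      \<open>\<epsilon>\<close>.\<close>
    obtain \<gamma> where g: "gauge \<gamma>" and H: "\<And>p. \<lbrakk>p tagged_partial_division_of (cbox a b); \<gamma> fine p\<rbrakk> \<Longrightarrow>
             sum (\<lambda>(x,k). norm(measure lborel k *\<^sub>R f x - integral k f)) p < \<epsilon> * e"
      using Henstock_lemma[OF f', of "\<epsilon> * e"] e \<epsilon> by auto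
    \<comment> \<open>A pair \<open>(x,u)\<close> encodes the interval with tag \<open>x\<close> and
      other endpoint \<open>u\<close>, on either side of the tag. Below, \<open>c\<close> and
      \<open>r\<close> present it as a ball, the shape used by the covering theorem.\<close>
    define K where "K = {(x,u). x \<in> Bad e \<and> Q x u \<and> {min x u..max x u} \<subseteq> \<gamma> x \<and>
       e * \<bar>u - x\<bar> \<le> \<bar>F u - F x - f x * (u - x)\<bar>}"
    define c where "c = (\<lambda>(x::real,u). (x + u) / 2)"
    define r where "r = (\<lambda>(x::real,u). \<bar>u - x\<bar> / 2)"
    have cb: "cball (c (x,u)) (r (x,u)) = {min x u..max x u}" for x u
      by (auto simp: cball_eq_atLeastAtMost c_def r_def min_def max_def abs_if field_simps)
    have V1: "\<exists>i. i \<in> K \<and> x \<in> cball (c i) (r i) \<and> r i < d" if x: "x \<in> Bad e" and d: "0 < d" for x d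
    proof -
      have "open (\<gamma> x)" "x \<in> \<gamma> x" using g by (auto simp: gauge_def)
      then obtain \<delta> where \<delta>: "\<delta> > 0" "cball x \<delta> \<subseteq> \<gamma> x" using open_contains_cball by blast
      obtain u where u: "Q x u" "\<bar>u - x\<bar> < min d \<delta>" "e * \<bar>u - x\<bar> \<le> \<bar>F u - F x - f x * (u - x)\<bar>"
      proof -
        have "0 < min d \<delta>" using d \<delta> by simp
        then show ?thesis using x that unfolding Bad_def by blast
      qed
      have "{min x u..max x u} \<subseteq> cball x \<delta>" using u(2) by (auto simp: dist_real_def)
      then have "(x,u) \<in> K" using x u \<delta> by (auto simp: K_def)
      moreover have "x \<in> cball (c (x,u)) (r (x,u))" unfolding cb by auto
      moreover have "r (x,u) < d" using u(2) d by (simp add: r_def)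
      ultimately show ?thesis by blast
    qed
    have V2: "0 < r i" if "i \<in> K" for i using that by (auto simp: K_def r_def Q_def)
    obtain C where C: "countable C" "C \<subseteq> K"
      and pw: "pairwise (\<lambda>i j. disjnt (cball (c i) (r i)) (cball (c j) (r j))) C"
      and cov: "negligible (Bad e - (\<Union>i\<in>C. cball (c i) (r i)))"
      by (rule Vitali_covering_theorem_cballs[of K r "Bad e" c, OF V2 V1])
    \<comment> \<open>Henstock's lemma is about finite divisions, so finite subfamilies are bounded
      first; the bound then passes to the countable family.\<close>
    have fin: "measure lebesgue (\<Union>i\<in>D. cball (c i) (r i)) \<le> \<epsilon>" if D: "D \<subseteq> C" "finite D" for D
    proof -
      define h where "h = (\<lambda>(x::real,u). (x, {min x u..max x u}))"
      have inj: "inj_on h D"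
      proof (rule inj_onI)
        fix i j assume "i \<in> D" "j \<in> D" and eq: "h i = h j"
        then show "i = j"
          by (cases i; cases j) (simp add: h_def Icc_eq_Icc min_def max_def split: if_splits)
      qed
      have DK: "i \<in> K" if "i \<in> D" for i using D C that by auto
      have tp: "h ` D tagged_partial_division_of (cbox a b)"
        unfolding tagged_partial_division_of_def
      proof (intro conjI allI impI)
        show "finite (h ` D)" using D by simp
      next
        fix x k assume "(x, k) \<in> h ` D"
        then obtain u where u: "(x,u) \<in> D" "k = {min x u..max x u}" by (auto simp: h_def)
        have "x \<in> {a..b}" "u \<in> {a..b}"
          using DK[OF u(1)] BadD[of x e] by (simp_all add: K_def Q_def)
        then show "x \<in> k" "k \<subseteq> cbox a b" "\<exists>a b. k = cbox a b" using u by auto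
      next
        fix x1 k1 x2 k2 assume *: "(x1, k1) \<in> h ` D \<and> (x2, k2) \<in> h ` D \<and> (x1,k1) \<noteq> (x2,k2)"
        then have ne: "(x1,k1) \<noteq> (x2,k2)" by blast
        from * obtain u1 u2 where u: "(x1,u1) \<in> D" "k1 = {min x1 u1..max x1 u1}"
           "(x2,u2) \<in> D" "k2 = {min x2 u2..max x2 u2}" by (auto simp: h_def)
        then have "(x1,u1) \<noteq> (x2,u2)" using ne u by auto
        then have "disjnt k1 k2" using pw u D unfolding pairwise_def u(2,4) cb[symmetric] by blast
        then show "interior k1 \<inter> interior k2 = {}"
          using interior_subset[of k1] interior_subset[of k2] by (auto simp: disjnt_def)
      qed
      have fine: "\<gamma> fine h ` D" using DK by (auto simp: fine_def h_def K_def)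
      have "e * (\<Sum>i\<in>D. measure lebesgue (cball (c i) (r i)))
          = (\<Sum>i\<in>D. e * measure lebesgue (cball (c i) (r i)))" by (rule sum_distrib_left)
      also have "\<dots> \<le> (\<Sum>i\<in>D. (\<lambda>(x,k). norm(measure lborel k *\<^sub>R f x - integral k f)) (h i))"
      proof (rule sum_mono)
        fix i assume iD: "i \<in> D"
        obtain x u where i: "i = (x,u)" by (cases i)
        have *: "(x,u) \<in> K" using DK iD i by auto
        then have xu: "x \<in> {a..b}" "u \<in> {a..b}" and le: "e * \<bar>u - x\<bar> \<le> \<bar>F u - F x - f x * (u - x)\<bar>"
          using BadD[of x e] by (simp_all add: K_def Q_def)
        have "measure lborel {min x u..max x u} = \<bar>u - x\<bar>" by (auto simp: min_def max_def)
        moreover have "norm (\<bar>u - x\<bar> *\<^sub>R f x - integral {min x u..max x u} f) = \<bar>F u - F x - f x * (u - x)\<bar>"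
          unfolding FF[OF xu] by (auto simp: algebra_simps abs_if)
        ultimately show "e * measure lebesgue (cball (c i) (r i)) \<le> (\<lambda>(x,k). norm(measure lborel k *\<^sub>R f x - integral k f)) (h i)"
          unfolding i cb using le by (simp add: h_def)
      qed
      also have "\<dots> = sum (\<lambda>(x,k). norm(measure lborel k *\<^sub>R f x - integral k f)) (h ` D)"
        using inj by (simp add: sum.reindex)
      also have "\<dots> < \<epsilon> * e" by (rule H[OF tp fine])
      finally have "(\<Sum>i\<in>D. measure lebesgue (cball (c i) (r i))) < \<epsilon>" using e by simp
      moreover have "measure lebesgue (\<Union>i\<in>D. cball (c i) (r i)) \<le> (\<Sum>i\<in>D. measure lebesgue (cball (c i) (r i)))"
        by (rule measure_UNION_le) (use D in auto)
      ultimately show ?thesis by simp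
    qed
    let ?U = "\<Union>i\<in>C. cball (c i) (r i)"
    have U: "?U \<in> lmeasurable" "measure lebesgue ?U \<le> \<epsilon>"
      using fmeasurable_UN_bound[OF C(1), of "\<lambda>i. cball (c i) (r i)" lebesgue \<epsilon>]
        measure_UN_bound[OF C(1), of "\<lambda>i. cball (c i) (r i)" lebesgue \<epsilon>] fin by auto
    show "\<exists>T. Bad e \<subseteq> T \<and> T \<in> lmeasurable \<and> measure lebesgue T \<le> \<epsilon>"
    proof (intro exI conjI)
      let ?T = "?U \<union> (Bad e - ?U)"
      show "Bad e \<subseteq> ?T" by auto
      have n: "Bad e - ?U \<in> null_sets lebesgue" using cov by (simp add: negligible_iff_null_sets)
      show "?T \<in> lmeasurable" using U n by (intro fmeasurable.Un) (auto simp: negligible_imp_measurable cov)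
      have "measure lebesgue ?T = measure lebesgue ?U"
        using U n by (intro measure_Un_null_set) auto
      then show "measure lebesgue ?T \<le> \<epsilon>" using U by simp
    qed
  qed
  have "negligible (\<Union>n::nat. Bad (1 / Suc n))"
    by (rule negligible_countable_Union) (auto intro: neg)
  moreover have "{x \<in> {a<..<b}. \<not> ((\<lambda>u. integral {a..u} f) has_real_derivative f x) (at x)}
      \<subseteq> (\<Union>n::nat. Bad (1 / Suc n))"
  proof (rule ccontr)
    assume "\<not> {x \<in> {a<..<b}. \<not> ((\<lambda>u. integral {a..u} f) has_real_derivative f x) (at x)} \<subseteq> (\<Union>n::nat. Bad (1 / Suc n))"
    then obtain x where x: "x \<in> {a<..<b}" and nd: "\<not> (F has_real_derivative f x) (at x)"
      and nb: "\<And>n::nat. x \<notin> Bad (1 / Suc n)" unfolding F_def by blast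
    have "((\<lambda>u. (F u - F x) / (u - x)) \<longlongrightarrow> f x) (at x)"
    proof (rule tendstoI)
      fix e :: real assume "e > 0"
      then obtain n where n: "1 / real (Suc n) < e" using nat_approx_posE by blast
      obtain d where d: "d > 0" and dd: "\<And>u. Q x u \<Longrightarrow> \<bar>u - x\<bar> < d \<Longrightarrow>
          \<bar>F u - F x - f x * (u - x)\<bar> < 1 / Suc n * \<bar>u - x\<bar>"
        using nb[of n] x unfolding Bad_def by (auto simp: not_le)
      show "\<forall>\<^sub>F u in at x. dist ((F u - F x) / (u - x)) (f x) < e"
        unfolding eventually_at
      proof (intro exI[of _ "min d (min (x - a) (b - x))"] conjI ballI impI)
        show "0 < min d (min (x - a) (b - x))" using d x by auto
        fix u assume u: "u \<noteq> x \<and> dist u x < min d (min (x - a) (b - x))"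
        then have "\<bar>F u - F x - f x * (u - x)\<bar> < 1 / Suc n * \<bar>u - x\<bar>"
          by (intro dd) (auto simp: dist_real_def Q_def)
        also have "\<dots> \<le> e * \<bar>u - x\<bar>" using n by (intro mult_right_mono) auto
        finally have lt: "\<bar>F u - F x - f x * (u - x)\<bar> < e * \<bar>u - x\<bar>" .
        have "(F u - F x) / (u - x) - f x = (F u - F x - f x * (u - x)) / (u - x)"
          using u by (simp add: field_simps)
        then show "dist ((F u - F x) / (u - x)) (f x) < e"
          using lt u by (simp add: dist_real_def abs_divide divide_less_eq)
      qed
    qed
    then show False using nd by (simp add: has_field_derivative_iff)
  qed
  ultimately show ?thesis by (rule negligible_subset)
qed

lemma AE_lebesgue_differentiation:
  fixes f :: "real \<Rightarrow> real"
  assumes f: "integrable lborel f"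
  shows "AE x in lborel. x \<in> {a<..<b} \<longrightarrow> ((\<lambda>u. integral {a..u} f) has_real_derivative f x) (at x)"
proof -
  have "f integrable_on {a..b}"
    using f by (intro integrable_on_lborel[THEN integrable_on_subinterval]) auto
  note negligible_lebesgue_differentiation[OF this]
  then have "AE x in lebesgue. x \<notin> {x \<in> {a<..<b}. \<not> ((\<lambda>u. integral {a..u} f) has_real_derivative f x) (at x)}"
    by (intro AE_not_in) (simp add: negligible_iff_null_sets)
  then have "AE x in completion lborel. x \<in> {a<..<b} \<longrightarrow> ((\<lambda>u. integral {a..u} f) has_real_derivative f x) (at x)"
    by auto
  then show ?thesis by (simp only: AE_completion_iff)
qed

lemma integrable_imp_set_integrable:
  fixes f :: "'a \<Rightarrow> 'b::{banach, second_countable_topology}"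
  assumes "integrable M f" "A \<in> sets M"
  shows "set_integrable M A f"
  unfolding set_integrable_def using assms by (intro integrable_mult_indicator)

lemma measure_density_set_integral:
  fixes g :: "'a \<Rightarrow> real"
  assumes g: "integrable M g" "\<And>x. 0 \<le> g x" and A: "A \<in> sets M"
  shows "measure (density M (\<lambda>x. ennreal (g x))) A = (LINT x:A|M. g x)"
proof -
  have "emeasure (density M (\<lambda>x. ennreal (g x))) A = (\<integral>\<^sup>+x. ennreal (indicator A x *\<^sub>R g x) \<partial>M)"
    using A borel_measurable_integrable[OF g(1)]
    by (subst emeasure_density) (auto intro!: nn_integral_cong simp: indicator_def)
  also have "\<dots> = ennreal (LINT x:A|M. g x)"
    unfolding set_lebesgue_integral_def
    using A g by (intro nn_integral_eq_integral integrable_mult_indicator) auto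
  finally show ?thesis
    unfolding measure_def set_lebesgue_integral_def using g by simp
qed

text \<open>Let \<open>\<mu>\<close> have density \<open>m\<close>. Since the increments of
  \<open>\<phi>\<close> are dominated by those of \<open>cdf \<mu>\<close>, both
  \<open>cdf \<mu> + \<phi>\<close> and \<open>cdf \<mu> - \<phi>\<close> are monotone and generate
  measures, which add up to twice \<open>\<mu>\<close>. So the first measure is absolutely
  continuous, and its Radon-Nikodym density minus \<open>m\<close> is a density for
  \<open>\<phi>\<close>.\<close>

lemma absolutely_continuous_has_density:
  fixes \<phi> m :: "real \<Rightarrow> real"
  assumes m: "integrable lborel m" and m0: "\<And>t. 0 \<le> m t"
    and \<phi>: "\<And>s t. s \<le> t \<Longrightarrow> \<bar>\<phi> t - \<phi> s\<bar> \<le> (LINT u:{s..t}|lborel. m u)"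
  obtains g where "integrable lborel g" "\<And>s t. s \<le> t \<Longrightarrow> \<phi> t - \<phi> s = (LINT u:{s..t}|lborel. g u)"
proof -
  have [measurable]: "m \<in> borel_measurable borel" using borel_measurable_integrable[OF m] by simp
  define \<mu> where "\<mu> = density lborel (\<lambda>t. ennreal (m t))"
  have fin\<mu>: "emeasure \<mu> UNIV < \<infinity>"
    using m m0 by (simp add: \<mu>_def emeasure_density nn_integral_eq_integral)
  interpret \<mu>: finite_borel_measure \<mu>
    by (intro finite_borel_measure.intro finite_measureI finite_borel_measure_axioms.intro)
       (use fin\<mu> in \<open>auto simp: \<mu>_def\<close>)
  have \<mu>_eq: "measure \<mu> A = (LINT u:A|lborel. m u)" if "A \<in> sets borel" for A
    unfolding \<mu>_def using m m0 that by (intro measure_density_set_integral) auto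
  have \<mu>_null: "A \<in> null_sets \<mu>" if "A \<in> null_sets lborel" for A
    using absolutely_continuousI_density[of "\<lambda>t. ennreal (m t)" lborel] that
    by (auto simp: absolutely_continuous_def \<mu>_def)
  have point: "{s} \<in> null_sets lborel" for s :: real by (simp add: null_sets_def)
  have Icc: "measure \<nu> {s..t} = measure \<nu> {s<..t}"
    if "sets \<nu> = sets borel" "emeasure \<nu> {s} = 0" "s \<le> t" for \<nu> :: "real measure" and s t
  proof -
    have "{s..t} = {s<..t} \<union> {s}" using that by auto
    then show ?thesis using that
      by (metis measure_Un_null_set null_setsI borel_singleton greaterThanAtMost_borel sets.empty_sets)
  qed
  have cdf_le: "cdf \<mu> t - cdf \<mu> s = (LINT u:{s..t}|lborel. m u)" if "s \<le> t" for s t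
  proof (cases "s = t")
    case True
    then show ?thesis using \<mu>_eq[of "{t}"] \<mu>_null[OF point, of t] by (auto simp: measure_def null_sets_def)
  next
    case False
    then have "cdf \<mu> t - cdf \<mu> s = measure \<mu> {s<..t}" using that by (intro \<mu>.cdf_diff_eq) auto
    also have "\<dots> = measure \<mu> {s..t}" using \<mu>_null[OF point, of s] that
      by (intro Icc[symmetric]) (auto simp: null_sets_def \<mu>_def)
    finally show ?thesis by (simp add: \<mu>_eq)
  qed
  \<comment> \<open>The sign \<open>c\<close> treats \<open>F\<close> and \<open>F'\<close> at once.
    Right continuity and finite mass are inherited from \<open>cdf \<mu>\<close> through the
    domination \<open>diff\<close>.\<close>
  have *: "mono F \<and> (\<forall>a. continuous (at_right a) F) \<and> finite_measure (interval_measure F)"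
    if F: "F = (\<lambda>t. cdf \<mu> t + c * \<phi> t)" and c: "\<bar>c\<bar> = 1" for F c
  proof -
    have diff: "\<bar>c * \<phi> t - c * \<phi> s\<bar> \<le> cdf \<mu> t - cdf \<mu> s" if "s \<le> t" for s t
    proof -
      have "\<bar>c * \<phi> t - c * \<phi> s\<bar> = \<bar>\<phi> t - \<phi> s\<bar>"
        using c by (metis abs_mult mult_1 right_diff_distrib)
      then show ?thesis using \<phi>[OF that] cdf_le[OF that] by simp
    qed
    have mono: "mono F"
    proof (rule monoI)
      fix s t :: real assume "s \<le> t"
      then show "F s \<le> F t" using diff[of s t] by (auto simp: F)
    qed
    have rc: "continuous (at_right a) F" for a
    proof -
      have "(cdf \<mu> \<longlongrightarrow> cdf \<mu> a) (at_right a)"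
        using \<mu>.cdf_is_right_cont[of a] by (simp add: continuous_within)
      then have "((\<lambda>t. cdf \<mu> t - cdf \<mu> a) \<longlongrightarrow> 0) (at_right a)" by (simp add: LIM_zero)
      then have "((\<lambda>t. c * \<phi> t - c * \<phi> a) \<longlongrightarrow> 0) (at_right a)"
        by (rule Lim_null_comparison[rotated])
           (use diff in \<open>auto simp: eventually_at_filter intro!: always_eventually\<close>)
      then have "((\<lambda>t. c * \<phi> t) \<longlongrightarrow> c * \<phi> a) (at_right a)" by (simp add: LIM_zero_iff)
      with \<open>(cdf \<mu> \<longlongrightarrow> cdf \<mu> a) (at_right a)\<close> show ?thesis
        unfolding F continuous_within by (rule tendsto_add)
    qed
    have "emeasure (interval_measure F) UNIV \<le> ennreal (2 * measure \<mu> UNIV)"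
    proof -
      have U: "UNIV = (\<Union>n::nat. {- real n<..real n})"
      proof safe
        fix x :: real
        obtain n where "\<bar>x\<bar> < real n" using reals_Archimedean2 by blast
        then show "x \<in> (\<Union>n::nat. {- real n<..real n})" by (auto intro!: exI[of _ n])
      qed auto
      have "emeasure (interval_measure F) {- real n<..real n} \<le> ennreal (2 * measure \<mu> UNIV)" for n
      proof -
        have "F n - F (- real n) \<le> 2 * (cdf \<mu> n - cdf \<mu> (- real n))"
          using diff[of "- real n" n] by (simp add: F)
        moreover have "cdf \<mu> n \<le> measure \<mu> UNIV" unfolding cdf_def by (rule \<mu>.finite_measure_mono) auto
        moreover have "0 \<le> cdf \<mu> (- real n)" unfolding cdf_def by simp
        ultimately have "F n - F (- real n) \<le> 2 * measure \<mu> UNIV" by (smt (verit))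
        then show ?thesis
          using mono rc by (subst emeasure_interval_measure_Ioc) (auto simp: mono_def)
      qed
      moreover have "emeasure (interval_measure F) UNIV = (SUP n. emeasure (interval_measure F) {- real n<..real n})"
        by (subst U, rule SUP_emeasure_incseq[symmetric]) (auto simp: incseq_def)
      ultimately show ?thesis by (simp add: SUP_le_iff)
    qed
    then have "emeasure (interval_measure F) UNIV \<noteq> \<infinity>" by (metis ennreal_neq_top infinity_ennreal_def top.extremum_uniqueI)
    then have "finite_measure (interval_measure F)" by (intro finite_measureI) simp
    with mono rc show ?thesis by blast
  qed
  define F F' where "F = (\<lambda>t. cdf \<mu> t + 1 * \<phi> t)" and "F' = (\<lambda>t. cdf \<mu> t + (-1) * \<phi> t)"
  have F: "mono F" "\<And>a. continuous (at_right a) F" and Ffin: "finite_measure (interval_measure F)"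
    using *[of F 1] by (auto simp: F_def)
  have F': "mono F'" "\<And>a. continuous (at_right a) F'" and F'fin: "finite_measure (interval_measure F')"
    using *[of F' "-1"] by (auto simp: F'_def)
  interpret N: finite_measure "interval_measure F" by fact
  interpret N': finite_measure "interval_measure F'" by fact
  have Ioc: "measure (interval_measure F) {s<..t} = F t - F s"
    "measure (interval_measure F') {s<..t} = F' t - F' s" if "s \<le> t" for s t
    using measure_interval_measure_Ioc[OF that, of F] measure_interval_measure_Ioc[OF that, of F'] F F'
    by (auto simp: mono_def)
  define G where "G = {{a<..b} |a b :: real. True}"
  \<comment> \<open>A Dynkin argument: half-open intervals are stable under intersection, and all
    three measures are finite. The total masses are compared separately because the complement step
    uses them.\<close>
  have sum: "measure (interval_measure F) A + measure (interval_measure F') A = 2 * measure \<mu> A"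
    if "A \<in> sigma_sets UNIV G" for A
  proof -
    have bor: "sigma_sets UNIV G = sets borel"
      unfolding borel_sigma_sets_Ioc G_def by (simp add: image_def full_SetCompr_eq) 
    have base: "measure (interval_measure F) A + measure (interval_measure F') A = 2 * measure \<mu> A" if AG: "A \<in> G" for A
    proof -
      obtain a b where A: "A = {a<..b}" using AG by (auto simp: G_def)
      show ?thesis
      proof (cases "a < b")
        case True
        then show ?thesis using Ioc[of a b] \<mu>.cdf_diff_eq[of a b] by (simp add: A F_def F'_def)
      qed (simp add: A)
    qed
    have istable: "Int_stable G" unfolding G_def Int_stable_def
    proof safe
      fix a b c d :: real
      have "{a<..b} \<inter> {c<..d} = {max a c<..min b d}" by auto
      then show "\<exists>a' b'. {a<..b} \<inter> {c<..d} = {a'<..b'} \<and> True" by blast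
    qed
    have U: "UNIV \<in> sigma_sets UNIV G" by (rule sigma_sets_top)
    have univ: "measure (interval_measure F) UNIV + measure (interval_measure F') UNIV = 2 * measure \<mu> UNIV"
    proof -
      let ?A = "\<lambda>n::nat. {- real n<..real n}"
      have UN: "(\<Union>n. ?A n) = UNIV"
      proof safe
        fix x :: real
        obtain n where "\<bar>x\<bar> < real n" using reals_Archimedean2 by blast
        then show "x \<in> (\<Union>n::nat. {- real n<..real n})" by (auto intro!: exI[of _ n])
      qed auto
      have inc: "incseq ?A" by (auto simp: incseq_def)
      have rb: "range ?A \<subseteq> sets borel" by auto
      have r\<mu>: "range ?A \<subseteq> sets \<mu>" by (auto simp: \<mu>_def)
      have "(\<lambda>n. measure (interval_measure F) (?A n) + measure (interval_measure F') (?A n))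
          \<longlonglongrightarrow> measure (interval_measure F) UNIV + measure (interval_measure F') UNIV"
        using N.finite_Lim_measure_incseq[OF _ inc] N'.finite_Lim_measure_incseq[OF _ inc] rb
        unfolding UN by (intro tendsto_add) simp_all
      moreover have "(\<lambda>n. measure (interval_measure F) (?A n) + measure (interval_measure F') (?A n))
          = (\<lambda>n. 2 * measure \<mu> (?A n))" by (intro ext base) (auto simp: G_def)
      moreover have "(\<lambda>n. 2 * measure \<mu> (?A n)) \<longlonglongrightarrow> 2 * measure \<mu> UNIV"
        using \<mu>.finite_Lim_measure_incseq[OF r\<mu> inc] unfolding UN by (intro tendsto_mult tendsto_const)
      ultimately show ?thesis using LIMSEQ_unique by metis
    qed
    have GP: "G \<subseteq> Pow UNIV" by simp
    show ?thesis
      using istable GP that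
    proof (induct A rule: sigma_sets_induct_disjoint)
      case (basic A) then show ?case by (rule base)
    next
      case empty then show ?case by simp
    next
      case (compl A)
      then have "A \<in> sets borel" using bor by simp
      then have "measure (interval_measure F) (UNIV - A) = measure (interval_measure F) UNIV - measure (interval_measure F) A"
        "measure (interval_measure F') (UNIV - A) = measure (interval_measure F') UNIV - measure (interval_measure F') A"
        "measure \<mu> (UNIV - A) = measure \<mu> UNIV - measure \<mu> A"
        using N.finite_measure_compl[of A] N'.finite_measure_compl[of A] \<mu>.finite_measure_compl[of A]
        by (auto simp: \<mu>_def)
      then show ?case using compl univ by simp
    next
      case (union A)
      then have r: "range A \<subseteq> sets borel" using bor by auto
      have "(\<lambda>i. measure (interval_measure F) (A i) + measure (interval_measure F') (A i)) sums
         (measure (interval_measure F) (\<Union>i. A i) + measure (interval_measure F') (\<Union>i. A i))"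
        using N.finite_measure_UNION[of A] N'.finite_measure_UNION[of A] r union(1) by (intro sums_add) auto
      moreover have "(\<lambda>i. 2 * measure \<mu> (A i)) sums (2 * measure \<mu> (\<Union>i. A i))"
        using \<mu>.finite_measure_UNION[of A] r union(1) by (intro sums_mult) auto
      ultimately show ?case using union(3) sums_unique2 by force
    qed
  qed
  have bor: "sigma_sets UNIV G = sets borel"
      unfolding borel_sigma_sets_Ioc G_def by (simp add: image_def full_SetCompr_eq) 
  have ac: "absolutely_continuous lborel (interval_measure F)"
    unfolding absolutely_continuous_def
  proof
    fix A :: "real set" assume A: "A \<in> null_sets lborel"
    then have "A \<in> sigma_sets UNIV G" using bor by (auto simp: null_sets_def)
    moreover have "measure \<mu> A = 0" using \<mu>_null[OF A] by (auto simp: null_sets_def measure_def)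
    ultimately have "measure (interval_measure F) A + measure (interval_measure F') A = 0" using sum by simp
    then have "measure (interval_measure F) A = 0" by (smt (verit) measure_nonneg)
    then show "A \<in> null_sets (interval_measure F)"
      using A by (auto simp: null_sets_def N.emeasure_eq_measure)
  qed
  obtain f where f[measurable]: "f \<in> borel_measurable lborel" and dens: "density lborel f = interval_measure F"
    using sigma_finite_measure.Radon_Nikodym[OF sigma_finite_lborel ac] by auto
  have fint: "(\<integral>\<^sup>+x. f x \<partial>lborel) = emeasure (interval_measure F) UNIV"
    by (simp add: dens[symmetric] emeasure_density)
  then have finf: "AE x in lborel. f x \<noteq> \<infinity>"
    using N.emeasure_finite by (intro nn_integral_noteq_infinite) auto
  define g where "g x = enn2real (f x)" for x
  have eg: "AE x in lborel. ennreal (g x) = f x" using finf by eventually_elim (auto simp: g_def top.not_eq_extremum)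
  have g0: "g x \<ge> 0" for x by (simp add: g_def)
  have [measurable]: "g \<in> borel_measurable borel" using f by (simp add: g_def[abs_def])
  have gint: "integrable lborel g"
  proof (rule integrableI_nonneg)
    have "(\<integral>\<^sup>+x. ennreal (g x) \<partial>lborel) = (\<integral>\<^sup>+x. f x \<partial>lborel)" by (rule nn_integral_cong_AE[OF eg])
    then show "(\<integral>\<^sup>+x. ennreal (g x) \<partial>lborel) < \<infinity>"
      using fint N.emeasure_finite[of UNIV] by (simp add: less_top[symmetric])
  qed (auto simp: g0)
  have Ng: "measure (interval_measure F) A = (LINT u:A|lborel. g u)" if A: "A \<in> sets borel" for A
  proof -
    have "interval_measure F = density lborel (\<lambda>x. ennreal (g x))"
      unfolding dens[symmetric] using eg by (intro density_cong) (auto elim!: eventually_mono)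
    then show ?thesis using measure_density_set_integral[OF gint g0, of A] A by simp
  qed
  show thesis
  proof (rule that[of "\<lambda>u. g u - m u"])
    show "integrable lborel (\<lambda>u. g u - m u)" using gint m by simp
    fix s t :: real assume st: "s \<le> t"
    have "emeasure (interval_measure F) {s} = 0" 
      using ac point[of s] unfolding absolutely_continuous_def by (intro null_setsD1) blast
    then have "F t - F s = (LINT u:{s..t}|lborel. g u)"
      using Icc[of "interval_measure F" s t] st Ioc(1)[OF st] Ng[of "{s..t}"] by simp
    moreover have "set_integrable lborel {s..t} g" "set_integrable lborel {s..t} m"
      using gint m by (auto intro!: integrable_imp_set_integrable)
    ultimately show "\<phi> t - \<phi> s = (LINT u:{s..t}|lborel. g u - m u)"
      using cdf_le[OF st] by (simp add: set_integral_diff F_def)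
  qed
qed

text \<open>Writing the interval with \<open>min\<close> and \<open>max\<close> lets one formula
  cover quotients from both sides, as the two-sided limit in \<open>mderiv\<close> requires.\<close>

lemma difference_quotient_AE:
  fixes f :: "real \<Rightarrow> real"
  assumes f: "integrable lborel f"
  shows "AE t in lborel. t \<in> {0<..<T} \<longrightarrow>
    ((\<lambda>h. (LINT u:{min t (t + h)..max t (t + h)}|lborel. f u) / \<bar>h\<bar>) \<longlongrightarrow> f t) (at 0)"
  using AE_lebesgue_differentiation[OF f, of 0 T]
proof eventually_elim
  case (elim t)
  show ?case
  proof
    assume t: "t \<in> {0<..<T}"
    define F where "F u = integral {0..u} f" for u
    have fi: "f integrable_on {a..b}" for a b
      using f by (intro integrable_on_lborel[THEN integrable_on_subinterval]) auto
    have LI: "(LINT u:{a..b}|lborel. f u) = integral {a..b} f" for a b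
      using f by (intro set_borel_integral_eq_integral) (auto intro!: integrable_imp_set_integrable)
    have LF: "(LINT u:{a..b}|lborel. f u) = F b - F a" if "0 \<le> a" "a \<le> b" for a b
      using Henstock_Kurzweil_Integration.integral_combine[of 0 a b f] that fi by (simp add: LI F_def)
    have "((\<lambda>u. (F u - F t) / (u - t)) \<longlongrightarrow> f t) (at t)"
      using elim t unfolding F_def[symmetric] by (simp add: has_field_derivative_iff)
    then have lim: "((\<lambda>h. (F (t + h) - F t) / h) \<longlongrightarrow> f t) (at 0)"
      by (subst (asm) LIM_offset_zero_iff[of t]) auto
    show "((\<lambda>h. (LINT u:{min t (t + h)..max t (t + h)}|lborel. f u) / \<bar>h\<bar>) \<longlongrightarrow> f t) (at 0)"
    proof (rule Lim_transform_eventually[OF lim])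
      have "eventually (\<lambda>h. h \<in> {-t<..<t}) (at 0)"
        using t by (intro eventually_at_in_open') auto
      then show "\<forall>\<^sub>F h in at 0. (F (t + h) - F t) / h
          = (LINT u:{min t (t + h)..max t (t + h)}|lborel. f u) / \<bar>h\<bar>"
      proof eventually_elim
        case (elim h)
        show ?case
        proof (cases "h \<ge> 0")
          case True
          then show ?thesis using LF[of t "t + h"] t by (simp add: min_def max_def)
        next
          case False
          then have "(LINT u:{t + h..t}|lborel. f u) / \<bar>h\<bar> = (F t - F (t + h)) / - h"
            using LF[of "t + h" t] elim by simp
          also have "\<dots> = (F (t + h) - F t) / h" using False by (simp add: field_simps)
          finally show ?thesis using False by (simp add: min_def max_def)
        qed
      qed
    qed
  qed
qed

text \<open>The candidate is the supremum of the absolute derivatives of the distances to countably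
  many points \<open>x n\<close>, dense in time. By the triangle inequality the increments of each
  such distance are at most \<open>D\<close>, which bounds the quotients of \<open>D\<close> from
  below. Density bounds \<open>D\<close> by the integral of \<open>v\<close>, and Lebesgue
  differentiation of \<open>v\<close> bounds the quotients from above.\<close>

lemma metric_derivative:
  fixes D :: "real \<Rightarrow> real \<Rightarrow> real"
  assumes m: "integrable lborel m" and m0: "\<And>t. 0 \<le> m t"
    and D0: "\<And>s. s \<in> {0..T} \<Longrightarrow> D s s = 0"
    and Dsym: "\<And>s t. s \<in> {0..T} \<Longrightarrow> t \<in> {0..T} \<Longrightarrow> D s t = D t s"
    and Dtri: "\<And>s t u. s \<in> {0..T} \<Longrightarrow> t \<in> {0..T} \<Longrightarrow> u \<in> {0..T} \<Longrightarrow> D s u \<le> D s t + D t u"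
    and Dm: "\<And>s t. 0 \<le> s \<Longrightarrow> s \<le> t \<Longrightarrow> t \<le> T \<Longrightarrow> D s t \<le> (LINT u:{s..t}|lborel. m u)"
    and T: "0 < T"
  obtains v where "v \<in> borel_measurable borel" "\<And>t. 0 \<le> v t" "integrable lborel v"
    "AE t in lborel. t \<in> {0<..<T} \<longrightarrow> ((\<lambda>h. D t (t + h) / \<bar>h\<bar>) \<longlongrightarrow> v t) (at 0)"
    "\<And>s t. 0 \<le> s \<Longrightarrow> s \<le> t \<Longrightarrow> t \<le> T \<Longrightarrow> D s t \<le> (LINT u:{s..t}|lborel. v u)"
proof -
  \<comment> \<open>Times are clipped to \<open>{0..T}\<close> because
    \<open>absolutely_continuous_has_density\<close> is about functions on the whole line.\<close>
  define c where "c t = max 0 (min T t)" for t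
  have c: "c t \<in> {0..T}" for t using T by (auto simp: c_def)
  have cid: "t \<in> {0..T} \<Longrightarrow> c t = t" for t by (auto simp: c_def)
  obtain q :: "nat \<Rightarrow> real" where q: "\<And>x e. e > 0 \<Longrightarrow> \<exists>n. \<bar>q n - x\<bar> < e"
  proof
    fix x e :: real assume "e > 0"
    then obtain r where r: "r \<in> \<rat>" "x < r" "r < x + e" using Rats_dense_in_real[of x "x + e"] by auto
    then obtain p where "r = of_rat p" by (auto elim: Rats_cases)
    then have "\<bar>of_rat (nat_to_rat_surj (inv nat_to_rat_surj p)) - x\<bar> < e"
      using r surj_nat_to_rat_surj by (simp add: surj_f_inv_f)
    then show "\<exists>n. \<bar>(real_of_rat \<circ> nat_to_rat_surj) n - x\<bar> < e" by auto
  qed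
  define x where "x n = c (q n)" for n
  have x: "x n \<in> {0..T}" for n unfolding x_def by (rule c)
  have xd: "\<exists>n. \<bar>x n - t\<bar> < e" if "t \<in> {0..T}" "e > 0" for t e
  proof -
    obtain n where "\<bar>q n - t\<bar> < e" using q \<open>e > 0\<close> by blast
    then show ?thesis using that by (intro exI[of _ n]) (auto simp: x_def c_def)
  qed
  have si: "set_integrable lborel {a..b} f" if "integrable lborel f" for f :: "real \<Rightarrow> real" and a b
    using that by (auto intro!: integrable_imp_set_integrable)
  define \<phi> where "\<phi> n t = D (c t) (x n)" for n t
  have \<phi>D: "\<bar>\<phi> n t - \<phi> n s\<bar> \<le> D (c s) (c t)" for n s t
    using Dtri[OF c[of s] c[of t] x[of n]] Dtri[OF c[of t] c[of s] x[of n]] Dsym[OF c[of s] c[of t]]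
    by (auto simp: \<phi>_def)
  have \<phi>m: "\<bar>\<phi> n t - \<phi> n s\<bar> \<le> (LINT u:{s..t}|lborel. m u)" if st: "s \<le> t" for n s t
  proof -
    have nn: "0 \<le> (LINT u:{s..t}|lborel. m u)"
      using m0 by (simp add: set_lebesgue_integral_def)
    consider "c s = c t" | "s \<le> c s" "c t \<le> t" "c s \<le> c t" using st T unfolding c_def by linarith
    then show ?thesis
    proof cases
      case 1
      then show ?thesis using nn by (simp add: \<phi>_def)
    next
      case 2
      have "\<bar>\<phi> n t - \<phi> n s\<bar> \<le> (LINT u:{c s..c t}|lborel. m u)"
        using \<phi>D[of n t s] Dm[of "c s" "c t"] c[of s] c[of t] 2 by auto
      also have "\<dots> \<le> (LINT u:{s..t}|lborel. m u)"
        unfolding set_lebesgue_integral_def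
        using 2 m0 si[OF m] by (intro integral_mono) (auto simp: set_integrable_def indicator_def)
      finally show ?thesis .
    qed
  qed
  have "\<exists>g. integrable lborel g \<and> (\<forall>s t. s \<le> t \<longrightarrow> \<phi> n t - \<phi> n s = (LINT u:{s..t}|lborel. g u))" for n
    by (rule absolutely_continuous_has_density[OF m m0 \<phi>m[of _ _ n]]) blast+
  then obtain g where gi: "\<And>n. integrable lborel (g n)"
    and g: "\<And>n s t. s \<le> t \<Longrightarrow> \<phi> n t - \<phi> n s = (LINT u:{s..t}|lborel. g n u)" by metis
  have gm: "g n \<in> borel_measurable borel" for n using borel_measurable_integrable[OF gi] by simp
  have mm: "m \<in> borel_measurable borel" using borel_measurable_integrable[OF m] by simp
  \<comment> \<open>The cap by \<open>m\<close> keeps the supremum finite everywhere and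
    \<open>v\<close> integrable; the proof of \<open>gv\<close> shows that it is inactive at good
    points.\<close>
  define v where "v t = (SUP n. min \<bar>g n t\<bar> (m t))" for t
  have bdd: "bdd_above (range (\<lambda>n. min \<bar>g n t\<bar> (m t)))" for t by (auto intro!: bdd_aboveI[of _ "m t"])
  have vm: "v t \<le> m t" for t unfolding v_def by (rule cSUP_least) auto
  have vge: "min \<bar>g n t\<bar> (m t) \<le> v t" for n t unfolding v_def by (rule cSUP_upper) (auto intro: bdd)
  have v0: "0 \<le> v t" for t using vge[of 0 t] m0[of t] by (auto simp: min_def split: if_splits)
  have vmeas: "v \<in> borel_measurable borel"
    unfolding v_def using gm mm bdd by (intro borel_measurable_cSUP) auto
  have vi: "integrable lborel v"
    by (rule Bochner_Integration.integrable_bound[OF m]) (use vmeas vm v0 m0 in auto)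
  define good where "good t \<longleftrightarrow> (t \<in> {0<..<T} \<longrightarrow>
      (\<forall>n. ((\<lambda>h. (LINT u:{min t (t + h)..max t (t + h)}|lborel. g n u) / \<bar>h\<bar>) \<longlongrightarrow> g n t) (at 0)) \<and>
      ((\<lambda>h. (LINT u:{min t (t + h)..max t (t + h)}|lborel. m u) / \<bar>h\<bar>) \<longlongrightarrow> m t) (at 0) \<and>
      ((\<lambda>h. (LINT u:{min t (t + h)..max t (t + h)}|lborel. v u) / \<bar>h\<bar>) \<longlongrightarrow> v t) (at 0))" for t
  have AEgood: "AE t in lborel. good t"
  proof -
    have "AE t in lborel. \<forall>n. t \<in> {0<..<T} \<longrightarrow>
      ((\<lambda>h. (LINT u:{min t (t + h)..max t (t + h)}|lborel. g n u) / \<bar>h\<bar>) \<longlongrightarrow> g n t) (at 0)"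
      unfolding AE_all_countable using difference_quotient_AE[OF gi] by blast
    with difference_quotient_AE[OF m, of T] difference_quotient_AE[OF vi, of T] show ?thesis
      by eventually_elim (auto simp: good_def)
  qed
  have gint: "\<bar>LINT u:{min t (t + h)..max t (t + h)}|lborel. g n u\<bar> = \<bar>\<phi> n (t + h) - \<phi> n t\<bar>" for n t h
    using g[of t "t + h" n] g[of "t + h" t n] by (cases "h \<ge> 0") (auto simp: min_def max_def)
  have gv: "\<bar>g n t\<bar> \<le> v t" if "good t" "t \<in> {0<..<T}" for n t
  proof -
    have "((\<lambda>h. \<bar>(LINT u:{min t (t + h)..max t (t + h)}|lborel. g n u) / \<bar>h\<bar>\<bar>) \<longlongrightarrow> \<bar>g n t\<bar>) (at 0)"
      using that by (intro tendsto_rabs) (auto simp: good_def)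
    moreover have "((\<lambda>h. (LINT u:{min t (t + h)..max t (t + h)}|lborel. m u) / \<bar>h\<bar>) \<longlongrightarrow> m t) (at 0)"
      using that by (auto simp: good_def)
    moreover have "\<bar>(LINT u:{min t (t + h)..max t (t + h)}|lborel. g n u) / \<bar>h\<bar>\<bar>
        \<le> (LINT u:{min t (t + h)..max t (t + h)}|lborel. m u) / \<bar>h\<bar>" for h
    proof -
      have "\<bar>\<phi> n (t + h) - \<phi> n t\<bar> \<le> (LINT u:{min t (t + h)..max t (t + h)}|lborel. m u)"
        using \<phi>m[of t "t + h" n] \<phi>m[of "t + h" t n]
        by (cases "h \<ge> 0") (simp_all add: min_def max_def abs_minus_commute)
      then show ?thesis unfolding abs_divide gint abs_abs by (rule divide_right_mono) simp
    qed
    ultimately have "\<bar>g n t\<bar> \<le> m t" by (intro tendsto_le[OF _ _ _ always_eventually]) auto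
    then show ?thesis using vge[of n t] by simp
  qed
  \<comment> \<open>Choose \<open>x n\<close> so close to \<open>s\<close> that
    \<open>D s (x n) < e / 2\<close>. Then \<open>D s t\<close> is at most
    \<open>2 * D s (x n)\<close> plus the increment of \<open>\<phi> n\<close> from \<open>s\<close>
    to \<open>t\<close>, and this increment is the integral of \<open>g n\<close>.\<close>
  have Dv: "D s t \<le> (LINT u:{s..t}|lborel. v u)" if st: "0 \<le> s" "s \<le> t" "t \<le> T" for s t
  proof (rule field_le_epsilon)
    fix e :: real assume e: "e > 0"
    have fin: "m integrable_on {0..T}" using m by (intro integrable_on_lborel[THEN integrable_on_subinterval]) auto
    have "continuous_on {0..T} (\<lambda>u. integral {0..u} m)" by (rule indefinite_integral_continuous_1[OF fin])
    then have "\<forall>e>0. \<exists>d>0. \<forall>u\<in>{0..T}. dist u s < d \<longrightarrow> dist (integral {0..u} m) (integral {0..s} m) < e"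
      using st unfolding continuous_on_iff by auto
    then obtain d where d: "d > 0" and dd: "\<And>u. u \<in> {0..T} \<Longrightarrow> \<bar>u - s\<bar> < d \<Longrightarrow>
        \<bar>integral {0..u} m - integral {0..s} m\<bar> < e / 2"
      using half_gt_zero[OF e] unfolding dist_real_def by blast
    obtain n where n: "\<bar>x n - s\<bar> < d" using xd[of s d] st d by auto
    have LI: "(LINT u:{a..b}|lborel. m u) = integral {a..b} m" for a b
      using si[OF m] by (rule set_borel_integral_eq_integral)
    have LF: "(LINT u:{a..b}|lborel. m u) = integral {0..b} m - integral {0..a} m" if "0 \<le> a" "a \<le> b" "b \<le> T" for a b
      using Henstock_Kurzweil_Integration.integral_combine[of 0 a b m] that integrable_subinterval_real[OF fin, of 0 b]
      by (simp add: LI)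
    have "D s (x n) < e / 2"
    proof (cases "s \<le> x n")
      case True
      then have "D s (x n) \<le> integral {0..x n} m - integral {0..s} m"
        using Dm[of s "x n"] LF[of s "x n"] x[of n] st by simp
      then show ?thesis using dd[OF x[of n] n] by linarith
    next
      case False
      then have "D (x n) s \<le> integral {0..s} m - integral {0..x n} m"
        using Dm[of "x n" s] LF[of "x n" s] x[of n] st by simp
      then have "D (x n) s < e / 2" using dd[OF x[of n] n] by linarith
      then show ?thesis using Dsym[of s "x n"] x[of n] st by auto
    qed
    moreover have "D s t \<le> D s (x n) + D t (x n)"
      using Dtri[of s "x n" t] Dsym[of "x n" t] x[of n] st by auto
    moreover have "D t (x n) - D s (x n) = (LINT u:{s..t}|lborel. g n u)"
      using g[of s t n] st by (simp add: \<phi>_def cid)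
    moreover have "(LINT u:{s..t}|lborel. g n u) \<le> (LINT u:{s..t}|lborel. v u)"
    proof (rule set_integral_mono_AE[OF si[OF gi] si[OF vi]])
      have "AE u in lborel. u \<noteq> 0 \<and> u \<noteq> T" using AE_lborel_singleton by auto
      with AEgood show "AE u\<in>{s..t} in lborel. g n u \<le> v u"
      proof eventually_elim
        case (elim u)
        then show ?case using gv[of u n] st by (auto simp: abs_le_iff)
      qed
    qed
    ultimately show "D s t \<le> (LINT u:{s..t}|lborel. v u) + e" by linarith
  qed
  show thesis
  proof (rule that[OF vmeas v0 vi _ Dv])
    show "AE t in lborel. t \<in> {0<..<T} \<longrightarrow> ((\<lambda>h. D t (t + h) / \<bar>h\<bar>) \<longlongrightarrow> v t) (at 0)"
      using AEgood
    proof eventually_elim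
      case (elim t)
      show ?case
      proof
        assume t: "t \<in> {0<..<T}"
        have near: "eventually (\<lambda>h. t + h \<in> {0..T} \<and> h \<noteq> 0) (at 0)"
        proof -
          have "eventually (\<lambda>h. h \<in> {-t<..<T-t} - {0}) (at 0)"
            using t by (intro eventually_at_in_open) auto
          then show ?thesis by eventually_elim auto
        qed
        show "((\<lambda>h. D t (t + h) / \<bar>h\<bar>) \<longlongrightarrow> v t) (at 0)"
        proof (rule tendstoI)
          fix e :: real assume e: "e > 0"
          have "((\<lambda>h. (LINT u:{min t (t + h)..max t (t + h)}|lborel. v u) / \<bar>h\<bar>) \<longlongrightarrow> v t) (at 0)"
            using elim t by (auto simp: good_def)
          then have up: "eventually (\<lambda>h. (LINT u:{min t (t + h)..max t (t + h)}|lborel. v u) / \<bar>h\<bar> < v t + e) (at 0)"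
            using e by (intro order_tendstoD) auto
          have "\<exists>n. v t - e < \<bar>g n t\<bar>"
          proof -
            have "\<exists>n\<in>UNIV. v t - e < min \<bar>g n t\<bar> (m t)"
              using less_cSUP_iff[of UNIV "\<lambda>n. min \<bar>g n t\<bar> (m t)" "v t - e"] bdd e by (auto simp: v_def)
            then show ?thesis by auto
          qed
          then obtain n where n: "v t - e < \<bar>g n t\<bar>" ..
          have "((\<lambda>h. \<bar>(LINT u:{min t (t + h)..max t (t + h)}|lborel. g n u) / \<bar>h\<bar>\<bar>) \<longlongrightarrow> \<bar>g n t\<bar>) (at 0)"
            using elim t by (intro tendsto_rabs) (auto simp: good_def)
          then have lo: "eventually (\<lambda>h. v t - e < \<bar>(LINT u:{min t (t + h)..max t (t + h)}|lborel. g n u) / \<bar>h\<bar>\<bar>) (at 0)"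
            using n by (intro order_tendstoD) auto
          show "\<forall>\<^sub>F h in at 0. dist (D t (t + h) / \<bar>h\<bar>) (v t) < e"
            using up lo near
          proof eventually_elim
            case (elim h)
            have tT: "t \<in> {0..T}" "t + h \<in> {0..T}" using t elim by auto
            have "D t (t + h) \<le> (LINT u:{min t (t + h)..max t (t + h)}|lborel. v u)"
              using Dv[of t "t + h"] Dv[of "t + h" t] Dsym[OF tT] tT by (auto simp: min_def max_def)
            then have "D t (t + h) / \<bar>h\<bar> \<le> (LINT u:{min t (t + h)..max t (t + h)}|lborel. v u) / \<bar>h\<bar>"
              by (rule divide_right_mono) simp
            moreover have "\<bar>(LINT u:{min t (t + h)..max t (t + h)}|lborel. g n u) / \<bar>h\<bar>\<bar> \<le> D t (t + h) / \<bar>h\<bar>"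
              unfolding abs_divide gint using \<phi>D[of n "t + h" t] tT
              unfolding cid[OF tT(1)] cid[OF tT(2)] abs_abs by (intro divide_right_mono) auto
            ultimately have "D t (t + h) / \<bar>h\<bar> < v t + e" "v t - e < D t (t + h) / \<bar>h\<bar>"
              using elim(1,2) by linarith+
            then show ?case unfolding dist_real_def by linarith
          qed
        qed
      qed
    qed
  qed
qed

section \<open>Quadratic transport distance on a compact set\<close>

text \<open>Cauchy-Schwarz from Young's inequality with the weight \<open>l\<close>, the optimal one
  up to \<open>e\<close>. The shift by \<open>e\<close> keeps the weight defined and positive when
  one of the norms vanishes.\<close>

lemma integral_mult_le_L2:
  fixes f g :: "'a \<Rightarrow> real"
  assumes f: "integrable M (\<lambda>x. (f x)\<^sup>2)" and g: "integrable M (\<lambda>x. (g x)\<^sup>2)"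
    and fg: "integrable M (\<lambda>x. f x * g x)"
  shows "(\<integral>x. f x * g x \<partial>M) \<le> sqrt (\<integral>x. (f x)\<^sup>2 \<partial>M) * sqrt (\<integral>x. (g x)\<^sup>2 \<partial>M)"
proof -
  define a b where "a = sqrt (\<integral>x. (f x)\<^sup>2 \<partial>M)" and "b = sqrt (\<integral>x. (g x)\<^sup>2 \<partial>M)"
  have a2: "(\<integral>x. (f x)\<^sup>2 \<partial>M) = a\<^sup>2" and b2: "(\<integral>x. (g x)\<^sup>2 \<partial>M) = b\<^sup>2" by (simp_all add: a_def b_def)
  have ab: "0 \<le> a" "0 \<le> b" by (simp_all add: a_def b_def)
  have le: "(\<integral>x. f x * g x \<partial>M) \<le> (a + e) * (b + e)" if e: "e > 0" for e
  proof -
    define l where "l = (b + e) / (a + e)"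
    have l: "l > 0" using ab e by (simp add: l_def)
    have "2 * (f x * g x) \<le> l * (f x)\<^sup>2 + inverse l * (g x)\<^sup>2" for x
    proof -
      have "0 \<le> (l * f x - g x)\<^sup>2 / l" using l by simp
      also have "\<dots> = l * (f x)\<^sup>2 + inverse l * (g x)\<^sup>2 - 2 * (f x * g x)"
        using l by (simp add: field_simps power2_eq_square)
      finally show ?thesis by simp
    qed
    then have "(\<integral>x. 2 * (f x * g x) \<partial>M) \<le> (\<integral>x. l * (f x)\<^sup>2 + inverse l * (g x)\<^sup>2 \<partial>M)"
      using f g fg by (intro integral_mono) auto
    also have "\<dots> = l * a\<^sup>2 + inverse l * b\<^sup>2" using f g by (simp add: a2 b2)
    also have "\<dots> \<le> l * (a + e)\<^sup>2 + inverse l * (b + e)\<^sup>2"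
      using l ab e by (intro add_mono mult_left_mono power_mono) auto
    also have "\<dots> = 2 * ((a + e) * (b + e))"
      using ab e by (simp add: l_def power2_eq_square)
    finally show ?thesis using fg by simp
  qed
  have "((\<lambda>e. (a + e) * (b + e)) \<longlongrightarrow> (a + 0) * (b + 0)) (at_right 0)"
    by (intro tendsto_intros)
  then have "(\<integral>x. f x * g x \<partial>M) \<le> (a + 0) * (b + 0)"
    by (rule tendsto_lowerbound) (use le in \<open>auto simp: eventually_at_filter\<close>)
  then show ?thesis by (simp add: a_def b_def)
qed

lemma L2_triangle:
  fixes f g :: "'a \<Rightarrow> real"
  assumes f: "integrable M (\<lambda>x. (f x)\<^sup>2)" and g: "integrable M (\<lambda>x. (g x)\<^sup>2)"
    and fg: "integrable M (\<lambda>x. f x * g x)"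
  shows "sqrt (\<integral>x. (f x + g x)\<^sup>2 \<partial>M) \<le> sqrt (\<integral>x. (f x)\<^sup>2 \<partial>M) + sqrt (\<integral>x. (g x)\<^sup>2 \<partial>M)"
proof (rule real_le_lsqrt)
  have "(\<integral>x. (f x + g x)\<^sup>2 \<partial>M) = (\<integral>x. (f x)\<^sup>2 + (g x)\<^sup>2 + 2 * (f x * g x) \<partial>M)"
    by (intro Bochner_Integration.integral_cong) (auto simp: power2_sum)
  also have "\<dots> = (\<integral>x. (f x)\<^sup>2 \<partial>M) + (\<integral>x. (g x)\<^sup>2 \<partial>M) + 2 * (\<integral>x. f x * g x \<partial>M)"
    using f g fg by simp
  also have "\<dots> \<le> (\<integral>x. (f x)\<^sup>2 \<partial>M) + (\<integral>x. (g x)\<^sup>2 \<partial>M)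
      + 2 * (sqrt (\<integral>x. (f x)\<^sup>2 \<partial>M) * sqrt (\<integral>x. (g x)\<^sup>2 \<partial>M))"
    using integral_mult_le_L2[OF f g fg] by simp
  also have "\<dots> = (sqrt (\<integral>x. (f x)\<^sup>2 \<partial>M) + sqrt (\<integral>x. (g x)\<^sup>2 \<partial>M))\<^sup>2"
    by (simp add: power2_sum)
  finally show "(\<integral>x. (f x + g x)\<^sup>2 \<partial>M) \<le> (sqrt (\<integral>x. (f x)\<^sup>2 \<partial>M) + sqrt (\<integral>x. (g x)\<^sup>2 \<partial>M))\<^sup>2" .
qed simp

lemma (in prob_space) integral_le_L2:
  fixes f :: "'a \<Rightarrow> real"
  assumes "integrable M f" "integrable M (\<lambda>x. (f x)\<^sup>2)"
  shows "(\<integral>x. f x \<partial>M) \<le> sqrt (\<integral>x. (f x)\<^sup>2 \<partial>M)"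
  using integral_mult_le_L2[of M f "\<lambda>_. 1"] assms by (simp add: prob_space)

lemma borel_measurable_fst [measurable]:
  "fst \<in> borel_measurable (borel :: ('a::second_countable_topology \<times> 'b::second_countable_topology) measure)"
  and borel_measurable_snd [measurable]:
  "snd \<in> borel_measurable (borel :: ('a::second_countable_topology \<times> 'b::second_countable_topology) measure)"
  by (auto intro!: borel_measurable_continuous_onI continuous_intros)

lemma PM_D:
  assumes "\<mu> \<in> PM M"
  shows "prob_space \<mu>" "sets \<mu> = sets borel" "space \<mu> = UNIV"
  using assms by (auto simp: PM_def dest: sets_eq_imp_space_eq)

lemma PM_AE:
  assumes "\<mu> \<in> PM M" "closed M"
  shows "AE x in \<mu>. x \<in> M"
proof (rule AE_I)
  show "{x \<in> space \<mu>. x \<notin> M} \<subseteq> UNIV - M" by auto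
qed (use assms in \<open>auto simp: PM_def\<close>)

lemma PM_distr:
  fixes X :: "'b \<Rightarrow> 'a::euclidean_space"
  assumes "prob_space \<Omega>" "X \<in> borel_measurable \<Omega>" "closed M" "\<And>\<omega>. \<omega> \<in> space \<Omega> \<Longrightarrow> X \<omega> \<in> M"
  shows "distr \<Omega> borel X \<in> PM M"
proof -
  have "X -` (UNIV - M) \<inter> space \<Omega> = {}" using assms by auto
  then have "emeasure (distr \<Omega> borel X) (UNIV - M) = 0"
    using assms by (subst emeasure_distr) (auto simp: borel_closed)
  then show ?thesis using assms by (auto simp: PM_def prob_space.prob_space_distr)
qed

lemma distr_borel_cong_AE:
  assumes "AE x in \<Omega>. f x = g x" "f \<in> borel_measurable \<Omega>" "g \<in> borel_measurable \<Omega>"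
  shows "distr \<Omega> borel f = distr \<Omega> borel g"
  using assms by (intro distr_cong_AE) auto

lemma distr_Pair_in_couplings:
  fixes X Y :: "'b \<Rightarrow> 'a::euclidean_space"
  assumes "prob_space \<Omega>" and [measurable]: "X \<in> borel_measurable \<Omega>" "Y \<in> borel_measurable \<Omega>"
  shows "distr \<Omega> borel (\<lambda>\<omega>. (X \<omega>, Y \<omega>)) \<in> couplings (distr \<Omega> borel X) (distr \<Omega> borel Y)"
proof -
  have m: "(\<lambda>\<omega>. (X \<omega>, Y \<omega>)) \<in> borel_measurable \<Omega>" by measurable
  have "prob_space (distr \<Omega> borel (\<lambda>\<omega>. (X \<omega>, Y \<omega>)))"
    using assms m by (intro prob_space.prob_space_distr) auto
  then show ?thesis
    using m by (auto simp: couplings_def distr_distr comp_def)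
qed

lemma d2_nonneg: "0 \<le> d2 \<mu> \<nu>" by (simp add: d2_def)

text \<open>Upper bounds on \<open>d2\<close> are obtained from two random variables on one
  probability space. Together with \<open>d2_realization\<close> in the other direction, this
  removes couplings from the later arguments.\<close>

lemma d2_distr_le:
  fixes X Y :: "'b \<Rightarrow> 'a::euclidean_space"
  assumes \<Omega>: "prob_space \<Omega>" and [measurable]: "X \<in> borel_measurable \<Omega>" "Y \<in> borel_measurable \<Omega>"
    and i: "integrable \<Omega> (\<lambda>\<omega>. (norm (X \<omega> - Y \<omega>))\<^sup>2)"
  shows "d2 (distr \<Omega> borel X) (distr \<Omega> borel Y) \<le> sqrt (\<integral>\<omega>. (norm (X \<omega> - Y \<omega>))\<^sup>2 \<partial>\<Omega>)"
proof -
  let ?\<gamma> = "distr \<Omega> borel (\<lambda>\<omega>. (X \<omega>, Y \<omega>))"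
  have "(INF \<gamma>\<in>couplings (distr \<Omega> borel X) (distr \<Omega> borel Y).
       \<integral>\<^sup>+ p. ennreal ((norm (fst p - snd p))\<^sup>2) \<partial>\<gamma>) \<le> (\<integral>\<^sup>+ p. ennreal ((norm (fst p - snd p))\<^sup>2) \<partial>?\<gamma>)"
    using distr_Pair_in_couplings[of \<Omega> X Y] \<Omega> by (intro INF_lower) auto
  also have "\<dots> = (\<integral>\<^sup>+ \<omega>. ennreal ((norm (X \<omega> - Y \<omega>))\<^sup>2) \<partial>\<Omega>)"
    by (subst nn_integral_distr) auto
  also have "\<dots> = ennreal (\<integral>\<omega>. (norm (X \<omega> - Y \<omega>))\<^sup>2 \<partial>\<Omega>)"
    using i by (intro nn_integral_eq_integral) auto
  finally show ?thesis
    unfolding d2_def by (intro real_sqrt_le_mono enn2real_leI) auto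
qed

text \<open>Near-optimal couplings, represented by random variables with values everywhere in M.\<close>
lemma d2_realization:
  fixes M :: "'a::euclidean_space set"
  assumes M: "compact M" "m0 \<in> M" and \<mu>: "\<mu> \<in> PM M" and \<nu>: "\<nu> \<in> PM M" and e: "e > 0"
  obtains \<Omega> :: "('a \<times> 'a) measure" and X Y
  where "prob_space \<Omega>" "X \<in> borel_measurable \<Omega>" "Y \<in> borel_measurable \<Omega>"
    "\<forall>\<omega>. X \<omega> \<in> M" "\<forall>\<omega>. Y \<omega> \<in> M" "distr \<Omega> borel X = \<mu>" "distr \<Omega> borel Y = \<nu>"
    "(\<integral>\<omega>. (norm (X \<omega> - Y \<omega>))\<^sup>2 \<partial>\<Omega>) \<le> (d2 \<mu> \<nu>)\<^sup>2 + e"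
proof -
  have cl: "closed M" using M compact_imp_closed by auto
  \<comment> \<open>Sending the null set outside M to \<open>m0\<close> changes no law in
    \<open>PM M\<close>. It makes the variables M-valued everywhere, so that later estimates can be
    pointwise without exceptional sets.\<close>
  define clip where "clip x = (if x \<in> M then x else m0)" for x
  have clip: "clip x \<in> M" for x using M by (simp add: clip_def)
  have [measurable]: "M \<in> sets borel" using cl by auto
  have [measurable]: "clip \<in> borel_measurable borel" unfolding clip_def[abs_def] by measurable
  obtain B where B: "\<And>x. x \<in> M \<Longrightarrow> norm x \<le> B" using compact_imp_bounded[OF M(1)] unfolding bounded_iff by blast
  have clipd: "distr \<sigma> borel clip = \<sigma>" if "\<sigma> \<in> PM M" for \<sigma>
  proof -
    note PM_D[OF that, measurable_cong]
    have "distr \<sigma> borel clip = distr \<sigma> borel (\<lambda>x. x)"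
      using PM_AE[OF that cl] by (intro distr_borel_cong_AE) (auto simp: clip_def elim!: eventually_mono)
    then show ?thesis using PM_D(2)[OF that] by (simp add: distr_id2)
  qed
  interpret \<mu>: prob_space \<mu> using PM_D[OF \<mu>] by simp
  interpret \<nu>: prob_space \<nu> using PM_D[OF \<nu>] by simp
  interpret \<mu>\<nu>: pair_prob_space \<mu> \<nu> ..
  note [measurable_cong] = PM_D(2)[OF \<mu>] PM_D(2)[OF \<nu>]
  let ?cost = "\<lambda>\<gamma>. \<integral>\<^sup>+ p. ennreal ((norm (fst p - snd p))\<^sup>2) \<partial>\<gamma>"
  define I where "I = (INF \<gamma>\<in>couplings \<mu> \<nu>. ?cost \<gamma>)"
  have cost: "?cost \<gamma> = (\<integral>\<^sup>+ p. ennreal ((norm (clip (fst p) - clip (snd p)))\<^sup>2) \<partial>\<gamma>)"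
    and c1: "distr \<gamma> borel (\<lambda>p. clip (fst p)) = \<mu>" and c2: "distr \<gamma> borel (\<lambda>p. clip (snd p)) = \<nu>"
    and gp: "prob_space \<gamma>" and gs: "sets \<gamma> = sets borel" if g: "\<gamma> \<in> couplings \<mu> \<nu>" for \<gamma>
  proof -
    show "prob_space \<gamma>" and gs: "sets \<gamma> = sets borel" using g by (auto simp: couplings_def)
    note [measurable_cong] = gs
    have d: "distr \<gamma> borel fst = \<mu>" "distr \<gamma> borel snd = \<nu>" using g by (auto simp: couplings_def)
    have "AE p in \<gamma>. fst p \<in> M" "AE p in \<gamma>. snd p \<in> M"
      using AE_distrD[of fst \<gamma> borel "\<lambda>x. x \<in> M", unfolded d] PM_AE[OF \<mu> cl]
        AE_distrD[of snd \<gamma> borel "\<lambda>x. x \<in> M", unfolded d] PM_AE[OF \<nu> cl] by auto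
    then have "AE p in \<gamma>. ennreal ((norm (fst p - snd p))\<^sup>2) = ennreal ((norm (clip (fst p) - clip (snd p)))\<^sup>2)"
      by eventually_elim (simp add: clip_def)
    then show "?cost \<gamma> = (\<integral>\<^sup>+ p. ennreal ((norm (clip (fst p) - clip (snd p)))\<^sup>2) \<partial>\<gamma>)"
      by (rule nn_integral_cong_AE)
    show "distr \<gamma> borel (\<lambda>p. clip (fst p)) = \<mu>"
      using distr_distr[of clip borel borel fst \<gamma>] clipd[OF \<mu>] by (simp add: d comp_def)
    show "distr \<gamma> borel (\<lambda>p. clip (snd p)) = \<nu>"
      using distr_distr[of clip borel borel snd \<gamma>] clipd[OF \<nu>] by (simp add: d comp_def)
  qed
  have bound: "(norm (clip x - clip y))\<^sup>2 \<le> (2 * B)\<^sup>2" for x y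
  proof (rule power_mono)
    show "norm (clip x - clip y) \<le> 2 * B"
      using B[OF clip[of x]] B[OF clip[of y]] norm_triangle_ineq4[of "clip x" "clip y"] by linarith
  qed simp
  have "distr (\<mu> \<Otimes>\<^sub>M \<nu>) borel fst = distr (\<mu> \<Otimes>\<^sub>M \<nu>) \<mu> fst"
    using PM_D(2)[OF \<mu>] by (intro distr_cong) auto
  also have "\<dots> = \<mu>" by (rule \<nu>.distr_pair_fst)
  finally have d1: "distr (\<mu> \<Otimes>\<^sub>M \<nu>) borel fst = \<mu>" .
  have "distr (\<mu> \<Otimes>\<^sub>M \<nu>) borel snd = distr (\<mu> \<Otimes>\<^sub>M \<nu>) \<nu> snd"
    using PM_D(2)[OF \<nu>] by (intro distr_cong) auto
  also have "\<dots> = \<nu>"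
  proof (rule measure_eqI)
    fix A assume A: "A \<in> sets (distr (\<mu> \<Otimes>\<^sub>M \<nu>) \<nu> snd)"
    then have "emeasure (distr (\<mu> \<Otimes>\<^sub>M \<nu>) \<nu> snd) A = emeasure (\<mu> \<Otimes>\<^sub>M \<nu>) (space \<mu> \<times> A)"
      using sets.sets_into_space[of A \<nu>]
      by (subst emeasure_distr) (auto simp: space_pair_measure intro!: arg_cong2[where f=emeasure])
    then show "emeasure (distr (\<mu> \<Otimes>\<^sub>M \<nu>) \<nu> snd) A = emeasure \<nu> A"
      using A by (simp add: \<nu>.emeasure_pair_measure_Times \<mu>.emeasure_space_1)
  qed simp
  finally have d2: "distr (\<mu> \<Otimes>\<^sub>M \<nu>) borel snd = \<nu>" .
  \<comment> \<open>The product coupling shows that the infimum is finite. At an infinite infimum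
    \<open>enn2real\<close> would return 0 and \<open>d2\<close> would carry no information.\<close>
  define \<gamma>0 where "\<gamma>0 = distr (\<mu> \<Otimes>\<^sub>M \<nu>) borel (\<lambda>p. (fst p, snd p))"
  have m1: "fst \<in> borel_measurable (\<mu> \<Otimes>\<^sub>M \<nu>)" "snd \<in> borel_measurable (\<mu> \<Otimes>\<^sub>M \<nu>)" by measurable
  have g0: "\<gamma>0 \<in> couplings \<mu> \<nu>"
    using distr_Pair_in_couplings[OF \<mu>\<nu>.prob_space_axioms m1] unfolding d1 d2 \<gamma>0_def by simp
  have "I \<le> ?cost \<gamma>0" unfolding I_def using g0 by (rule INF_lower)
  also have "\<dots> \<le> (\<integral>\<^sup>+ p. ennreal ((2 * B)\<^sup>2) \<partial>\<gamma>0)"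
    unfolding cost[OF g0] using bound by (intro nn_integral_mono) auto
  also have "\<dots> = ennreal ((2 * B)\<^sup>2)"
    using prob_space.emeasure_space_1[OF gp[OF g0]] by simp
  finally have Ifin: "I < \<infinity>" by (metis ennreal_less_top infinity_ennreal_def order_le_less_trans)
  have Id: "I = ennreal ((d2 \<mu> \<nu>)\<^sup>2)" using Ifin by (simp add: d2_def I_def[symmetric])
  have "I < I + ennreal e" using Ifin e by (simp add: Id ennreal_plus[symmetric] ennreal_less_iff del: ennreal_plus)
  then obtain \<gamma> where g: "\<gamma> \<in> couplings \<mu> \<nu>" and lt: "?cost \<gamma> < I + ennreal e"
    unfolding I_def INF_less_iff by blast
  note [measurable_cong] = gs[OF g]
  interpret \<gamma>: prob_space \<gamma> by (rule gp[OF g])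
  have int: "integrable \<gamma> (\<lambda>p. (norm (clip (fst p) - clip (snd p)))\<^sup>2)"
    using bound by (intro \<gamma>.integrable_const_bound[where B="(2*B)\<^sup>2"]) auto
  have "ennreal (\<integral>p. (norm (clip (fst p) - clip (snd p)))\<^sup>2 \<partial>\<gamma>) = ?cost \<gamma>"
    unfolding cost[OF g] using int by (intro nn_integral_eq_integral[symmetric]) auto
  also have "\<dots> \<le> ennreal ((d2 \<mu> \<nu>)\<^sup>2 + e)" using lt e by (simp add: Id)
  finally have "(\<integral>p. (norm (clip (fst p) - clip (snd p)))\<^sup>2 \<partial>\<gamma>) \<le> (d2 \<mu> \<nu>)\<^sup>2 + e"
    using e by (subst (asm) ennreal_le_iff) auto
  then show thesis
    using gp[OF g] c1[OF g] c2[OF g] clip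
    by (intro that[of \<gamma> "\<lambda>p. clip (fst p)" "\<lambda>p. clip (snd p)"]) auto
qed

text \<open>Gluing kernel: conditionally on the cell of the common marginal, the two factors are independent.\<close>
lemma nn_integral_cell_kernel:
  fixes c :: "'b \<Rightarrow> nat"
  assumes A: "prob_space A" and B: "prob_space B"
    and [measurable]: "f \<in> measurable A (count_space UNIV)" "g \<in> measurable B (count_space UNIV)"
    and eq: "\<And>n::nat. emeasure A {x \<in> space A. f x = n} = emeasure B {y \<in> space B. g y = n}"
    and [measurable]: "h \<in> borel_measurable A"
  defines "w \<equiv> \<lambda>n. 1 / emeasure B {y \<in> space B. g y = n}"
  shows "(\<integral>\<^sup>+ p. (if f (fst p) = g (snd p) then w (f (fst p)) else 0) * h (fst p) \<partial>(A \<Otimes>\<^sub>M B)) = (\<integral>\<^sup>+ x. h x \<partial>A)"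
proof -
  interpret A: prob_space A by fact
  interpret B: prob_space B by fact
  have [measurable]: "w \<in> measurable (count_space UNIV) borel" by simp
  have "Measurable.pred (A \<Otimes>\<^sub>M B) (\<lambda>p. \<exists>n. g (snd p) = n \<and> f (fst p) = n)" by measurable
  then have [measurable]: "Measurable.pred (A \<Otimes>\<^sub>M B) (\<lambda>p. f (fst p) = g (snd p))" by simp
  have [measurable]: "(\<lambda>p. w (f (fst p))) \<in> borel_measurable (A \<Otimes>\<^sub>M B)"
    by (rule measurable_compose[of _ _ "count_space UNIV" w]) measurable
  have m: "(\<lambda>p. (if f (fst p) = g (snd p) then w (f (fst p)) else 0) * h (fst p)) \<in> borel_measurable (A \<Otimes>\<^sub>M B)"
    by measurable
  have "(\<integral>\<^sup>+ p. (if f (fst p) = g (snd p) then w (f (fst p)) else 0) * h (fst p) \<partial>(A \<Otimes>\<^sub>M B))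
      = (\<integral>\<^sup>+ x. (\<integral>\<^sup>+ y. (if f x = g y then w (f x) else 0) * h x \<partial>B) \<partial>A)"
    by (subst B.nn_integral_fst[OF m, symmetric]) (simp cong: if_cong)
  also have "\<dots> = (\<integral>\<^sup>+ x. h x \<partial>A)"
  proof (rule nn_integral_cong_AE)
    \<comment> \<open>On a null cell the weight \<open>w\<close> is infinite; almost every
      \<open>x\<close> avoids these cells.\<close>
    have "AE x in A. \<forall>n. emeasure A {x \<in> space A. f x = n} = 0 \<longrightarrow> f x \<noteq> n"
      unfolding AE_all_countable
    proof
      fix n
      show "AE x in A. emeasure A {x \<in> space A. f x = n} = 0 \<longrightarrow> f x \<noteq> n"
      proof (cases "emeasure A {x \<in> space A. f x = n} = 0")
        case True
        then show ?thesis by (intro AE_I[of _ _ "{x \<in> space A. f x = n}"]) auto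
      qed simp
    qed
    then show "AE x in A. (\<integral>\<^sup>+ y. (if f x = g y then w (f x) else 0) * h x \<partial>B) = h x"
    proof eventually_elim
      case (elim x)
      then have ne: "emeasure B {y \<in> space B. g y = f x} \<noteq> 0" using eq by auto
      have "(\<integral>\<^sup>+ y. (if f x = g y then w (f x) else 0) * h x \<partial>B)
          = (\<integral>\<^sup>+ y. (w (f x) * h x) * indicator {y \<in> space B. g y = f x} y \<partial>B)"
        by (intro nn_integral_cong) (auto simp: indicator_def)
      also have "\<dots> = (w (f x) * h x) * emeasure B {y \<in> space B. g y = f x}"
        by (rule nn_integral_cmult_indicator) measurable
      also have "\<dots> = h x * (emeasure B {y \<in> space B. g y = f x} / emeasure B {y \<in> space B. g y = f x})"
        by (simp add: w_def ennreal_times_divide mult.commute mult.left_commute)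
      also have "\<dots> = h x"
        using ne by (subst ennreal_divide_self) (auto simp: less_top[symmetric])
      finally show ?case .
    qed
  qed
  finally show ?thesis .
qed

text \<open>The index of the first point of a dense sequence within \<open>e / 2\<close>. It cuts
  the space into countably many small Borel cells, so the conditioning in the gluing argument is
  elementary.\<close>

lemma measurable_dense_index:
  assumes e: "e > 0"
  obtains c :: "'a::euclidean_space \<Rightarrow> nat"
  where "c \<in> measurable borel (count_space UNIV)" "\<And>x y. c x = c y \<Longrightarrow> dist x y < e"
proof -
  obtain D :: "'a set" where D: "countable D" "\<forall>U. open U \<longrightarrow> U \<noteq> {} \<longrightarrow> (\<exists>d\<in>D. d \<in> U)"
    using countable_dense_exists[where 'a='a] by blast
  have Dne: "D \<noteq> {}" using D(2)[rule_format, of UNIV] by auto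
  define q where "q = from_nat_into D"
  have ex: "\<exists>n. dist x (q n) < e / 2" for x
  proof -
    obtain d where "d \<in> D" "d \<in> ball x (e/2)" using D(2)[rule_format, of "ball x (e/2)"] e by auto
    then show ?thesis using from_nat_into_surj[OF D(1), of d] by (auto simp: q_def)
  qed
  define c where "c x = (LEAST n. dist x (q n) < e / 2)" for x
  have c: "dist x (q (c x)) < e / 2" for x unfolding c_def by (rule LeastI_ex) (rule ex)
  have "c \<in> measurable borel (count_space UNIV)" unfolding c_def[abs_def]
    by (rule measurable_Least) measurable
  moreover have "dist x y < e" if cc: "c x = c y" for x y
    using c[of x] c[of y] cc dist_triangle2[of x y "q (c x)"] by simp
  ultimately show thesis by (rule that)
qed

text \<open>Two near-optimal couplings are glued approximately, in place of a disintegration.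
  \<open>Y\<close> and \<open>Y'\<close> have the same law, and the product measure is reweighted
  onto the event that they lie in the same cell. With reciprocal cell probabilities as weights both
  factors keep their laws, while \<open>Y\<close> and \<open>Y'\<close> differ by at most
  \<open>e\<close>. Minkowski's inequality and \<open>e\<close> tending to 0 conclude.\<close>

lemma d2_triangle:
  fixes M :: "'a::euclidean_space set"
  assumes M: "compact M" and \<mu>: "\<mu> \<in> PM M" and \<nu>: "\<nu> \<in> PM M" and \<sigma>: "\<sigma> \<in> PM M"
  shows "d2 \<mu> \<sigma> \<le> d2 \<mu> \<nu> + d2 \<nu> \<sigma>"
proof -
  have cl: "closed M" by (rule compact_imp_closed[OF M])
  obtain m0 where m0: "m0 \<in> M"
  proof (cases "M = {}")
    case True
    then have "emeasure \<mu> (space \<mu>) = 0" using \<mu> PM_D[OF \<mu>] by (auto simp: PM_def)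
    then show ?thesis using prob_space.emeasure_space_1[OF PM_D(1)[OF \<mu>]] by simp
  qed blast
  obtain B where B: "\<And>x. x \<in> M \<Longrightarrow> norm x \<le> B" using compact_imp_bounded[OF M] unfolding bounded_iff by blast
  have bd: "norm (x - y) \<le> 2 * B" if "x \<in> M" "y \<in> M" for x y
    using B[OF that(1)] B[OF that(2)] norm_triangle_ineq4[of x y] by linarith
  have le: "d2 \<mu> \<sigma> \<le> sqrt ((d2 \<mu> \<nu>)\<^sup>2 + e) + sqrt ((d2 \<nu> \<sigma>)\<^sup>2 + e) + e" if e: "e > 0" for e
  proof -
    obtain \<Omega>1 :: "('a \<times> 'a) measure" and X Y where P1: "prob_space \<Omega>1"
      and [measurable]: "X \<in> borel_measurable \<Omega>1" "Y \<in> borel_measurable \<Omega>1"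
      and XM: "\<forall>\<omega>. X \<omega> \<in> M" "\<forall>\<omega>. Y \<omega> \<in> M" and dX: "distr \<Omega>1 borel X = \<mu>" and dY: "distr \<Omega>1 borel Y = \<nu>"
      and c1: "(\<integral>\<omega>. (norm (X \<omega> - Y \<omega>))\<^sup>2 \<partial>\<Omega>1) \<le> (d2 \<mu> \<nu>)\<^sup>2 + e"
      by (rule d2_realization[OF M m0 \<mu> \<nu> e])
    obtain \<Omega>2 :: "('a \<times> 'a) measure" and Y' Z where P2: "prob_space \<Omega>2"
      and [measurable]: "Y' \<in> borel_measurable \<Omega>2" "Z \<in> borel_measurable \<Omega>2"
      and ZM: "\<forall>\<omega>. Y' \<omega> \<in> M" "\<forall>\<omega>. Z \<omega> \<in> M" and dY': "distr \<Omega>2 borel Y' = \<nu>" and dZ: "distr \<Omega>2 borel Z = \<sigma>"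
      and c2: "(\<integral>\<omega>. (norm (Y' \<omega> - Z \<omega>))\<^sup>2 \<partial>\<Omega>2) \<le> (d2 \<nu> \<sigma>)\<^sup>2 + e"
      by (rule d2_realization[OF M m0 \<nu> \<sigma> e])
    interpret O1: prob_space \<Omega>1 by fact
    interpret O2: prob_space \<Omega>2 by fact
    interpret PP: pair_prob_space \<Omega>1 \<Omega>2 ..
    obtain c :: "'a \<Rightarrow> nat" where [measurable]: "c \<in> measurable borel (count_space UNIV)"
      and c: "\<And>x y. c x = c y \<Longrightarrow> dist x y < e"
      using measurable_dense_index[OF e] by blast
    define f g where "f \<omega> = c (Y \<omega>)" and "g \<omega> = c (Y' \<omega>)" for \<omega>
    have fm[measurable]: "f \<in> measurable \<Omega>1 (count_space UNIV)" and gm[measurable]: "g \<in> measurable \<Omega>2 (count_space UNIV)"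
      unfolding f_def[abs_def] g_def[abs_def] by measurable
    have eq: "emeasure \<Omega>1 {x \<in> space \<Omega>1. f x = n} = emeasure \<Omega>2 {x \<in> space \<Omega>2. g x = n}" for n
    proof -
      have b: "c -` {n} \<in> sets borel" using measurable_sets[of c borel "count_space UNIV" "{n}"] by simp
      have "emeasure \<Omega>1 {x \<in> space \<Omega>1. f x = n} = emeasure (distr \<Omega>1 borel Y) (c -` {n})"
        using b by (subst emeasure_distr) (auto simp: f_def intro!: arg_cong[where f="emeasure \<Omega>1"])
      also have "\<dots> = emeasure (distr \<Omega>2 borel Y') (c -` {n})" by (simp add: dY dY')
      also have "\<dots> = emeasure \<Omega>2 {x \<in> space \<Omega>2. g x = n}"
        using b by (subst emeasure_distr) (auto simp: g_def intro!: arg_cong[where f="emeasure \<Omega>2"])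
      finally show ?thesis .
    qed
    define w where "w n = 1 / emeasure \<Omega>2 {y \<in> space \<Omega>2. g y = n}" for n
    define k where "k p = (if f (fst p) = g (snd p) then w (f (fst p)) else 0)" for p
    have wm[measurable]: "w \<in> measurable (count_space UNIV) borel" by simp
    have km[measurable]: "k \<in> borel_measurable (\<Omega>1 \<Otimes>\<^sub>M \<Omega>2)"
    proof -
      have "Measurable.pred (\<Omega>1 \<Otimes>\<^sub>M \<Omega>2) (\<lambda>p. \<exists>n. g (snd p) = n \<and> f (fst p) = n)" by measurable
      then have [measurable]: "Measurable.pred (\<Omega>1 \<Otimes>\<^sub>M \<Omega>2) (\<lambda>p. f (fst p) = g (snd p))" by simp
      have [measurable]: "(\<lambda>p. w (f (fst p))) \<in> borel_measurable (\<Omega>1 \<Otimes>\<^sub>M \<Omega>2)"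
        by (rule measurable_compose[of _ _ "count_space UNIV" w]) measurable
      show ?thesis unfolding k_def[abs_def] by measurable
    qed
    have I1: "(\<integral>\<^sup>+ p. k p * h (fst p) \<partial>(\<Omega>1 \<Otimes>\<^sub>M \<Omega>2)) = (\<integral>\<^sup>+ x. h x \<partial>\<Omega>1)" if "h \<in> borel_measurable \<Omega>1" for h
      unfolding k_def w_def using nn_integral_cell_kernel[OF P1 P2 fm gm eq that] by simp
    \<comment> \<open>Equal laws give equal cell probabilities, so the weight can be read from
      either factor and the kernel lemma applies with the roles exchanged.\<close>
    have I2: "(\<integral>\<^sup>+ p. k p * h (snd p) \<partial>(\<Omega>1 \<Otimes>\<^sub>M \<Omega>2)) = (\<integral>\<^sup>+ x. h x \<partial>\<Omega>2)" if hm[measurable]: "h \<in> borel_measurable \<Omega>2" for h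
    proof -
      have "(\<integral>\<^sup>+ p. k p * h (snd p) \<partial>(\<Omega>1 \<Otimes>\<^sub>M \<Omega>2)) = (\<integral>\<^sup>+ y. \<integral>\<^sup>+ x. k (x, y) * h y \<partial>\<Omega>1 \<partial>\<Omega>2)"
        by (subst PP.nn_integral_snd[symmetric]) auto
      also have "\<dots> = (\<integral>\<^sup>+ p. k (snd p, fst p) * h (fst p) \<partial>(\<Omega>2 \<Otimes>\<^sub>M \<Omega>1))"
        by (subst O1.nn_integral_fst[symmetric]) auto
      also have "\<dots> = (\<integral>\<^sup>+ p. (if g (fst p) = f (snd p) then 1 / emeasure \<Omega>1 {y \<in> space \<Omega>1. f y = g (fst p)} else 0) * h (fst p) \<partial>(\<Omega>2 \<Otimes>\<^sub>M \<Omega>1))"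
        by (intro nn_integral_cong) (auto simp: k_def w_def eq)
      also have "\<dots> = (\<integral>\<^sup>+ x. h x \<partial>\<Omega>2)"
        using nn_integral_cell_kernel[OF P2 P1 gm fm eq[symmetric] hm] by simp
      finally show ?thesis .
    qed
    define \<Omega> where "\<Omega> = density (\<Omega>1 \<Otimes>\<^sub>M \<Omega>2) k"
    have sO[measurable_cong]: "sets \<Omega> = sets (\<Omega>1 \<Otimes>\<^sub>M \<Omega>2)" by (simp add: \<Omega>_def)
    have J1: "(\<integral>\<^sup>+ p. h (fst p) \<partial>\<Omega>) = (\<integral>\<^sup>+ x. h x \<partial>\<Omega>1)" if [measurable]: "h \<in> borel_measurable \<Omega>1" for h
      unfolding \<Omega>_def using I1[OF that] by (subst nn_integral_density) auto
    have J2: "(\<integral>\<^sup>+ p. h (snd p) \<partial>\<Omega>) = (\<integral>\<^sup>+ x. h x \<partial>\<Omega>2)" if [measurable]: "h \<in> borel_measurable \<Omega>2" for h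
      unfolding \<Omega>_def using I2[OF that] by (subst nn_integral_density) auto
    have "prob_space \<Omega>"
    proof
      show "emeasure \<Omega> (space \<Omega>) = 1" using J1[of "\<lambda>_. 1"] O1.emeasure_space_1 by simp
    qed
    then interpret O: prob_space \<Omega> .
    have mm[measurable]: "(\<lambda>p. X (fst p)) \<in> borel_measurable \<Omega>" "(\<lambda>p. Y (fst p)) \<in> borel_measurable \<Omega>"
      "(\<lambda>p. Y' (snd p)) \<in> borel_measurable \<Omega>" "(\<lambda>p. Z (snd p)) \<in> borel_measurable \<Omega>" by measurable
    have mX: "distr \<Omega> borel (\<lambda>p. X (fst p)) = \<mu>"
    proof (rule measure_eqI)
      fix A assume "A \<in> sets (distr \<Omega> borel (\<lambda>p. X (fst p)))"
      then have [measurable]: "A \<in> sets borel" by simp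
      have "emeasure (distr \<Omega> borel (\<lambda>p. X (fst p))) A = (\<integral>\<^sup>+ p. indicator A (X (fst p)) \<partial>\<Omega>)"
        by (subst nn_integral_indicator[symmetric], simp, subst nn_integral_distr) auto
      also have "\<dots> = (\<integral>\<^sup>+ x. indicator A (X x) \<partial>\<Omega>1)" by (rule J1) measurable
      also have "\<dots> = emeasure (distr \<Omega>1 borel X) A"
        by (subst nn_integral_indicator[symmetric, of A "distr \<Omega>1 borel X"], simp, subst nn_integral_distr) auto
      finally show "emeasure (distr \<Omega> borel (\<lambda>p. X (fst p))) A = emeasure \<mu> A" by (simp add: dX)
    qed (simp add: PM_D(2)[OF \<mu>])
    have mZ: "distr \<Omega> borel (\<lambda>p. Z (snd p)) = \<sigma>"
    proof (rule measure_eqI)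
      fix A assume "A \<in> sets (distr \<Omega> borel (\<lambda>p. Z (snd p)))"
      then have [measurable]: "A \<in> sets borel" by simp
      have "emeasure (distr \<Omega> borel (\<lambda>p. Z (snd p))) A = (\<integral>\<^sup>+ p. indicator A (Z (snd p)) \<partial>\<Omega>)"
        by (subst nn_integral_indicator[symmetric], simp, subst nn_integral_distr) auto
      also have "\<dots> = (\<integral>\<^sup>+ x. indicator A (Z x) \<partial>\<Omega>2)" by (rule J2) measurable
      also have "\<dots> = emeasure (distr \<Omega>2 borel Z) A"
        by (subst nn_integral_indicator[symmetric, of A "distr \<Omega>2 borel Z"], simp, subst nn_integral_distr) auto
      finally show "emeasure (distr \<Omega> borel (\<lambda>p. Z (snd p))) A = emeasure \<sigma> A" by (simp add: dZ)
    qed (simp add: PM_D(2)[OF \<sigma>])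
    have AEd: "AE p in \<Omega>. norm (Y (fst p) - Y' (snd p)) \<le> e"
      unfolding \<Omega>_def
    proof (subst AE_density, measurable, intro AE_I2 impI)
      fix p assume "0 < k p"
      then have "c (Y (fst p)) = c (Y' (snd p))" by (auto simp: k_def f_def g_def split: if_splits)
      then show "norm (Y (fst p) - Y' (snd p)) \<le> e" using c by (auto simp: dist_norm less_imp_le)
    qed
    define a b where "a p = norm (X (fst p) - Y (fst p))" and "b p = norm (Y' (snd p) - Z (snd p))" for p
    have ab: "0 \<le> a p" "a p \<le> 2 * B" "0 \<le> b p" "b p \<le> 2 * B" for p
      using bd[OF XM[rule_format]] bd[OF ZM[rule_format]] by (auto simp: a_def b_def)
    have [measurable]: "a \<in> borel_measurable \<Omega>" "b \<in> borel_measurable \<Omega>"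
      unfolding a_def[abs_def] b_def[abs_def] by measurable
    have B0: "0 \<le> B" using B[OF m0] norm_ge_zero order_trans by blast
    have intg: "integrable \<Omega> (\<lambda>p. h p * l p)"
      if [measurable]: "h \<in> borel_measurable \<Omega>" "l \<in> borel_measurable \<Omega>"
        and hC: "\<forall>p. 0 \<le> h p \<and> h p \<le> C" and lD: "\<forall>p. 0 \<le> l p \<and> l p \<le> D" for h l :: "_ \<Rightarrow> real" and C D :: real
    proof (rule O.integrable_const_bound[where B="C * D"])
      have "norm (h p * l p) \<le> C * D" for p
        using hC[rule_format, of p] lD[rule_format, of p] by (simp add: abs_mult mult_mono)
      then show "AE p in \<Omega>. norm (h p * l p) \<le> C * D" by simp
    qed measurable
    have intsq: "integrable \<Omega> (\<lambda>p. (h p)\<^sup>2)"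
      if "h \<in> borel_measurable \<Omega>" "\<forall>p. 0 \<le> h p \<and> h p \<le> C" for h :: "_ \<Rightarrow> real" and C :: real
      unfolding power2_eq_square by (rule intg[OF that(1) that(1) that(2) that(2)])
    have i1: "integrable \<Omega> (\<lambda>p. (norm (X (fst p) - Z (snd p)))\<^sup>2)"
      by (rule intsq[of _ "2*B"]) (use bd[OF XM(1)[rule_format] ZM(2)[rule_format]] in auto)
    have ab4: "0 \<le> a p + b p \<and> a p + b p \<le> 4 * B" for p using ab[of p] by linarith
    have ab5: "0 \<le> a p + b p + e \<and> a p + b p + e \<le> 4 * B + e" for p using ab[of p] e by linarith
    have Ea: "(\<integral>p. (a p)\<^sup>2 \<partial>\<Omega>) = (\<integral>\<omega>. (norm (X \<omega> - Y \<omega>))\<^sup>2 \<partial>\<Omega>1)"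
      using J1[of "\<lambda>\<omega>. ennreal ((norm (X \<omega> - Y \<omega>))\<^sup>2)"] by (simp add: a_def integral_eq_nn_integral)
    have Eb: "(\<integral>p. (b p)\<^sup>2 \<partial>\<Omega>) = (\<integral>\<omega>. (norm (Y' \<omega> - Z \<omega>))\<^sup>2 \<partial>\<Omega>2)"
      using J2[of "\<lambda>\<omega>. ennreal ((norm (Y' \<omega> - Z \<omega>))\<^sup>2)"] by (simp add: b_def integral_eq_nn_integral)
    have "d2 \<mu> \<sigma> \<le> sqrt (\<integral>p. (norm (X (fst p) - Z (snd p)))\<^sup>2 \<partial>\<Omega>)"
      using d2_distr_le[OF \<open>prob_space \<Omega>\<close> mm(1) mm(4) i1] by (simp add: mX mZ)
    also have "\<dots> \<le> sqrt (\<integral>p. ((a p + b p) + e)\<^sup>2 \<partial>\<Omega>)"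
    proof (intro real_sqrt_le_mono integral_mono_AE)
      show "integrable \<Omega> (\<lambda>p. (norm (X (fst p) - Z (snd p)))\<^sup>2)" by (rule i1)
      show "integrable \<Omega> (\<lambda>p. ((a p + b p) + e)\<^sup>2)"
        by (rule intsq[of _ "4 * B + e"]) (use ab5 in auto)
      show "AE p in \<Omega>. (norm (X (fst p) - Z (snd p)))\<^sup>2 \<le> ((a p + b p) + e)\<^sup>2"
        using AEd
      proof eventually_elim
        case (elim p)
        have "X (fst p) - Z (snd p) = (X (fst p) - Y (fst p)) + (Y (fst p) - Y' (snd p)) + (Y' (snd p) - Z (snd p))" by simp
        then have "norm (X (fst p) - Z (snd p)) \<le> a p + norm (Y (fst p) - Y' (snd p)) + b p"
          unfolding a_def b_def
          using norm_triangle_ineq[of "X (fst p) - Y (fst p) + (Y (fst p) - Y' (snd p))" "Y' (snd p) - Z (snd p)"]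
            norm_triangle_ineq[of "X (fst p) - Y (fst p)" "Y (fst p) - Y' (snd p)"] by simp
        then show ?case using elim by (intro power_mono) auto
      qed
    qed
    also have "\<dots> \<le> sqrt (\<integral>p. (a p + b p)\<^sup>2 \<partial>\<Omega>) + sqrt (\<integral>p. e\<^sup>2 \<partial>\<Omega>)"
    proof (rule L2_triangle)
      show "integrable \<Omega> (\<lambda>p. (a p + b p)\<^sup>2)"
        by (rule intsq[of _ "4 * B"]) (use ab4 in auto)
      show "integrable \<Omega> (\<lambda>p. (a p + b p) * e)"
        by (rule intg[of _ _ "4 * B" e]) (use ab4 e in auto)
    qed simp
    also have "sqrt (\<integral>p. e\<^sup>2 \<partial>\<Omega>) = e" using e by (simp add: O.prob_space)
    also have "sqrt (\<integral>p. (a p + b p)\<^sup>2 \<partial>\<Omega>) \<le> sqrt (\<integral>p. (a p)\<^sup>2 \<partial>\<Omega>) + sqrt (\<integral>p. (b p)\<^sup>2 \<partial>\<Omega>)"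
    proof (rule L2_triangle)
      show "integrable \<Omega> (\<lambda>p. (a p)\<^sup>2)" by (rule intsq[of _ "2*B"]) (use ab in auto)
      show "integrable \<Omega> (\<lambda>p. (b p)\<^sup>2)" by (rule intsq[of _ "2*B"]) (use ab in auto)
      show "integrable \<Omega> (\<lambda>p. a p * b p)"
        by (rule intg[of _ _ "2*B" "2*B"]) (use ab in auto)
    qed
    also have "sqrt (\<integral>p. (a p)\<^sup>2 \<partial>\<Omega>) \<le> sqrt ((d2 \<mu> \<nu>)\<^sup>2 + e)" unfolding Ea using c1 by simp
    also have "sqrt (\<integral>p. (b p)\<^sup>2 \<partial>\<Omega>) \<le> sqrt ((d2 \<nu> \<sigma>)\<^sup>2 + e)" unfolding Eb using c2 by simp
    finally show ?thesis by simp
  qed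
  have "((\<lambda>e. sqrt ((d2 \<mu> \<nu>)\<^sup>2 + e) + sqrt ((d2 \<nu> \<sigma>)\<^sup>2 + e) + e) \<longlongrightarrow>
      sqrt ((d2 \<mu> \<nu>)\<^sup>2 + 0) + sqrt ((d2 \<nu> \<sigma>)\<^sup>2 + 0) + 0) (at_right 0)"
    by (intro tendsto_intros)
  then have "d2 \<mu> \<sigma> \<le> sqrt ((d2 \<mu> \<nu>)\<^sup>2 + 0) + sqrt ((d2 \<nu> \<sigma>)\<^sup>2 + 0) + 0"
    by (rule tendsto_lowerbound) (use le in \<open>auto simp: eventually_at_filter\<close>)
  then show ?thesis using d2_nonneg[of \<mu> \<nu>] d2_nonneg[of \<nu> \<sigma>] by simp
qed

lemma d2_refl:
  fixes M :: "'a::euclidean_space set"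
  assumes \<mu>: "\<mu> \<in> PM M"
  shows "d2 \<mu> \<mu> = 0"
proof -
  have "distr \<mu> borel (\<lambda>x. x) = \<mu>" using PM_D(2)[OF \<mu>] by (simp add: distr_id2)
  moreover have "(\<lambda>x. x) \<in> borel_measurable \<mu>" using PM_D(2)[OF \<mu>] by (simp cong: measurable_cong_sets)
  ultimately have "d2 \<mu> \<mu> \<le> sqrt (\<integral>x. (norm (x - x))\<^sup>2 \<partial>\<mu>)"
    using d2_distr_le[OF PM_D(1)[OF \<mu>], of "\<lambda>x. x" "\<lambda>x. x"] by simp
  then show ?thesis using d2_nonneg[of \<mu> \<mu>] by simp
qed

lemma d2_le_commute:
  fixes M :: "'a::euclidean_space set"
  assumes M: "compact M" and \<mu>: "\<mu> \<in> PM M" and \<nu>: "\<nu> \<in> PM M" and m0: "m0 \<in> M"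
  shows "d2 \<nu> \<mu> \<le> d2 \<mu> \<nu>"
proof -
  obtain B where B: "\<And>x. x \<in> M \<Longrightarrow> norm x \<le> B" using compact_imp_bounded[OF M] unfolding bounded_iff by blast
  have le: "(d2 \<nu> \<mu>)\<^sup>2 \<le> (d2 \<mu> \<nu>)\<^sup>2 + e" if e: "e > 0" for e
  proof -
    obtain \<Omega> :: "('a \<times> 'a) measure" and X Y where P: "prob_space \<Omega>"
      and m[measurable]: "X \<in> borel_measurable \<Omega>" "Y \<in> borel_measurable \<Omega>"
      and XM: "\<forall>\<omega>. X \<omega> \<in> M" "\<forall>\<omega>. Y \<omega> \<in> M" and dX: "distr \<Omega> borel X = \<mu>" and dY: "distr \<Omega> borel Y = \<nu>"
      and c: "(\<integral>\<omega>. (norm (X \<omega> - Y \<omega>))\<^sup>2 \<partial>\<Omega>) \<le> (d2 \<mu> \<nu>)\<^sup>2 + e"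
      by (rule d2_realization[OF M m0 \<mu> \<nu> e])
    interpret prob_space \<Omega> by fact
    have "norm (Y \<omega> - X \<omega>) \<le> 2 * B" for \<omega>
      using B[OF XM(1)[rule_format, of \<omega>]] B[OF XM(2)[rule_format, of \<omega>]] norm_triangle_ineq4[of "Y \<omega>" "X \<omega>"] by linarith
    then have "(norm (Y \<omega> - X \<omega>))\<^sup>2 \<le> (2 * B)\<^sup>2" for \<omega> by (rule power_mono) simp
    then have "integrable \<Omega> (\<lambda>\<omega>. (norm (Y \<omega> - X \<omega>))\<^sup>2)"
      by (intro integrable_const_bound[where B="(2*B)\<^sup>2"] AE_I2) simp_all
    then have "d2 \<nu> \<mu> \<le> sqrt (\<integral>\<omega>. (norm (Y \<omega> - X \<omega>))\<^sup>2 \<partial>\<Omega>)"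
      using d2_distr_le[OF P m(2) m(1)] by (simp add: dX dY)
    also have "\<dots> \<le> sqrt ((d2 \<mu> \<nu>)\<^sup>2 + e)" using c by (simp add: norm_minus_commute)
    finally have "(d2 \<nu> \<mu>)\<^sup>2 \<le> (sqrt ((d2 \<mu> \<nu>)\<^sup>2 + e))\<^sup>2" using d2_nonneg by (intro power_mono)
    then show ?thesis using e by simp
  qed
  then have "(d2 \<nu> \<mu>)\<^sup>2 \<le> (d2 \<mu> \<nu>)\<^sup>2" by (rule field_le_epsilon)
  then show ?thesis using d2_nonneg by (rule power2_le_imp_le)
qed

section \<open>The interaction energy on a set of positive reach\<close>

lemma integrable_bounded:
  fixes f :: "'b \<Rightarrow> 'c::{banach, second_countable_topology}"
  assumes "prob_space \<Omega>" "f \<in> borel_measurable \<Omega>" "\<forall>\<omega>. norm (f \<omega>) \<le> C"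
  shows "integrable \<Omega> f"
proof -
  interpret prob_space \<Omega> by fact
  show ?thesis using assms by (intro integrable_const_bound[where B=C]) auto
qed

lemma (in prob_space) norm_integral_le:
  fixes f :: "'a \<Rightarrow> 'c::{banach, second_countable_topology}"
  assumes "f \<in> borel_measurable M" "AE \<omega> in M. norm (f \<omega>) \<le> C"
  shows "norm (\<integral>\<omega>. f \<omega> \<partial>M) \<le> C"
proof -
  have i: "integrable M f" using assms by (intro integrable_const_bound[where B=C]) auto
  have "norm (\<integral>\<omega>. f \<omega> \<partial>M) \<le> (\<integral>\<omega>. norm (f \<omega>) \<partial>M)" by (rule integral_norm_bound)
  also have "\<dots> \<le> (\<integral>\<omega>. C \<partial>M)" using i assms by (intro integral_mono_AE) auto
  finally show ?thesis by (simp add: prob_space)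
qed

lemma GDERIV_norm_diff_le:
  fixes f :: "'a::euclidean_space \<Rightarrow> real"
  assumes S: "convex S" and d: "\<And>x. x \<in> S \<Longrightarrow> GDERIV f x :> g x" and B: "\<And>x. x \<in> S \<Longrightarrow> norm (g x) \<le> B"
    and xy: "x \<in> S" "y \<in> S"
  shows "\<bar>f x - f y\<bar> \<le> B * norm (x - y)"
proof -
  have "norm (f x - f y) \<le> B * norm (x - y)"
  proof (rule differentiable_bound[OF S _ _ xy(1) xy(2)])
    fix x assume x: "x \<in> S"
    show "(f has_derivative (\<lambda>h. h \<bullet> g x)) (at x within S)"
      using d[OF x] by (auto simp: gderiv_def intro: has_derivative_at_withinI)
    show "onorm (\<lambda>h. h \<bullet> g x) \<le> B"
    proof (rule onorm_le)
      fix h show "norm (h \<bullet> g x) \<le> B * norm h"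
        using Cauchy_Schwarz_ineq2[of h "g x"] mult_left_mono[OF B[OF x] norm_ge_zero[of h]]
        by (simp add: mult.commute)
    qed
  qed
  then show ?thesis by simp
qed

text \<open>Removes the slack \<open>e\<close> left by near-optimal couplings.\<close>

lemma le_of_le_sqrt_add:
  fixes A c d :: real
  assumes "\<And>e. e > 0 \<Longrightarrow> A \<le> c * sqrt (d\<^sup>2 + e)" "0 \<le> d"
  shows "A \<le> c * d"
proof -
  have "((\<lambda>e. c * sqrt (d\<^sup>2 + e)) \<longlongrightarrow> c * sqrt (d\<^sup>2 + 0)) (at_right 0)"
    by (intro tendsto_intros)
  then have "A \<le> c * sqrt (d\<^sup>2 + 0)"
    by (rule tendsto_lowerbound) (use assms in \<open>auto simp: eventually_at_filter\<close>)
  then show ?thesis using assms(2) by simp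
qed

text \<open>\<open>K\<close> bounds the gradient and \<open>L\<close> its Lipschitz constant on the
  ball of radius \<open>R\<close>. The extra 1 in \<open>diam\<close> is room for points that have
  left M by at most 1, as flow lines do for short times. The geometry of \<open>P\<close> is
  prescribed on the tube only, its measurability everywhere, so that pushforwards by
  \<open>P\<close> behave.\<close>

locale prox_energy =
  fixes M :: "'a::euclidean_space set" and W :: "'a \<Rightarrow> real" and r K L R :: real and P :: "'a \<Rightarrow> 'a"
  assumes M_compact: "compact M" and M_ne: "M \<noteq> {}" and r: "0 < r"
    and P_in: "infdist x M < r \<Longrightarrow> P x \<in> M"
    and P_dist: "infdist x M < r \<Longrightarrow> norm (x - P x) = infdist x M"
    and P_normal: "infdist x M < r \<Longrightarrow> y \<in> M \<Longrightarrow>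
          2 * r * ((x - P x) \<bullet> (y - P x)) \<le> norm (x - P x) * (norm (y - P x))\<^sup>2"
    and P_meas [measurable]: "P \<in> borel_measurable borel"
    and W_grad: "GDERIV W x :> grad W x"
    and grad_cont: "continuous_on UNIV (grad W)"
    and grad_odd: "grad W (- x) = - grad W x"
    and K: "0 < K" "norm x \<le> R \<Longrightarrow> norm (grad W x) \<le> K"
    and L: "0 \<le> L" "norm x \<le> R \<Longrightarrow> norm y \<le> R \<Longrightarrow> norm (grad W x - grad W y) \<le> L * norm (x - y)"
    and diam: "infdist x M < r \<Longrightarrow> infdist y M < r \<Longrightarrow> norm (x - y) + 1 \<le> R"
begin

lemma M_closed: "closed M" using M_compact by (rule compact_imp_closed)

lemma diam_M: "x \<in> M \<Longrightarrow> y \<in> M \<Longrightarrow> norm (x - y) \<le> R"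
  using diam[of x y] r by simp

lemma W_cont: "continuous_on UNIV W"
  using W_grad by (auto simp: continuous_on_eq_continuous_at gderiv_def intro: has_derivative_continuous)

lemma W_meas [measurable]: "W \<in> borel_measurable borel"
  by (rule borel_measurable_continuous_onI[OF W_cont])

lemma grad_meas [measurable]: "grad W \<in> borel_measurable borel"
  by (rule borel_measurable_continuous_onI[OF grad_cont])

lemma W_diff_le: "norm x \<le> R \<Longrightarrow> norm y \<le> R \<Longrightarrow> \<bar>W x - W y\<bar> \<le> K * norm (x - y)"
  using GDERIV_norm_diff_le[OF convex_cball[of 0 R] W_grad, of K x y] K by simp

text \<open>Mean value estimate for \<open>W\<close> minus its linear part at \<open>a\<close>,
  whose gradient along the segment has norm at most \<open>L * norm (b - a)\<close>.\<close>

lemma W_taylor: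
  assumes "norm a \<le> R" "norm b \<le> R"
  shows "\<bar>W b - W a - grad W a \<bullet> (b - a)\<bar> \<le> L * (norm (b - a))\<^sup>2"
proof -
  let ?f = "\<lambda>z. W z - z \<bullet> grad W a"
  have sub: "closed_segment a b \<subseteq> cball 0 R"
    using assms by (intro closed_segment_subset) auto
  have "\<bar>?f b - ?f a\<bar> \<le> (L * norm (b - a)) * norm (b - a)"
  proof (rule GDERIV_norm_diff_le[where S = "closed_segment a b"])
    fix z assume z: "z \<in> closed_segment a b"
    have "((\<lambda>z. W z - z \<bullet> grad W a) has_derivative (\<lambda>h. h \<bullet> grad W z - h \<bullet> grad W a)) (at z)"
      using W_grad[of z] unfolding gderiv_def by (auto intro!: derivative_eq_intros)
    then show "GDERIV ?f z :> grad W z - grad W a" by (simp add: gderiv_def inner_diff_right)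
    have "norm (grad W z - grad W a) \<le> L * norm (z - a)" using L(2)[of z a] sub z assms by auto
    also have "\<dots> \<le> L * norm (b - a)"
      using segment_bound1[OF z] L(1) by (intro mult_left_mono) auto
    finally show "norm (grad W z - grad W a) \<le> L * norm (b - a)" .
  qed auto
  moreover have "?f b - ?f a = W b - W a - grad W a \<bullet> (b - a)"
    by (simp add: inner_diff_right inner_commute algebra_simps)
  ultimately show ?thesis by (simp add: power2_eq_square mult.assoc)
qed

definition RV :: "'b measure \<Rightarrow> ('b \<Rightarrow> 'a) \<Rightarrow> bool" where
  "RV \<Omega> X \<longleftrightarrow> prob_space \<Omega> \<and> X \<in> borel_measurable \<Omega> \<and> (\<forall>\<omega>. X \<omega> \<in> M)"

definition v :: "'a measure \<Rightarrow> 'a \<Rightarrow> 'a" where "v \<nu> x = - convgrad W \<nu> x"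

definition en :: "'a measure \<Rightarrow> real" where "en \<nu> = 1/2 * (\<integral> x. (\<integral> y. W (x - y) \<partial>\<nu>) \<partial>\<nu>)"

lemma RV_D: assumes "RV \<Omega> X" shows "prob_space \<Omega>" "X \<in> borel_measurable \<Omega>" "X \<omega> \<in> M"
  using assms by (auto simp: RV_def)

lemma RV_PM: "RV \<Omega> X \<Longrightarrow> distr \<Omega> borel X \<in> PM M"
  by (intro PM_distr M_closed) (auto simp: RV_def)

lemma energy_eq: "\<nu> \<in> PM M \<Longrightarrow> energy M W \<nu> = ereal (en \<nu>)"
  by (simp add: energy_def en_def)

lemma realize:
  assumes "\<mu> \<in> PM M" "\<nu> \<in> PM M" "e > 0"
  obtains \<Omega> :: "('a \<times> 'a) measure" and X Y where "RV \<Omega> X" "RV \<Omega> Y" "distr \<Omega> borel X = \<mu>" "distr \<Omega> borel Y = \<nu>"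
    "(\<integral>\<omega>. (norm (X \<omega> - Y \<omega>))\<^sup>2 \<partial>\<Omega>) \<le> (d2 \<mu> \<nu>)\<^sup>2 + e"
proof -
  obtain m0 where "m0 \<in> M" using M_ne by auto
  then show thesis
    by (rule d2_realization[OF M_compact _ assms]) (rule that, auto simp: RV_def)
qed

lemma RV_diff:
  assumes "RV \<Omega> X" "RV \<Omega> Y"
  shows "integrable \<Omega> (\<lambda>\<omega>. norm (X \<omega> - Y \<omega>))" "integrable \<Omega> (\<lambda>\<omega>. (norm (X \<omega> - Y \<omega>))\<^sup>2)"
    "d2 (distr \<Omega> borel X) (distr \<Omega> borel Y) \<le> sqrt (\<integral>\<omega>. (norm (X \<omega> - Y \<omega>))\<^sup>2 \<partial>\<Omega>)"
    "(\<integral>\<omega>. norm (X \<omega> - Y \<omega>) \<partial>\<Omega>) \<le> sqrt (\<integral>\<omega>. (norm (X \<omega> - Y \<omega>))\<^sup>2 \<partial>\<Omega>)"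
proof -
  note [measurable] = RV_D(2)[OF assms(1)] RV_D(2)[OF assms(2)]
  have p: "prob_space \<Omega>" by (rule RV_D(1)[OF assms(1)])
  have b: "norm (X \<omega> - Y \<omega>) \<le> R" for \<omega> using assms by (intro diam_M) (auto simp: RV_def)
  show i1: "integrable \<Omega> (\<lambda>\<omega>. norm (X \<omega> - Y \<omega>))"
    using b by (intro integrable_bounded[OF p, of _ R]) auto
  show i2: "integrable \<Omega> (\<lambda>\<omega>. (norm (X \<omega> - Y \<omega>))\<^sup>2)"
  proof (rule integrable_bounded[OF p, of _ "R\<^sup>2"])
    show "\<forall>\<omega>. norm ((norm (X \<omega> - Y \<omega>))\<^sup>2) \<le> R\<^sup>2" using b by (simp add: power_mono)
  qed measurable
  show "d2 (distr \<Omega> borel X) (distr \<Omega> borel Y) \<le> sqrt (\<integral>\<omega>. (norm (X \<omega> - Y \<omega>))\<^sup>2 \<partial>\<Omega>)"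
    by (rule d2_distr_le[OF p _ _ i2]) auto
  show "(\<integral>\<omega>. norm (X \<omega> - Y \<omega>) \<partial>\<Omega>) \<le> sqrt (\<integral>\<omega>. (norm (X \<omega> - Y \<omega>))\<^sup>2 \<partial>\<Omega>)"
    by (rule prob_space.integral_le_L2[OF p i1 i2])
qed

lemma convgrad_distr:
  assumes "RV \<Omega> X"
  shows "convgrad W (distr \<Omega> borel X) x = (\<integral>\<omega>. grad W (x - X \<omega>) \<partial>\<Omega>)"
  unfolding convgrad_def using RV_D(2)[OF assms] by (intro integral_distr) auto

lemma convgrad_measurable [measurable]:
  assumes "\<nu> \<in> PM M"
  shows "convgrad W \<nu> \<in> borel_measurable borel"
proof -
  interpret prob_space \<nu> using PM_D[OF assms] by simp
  note [measurable_cong] = PM_D(2)[OF assms]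
  show ?thesis unfolding convgrad_def[abs_def]
    by (rule borel_measurable_lebesgue_integral) measurable
qed

lemma v_measurable: "\<nu> \<in> PM M \<Longrightarrow> v \<nu> \<in> borel_measurable borel"
  unfolding v_def[abs_def] by measurable

lemma v_bound:
  assumes \<nu>: "\<nu> \<in> PM M" and x: "x \<in> M"
  shows "norm (v \<nu> x) \<le> K"
proof -
  obtain \<Omega> :: "('a \<times> 'a) measure" and X Y where X: "RV \<Omega> X" "RV \<Omega> Y" "distr \<Omega> borel X = \<nu>"
    by (rule realize[OF \<nu> \<nu>, of 1]) auto
  note [measurable] = RV_D(2)[OF X(1)]
  have "norm (\<integral>\<omega>. grad W (x - X \<omega>) \<partial>\<Omega>) \<le> K"
    using X x by (intro prob_space.norm_integral_le AE_I2 K diam_M) (auto simp: RV_def)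
  then show ?thesis using convgrad_distr[OF X(1), of x] by (simp add: v_def X)
qed

text \<open>Both measures are represented on one space, so that the bound for the velocities
  involves the same variables as the transport cost.\<close>

lemma v_diff:
  assumes X: "RV \<Omega> X" and Y: "RV \<Omega> Y" and x: "x \<in> M" and y: "y \<in> M"
  shows "norm (v (distr \<Omega> borel X) x - v (distr \<Omega> borel Y) y)
      \<le> L * (norm (x - y) + (\<integral>\<omega>. norm (X \<omega> - Y \<omega>) \<partial>\<Omega>))"
proof -
  interpret prob_space \<Omega> using RV_D(1)[OF X] .
  note [measurable] = RV_D(2)[OF X] RV_D(2)[OF Y]
  have i: "integrable \<Omega> (\<lambda>\<omega>. grad W (z - Z \<omega>))" if "RV \<Omega> Z" "z \<in> M" for z Z
    using K(2)[OF diam_M[OF that(2) RV_D(3)[OF that(1)]]] RV_D(2)[OF that(1)]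
    by (intro integrable_bounded[of _ _ K]) (auto intro: prob_space_axioms)
  have "norm (v (distr \<Omega> borel X) x - v (distr \<Omega> borel Y) y)
      = norm (\<integral>\<omega>. grad W (y - Y \<omega>) - grad W (x - X \<omega>) \<partial>\<Omega>)"
    using i[OF X x] i[OF Y y] by (simp add: v_def convgrad_distr[OF X] convgrad_distr[OF Y])
  also have "\<dots> \<le> (\<integral>\<omega>. norm (grad W (y - Y \<omega>) - grad W (x - X \<omega>)) \<partial>\<Omega>)"
    by (rule integral_norm_bound)
  also have "\<dots> \<le> (\<integral>\<omega>. L * (norm (x - y) + norm (X \<omega> - Y \<omega>)) \<partial>\<Omega>)"
  proof (rule integral_mono)
    show "integrable \<Omega> (\<lambda>\<omega>. norm (grad W (y - Y \<omega>) - grad W (x - X \<omega>)))"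
      using i[OF X x] i[OF Y y] by (intro integrable_norm Bochner_Integration.integrable_diff)
    show "integrable \<Omega> (\<lambda>\<omega>. L * (norm (x - y) + norm (X \<omega> - Y \<omega>)))"
      using RV_diff(1)[OF X Y] by simp
    fix \<omega>
    have "norm (grad W (y - Y \<omega>) - grad W (x - X \<omega>)) \<le> L * norm ((y - Y \<omega>) - (x - X \<omega>))"
      using X Y x y by (intro L(2) diam_M) (auto simp: RV_def)
    also have "(y - Y \<omega>) - (x - X \<omega>) = (X \<omega> - Y \<omega>) - (x - y)" by simp
    also have "L * norm ((X \<omega> - Y \<omega>) - (x - y)) \<le> L * (norm (x - y) + norm (X \<omega> - Y \<omega>))"
      using L(1) norm_triangle_ineq4[of "X \<omega> - Y \<omega>" "x - y"] by (intro mult_left_mono) auto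
    finally show "norm (grad W (y - Y \<omega>) - grad W (x - X \<omega>)) \<le> L * (norm (x - y) + norm (X \<omega> - Y \<omega>))" .
  qed
  also have "\<dots> = L * (norm (x - y) + (\<integral>\<omega>. norm (X \<omega> - Y \<omega>) \<partial>\<Omega>))"
    using RV_diff(1)[OF X Y] by (simp add: prob_space)
  finally show ?thesis .
qed

lemma W_bounded: "\<exists>C. \<forall>x. norm x \<le> R \<longrightarrow> \<bar>W x\<bar> \<le> C"
proof -
  have "compact (W ` cball 0 R)"
    using W_cont by (intro compact_continuous_image continuous_on_subset[OF W_cont]) auto
  then have "bounded (W ` cball 0 R)" by (rule compact_imp_bounded)
  then obtain C where "\<forall>y\<in>W ` cball 0 R. norm y \<le> C" unfolding bounded_iff by blast
  then have "\<bar>W x\<bar> \<le> C" if "norm x \<le> R" for x using that by simp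
  then show ?thesis by blast
qed

lemma integrable_W:
  assumes X: "RV \<Omega> X"
  shows "integrable (\<Omega> \<Otimes>\<^sub>M \<Omega>) (\<lambda>p. W (X (fst p) - X (snd p)))"
proof -
  interpret prob_space \<Omega> using RV_D(1)[OF X] .
  interpret PP: pair_prob_space \<Omega> \<Omega> ..
  note [measurable] = RV_D(2)[OF X]
  obtain C where C: "\<forall>x. norm x \<le> R \<longrightarrow> \<bar>W x\<bar> \<le> C" using W_bounded by blast
  have "\<forall>p. norm (W (X (fst p) - X (snd p))) \<le> C"
    using C diam_M[OF RV_D(3)[OF X] RV_D(3)[OF X]] by simp
  then show ?thesis by (intro integrable_bounded[OF PP.prob_space_axioms, of _ C]) measurable
qed

lemma en_distr:
  assumes X: "RV \<Omega> X"
  shows "2 * en (distr \<Omega> borel X) = (\<integral>p. W (X (fst p) - X (snd p)) \<partial>(\<Omega> \<Otimes>\<^sub>M \<Omega>))"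
proof -
  interpret prob_space \<Omega> using RV_D(1)[OF X] .
  interpret PP: pair_prob_space \<Omega> \<Omega> ..
  note [measurable] = RV_D(2)[OF X]
  have *: "(\<integral>y. W (x - y) \<partial>distr \<Omega> borel X) = (\<integral>\<omega>. W (x - X \<omega>) \<partial>\<Omega>)" for x
    by (intro integral_distr) auto
  have "(\<lambda>x. \<integral>\<omega>. W (x - X \<omega>) \<partial>\<Omega>) \<in> borel_measurable borel"
    by (rule borel_measurable_lebesgue_integral) measurable
  then have "2 * en (distr \<Omega> borel X) = (\<integral>\<omega>'. (\<integral>\<omega>. W (X \<omega>' - X \<omega>) \<partial>\<Omega>) \<partial>\<Omega>)"
    unfolding en_def * by (subst integral_distr) auto
  also have "\<dots> = (\<integral>p. W (X (fst p) - X (snd p)) \<partial>(\<Omega> \<Otimes>\<^sub>M \<Omega>))"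
    using PP.integral_fst'[OF integrable_W[OF X]] by simp
  finally show ?thesis .
qed

lemma integral_pair_sum:
  fixes f :: "'b \<Rightarrow> real"
  assumes "prob_space \<Omega>" and f: "integrable \<Omega> f"
  shows "integrable (\<Omega> \<Otimes>\<^sub>M \<Omega>) (\<lambda>p. f (fst p) + f (snd p))"
    "(\<integral>p. f (fst p) + f (snd p) \<partial>(\<Omega> \<Otimes>\<^sub>M \<Omega>)) = 2 * (\<integral>\<omega>. f \<omega> \<partial>\<Omega>)"
proof -
  interpret prob_space \<Omega> by fact
  interpret PP: pair_prob_space \<Omega> \<Omega> ..
  have [measurable]: "f \<in> borel_measurable \<Omega>" using f by auto
  have d1: "distr (\<Omega> \<Otimes>\<^sub>M \<Omega>) \<Omega> fst = \<Omega>" by (rule distr_pair_fst)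
  have d2: "distr (\<Omega> \<Otimes>\<^sub>M \<Omega>) \<Omega> snd = \<Omega>"
  proof -
    have "distr (\<Omega> \<Otimes>\<^sub>M \<Omega>) \<Omega> snd = distr (distr (\<Omega> \<Otimes>\<^sub>M \<Omega>) (\<Omega> \<Otimes>\<^sub>M \<Omega>) (\<lambda>(x, y). (y, x))) \<Omega> snd"
      using PP.distr_pair_swap by simp
    also have "\<dots> = distr (\<Omega> \<Otimes>\<^sub>M \<Omega>) \<Omega> fst"
      by (subst distr_distr) (auto simp: comp_def split_beta)
    finally show ?thesis using d1 by simp
  qed
  have i: "integrable (\<Omega> \<Otimes>\<^sub>M \<Omega>) (\<lambda>p. f (fst p))" "integrable (\<Omega> \<Otimes>\<^sub>M \<Omega>) (\<lambda>p. f (snd p))"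
    using integrable_distr[of fst "\<Omega> \<Otimes>\<^sub>M \<Omega>" \<Omega> f] integrable_distr[of snd "\<Omega> \<Otimes>\<^sub>M \<Omega>" \<Omega> f] f d1 d2 by auto
  then show "integrable (\<Omega> \<Otimes>\<^sub>M \<Omega>) (\<lambda>p. f (fst p) + f (snd p))" by simp
  have "(\<integral>p. f (fst p) \<partial>(\<Omega> \<Otimes>\<^sub>M \<Omega>)) = (\<integral>\<omega>. f \<omega> \<partial>\<Omega>)" "(\<integral>p. f (snd p) \<partial>(\<Omega> \<Otimes>\<^sub>M \<Omega>)) = (\<integral>\<omega>. f \<omega> \<partial>\<Omega>)"
    using integral_distr[of fst "\<Omega> \<Otimes>\<^sub>M \<Omega>" \<Omega> f] integral_distr[of snd "\<Omega> \<Otimes>\<^sub>M \<Omega>" \<Omega> f] d1 d2 by auto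
  then show "(\<integral>p. f (fst p) + f (snd p) \<partial>(\<Omega> \<Otimes>\<^sub>M \<Omega>)) = 2 * (\<integral>\<omega>. f \<omega> \<partial>\<Omega>)" using i by simp
qed

lemma en_diff_le:
  assumes X: "RV \<Omega> X" and Y: "RV \<Omega> Y"
  shows "\<bar>en (distr \<Omega> borel Y) - en (distr \<Omega> borel X)\<bar> \<le> K * (\<integral>\<omega>. norm (X \<omega> - Y \<omega>) \<partial>\<Omega>)"
proof -
  interpret prob_space \<Omega> using RV_D(1)[OF X] .
  let ?f = "\<lambda>\<omega>. norm (X \<omega> - Y \<omega>)"
  note i = integral_pair_sum[OF prob_space_axioms RV_diff(1)[OF X Y]]
  have "2 * en (distr \<Omega> borel Y) - 2 * en (distr \<Omega> borel X)
    = (\<integral>p. W (Y (fst p) - Y (snd p)) - W (X (fst p) - X (snd p)) \<partial>(\<Omega> \<Otimes>\<^sub>M \<Omega>))"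
    using integrable_W[OF X] integrable_W[OF Y] by (simp add: en_distr X Y)
  also have "norm \<dots> \<le> (\<integral>p. norm (W (Y (fst p) - Y (snd p)) - W (X (fst p) - X (snd p))) \<partial>(\<Omega> \<Otimes>\<^sub>M \<Omega>))"
    by (rule integral_norm_bound)
  also have "\<dots> \<le> (\<integral>p. K * (?f (fst p) + ?f (snd p)) \<partial>(\<Omega> \<Otimes>\<^sub>M \<Omega>))"
  proof (rule integral_mono)
    show "integrable (\<Omega> \<Otimes>\<^sub>M \<Omega>) (\<lambda>p. norm (W (Y (fst p) - Y (snd p)) - W (X (fst p) - X (snd p))))"
      using integrable_W[OF X] integrable_W[OF Y] by (intro integrable_norm Bochner_Integration.integrable_diff)
    show "integrable (\<Omega> \<Otimes>\<^sub>M \<Omega>) (\<lambda>p. K * (?f (fst p) + ?f (snd p)))" using i(1) by simp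
    fix p
    have "norm (W (Y (fst p) - Y (snd p)) - W (X (fst p) - X (snd p)))
        \<le> K * norm ((Y (fst p) - Y (snd p)) - (X (fst p) - X (snd p)))"
      using W_diff_le[OF diam_M[OF RV_D(3)[OF Y] RV_D(3)[OF Y]] diam_M[OF RV_D(3)[OF X] RV_D(3)[OF X]]] by simp
    also have "(Y (fst p) - Y (snd p)) - (X (fst p) - X (snd p)) = (X (snd p) - Y (snd p)) - (X (fst p) - Y (fst p))" by simp
    also have "K * norm ((X (snd p) - Y (snd p)) - (X (fst p) - Y (fst p))) \<le> K * (?f (fst p) + ?f (snd p))"
      using K(1) norm_triangle_ineq4[of "X (snd p) - Y (snd p)" "X (fst p) - Y (fst p)"] by (intro mult_left_mono) auto
    finally show "norm (W (Y (fst p) - Y (snd p)) - W (X (fst p) - X (snd p))) \<le> K * (?f (fst p) + ?f (snd p))" .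
  qed
  also have "\<dots> = 2 * (K * (\<integral>\<omega>. ?f \<omega> \<partial>\<Omega>))" using i by simp
  finally show ?thesis by simp
qed

text \<open>Besides bounding the speed of the gradient flow, this settles competitors at distance 0
  in the slope estimate: their energies agree.\<close>

lemma en_lipschitz:
  assumes \<mu>: "\<mu> \<in> PM M" and \<nu>: "\<nu> \<in> PM M"
  shows "\<bar>en \<nu> - en \<mu>\<bar> \<le> K * d2 \<mu> \<nu>"
proof (rule le_of_le_sqrt_add[OF _ d2_nonneg])
  fix e :: real assume e: "e > 0"
  obtain \<Omega> :: "('a \<times> 'a) measure" and X Y where X: "RV \<Omega> X" and Y: "RV \<Omega> Y"
    and d: "distr \<Omega> borel X = \<mu>" "distr \<Omega> borel Y = \<nu>"
    and c: "(\<integral>\<omega>. (norm (X \<omega> - Y \<omega>))\<^sup>2 \<partial>\<Omega>) \<le> (d2 \<mu> \<nu>)\<^sup>2 + e"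
    by (rule realize[OF \<mu> \<nu> e])
  have "\<bar>en \<nu> - en \<mu>\<bar> \<le> K * (\<integral>\<omega>. norm (X \<omega> - Y \<omega>) \<partial>\<Omega>)" using en_diff_le[OF X Y] by (simp add: d)
  also have "\<dots> \<le> K * sqrt ((d2 \<mu> \<nu>)\<^sup>2 + e)"
    using K(1) order_trans[OF RV_diff(4)[OF X Y] real_sqrt_le_mono[OF c]] by (intro mult_left_mono) auto
  finally show "\<bar>en \<nu> - en \<mu>\<bar> \<le> K * sqrt ((d2 \<mu> \<nu>)\<^sup>2 + e)" .
qed

text \<open>By oddness of the gradient, both slots of the double integral contribute equally.\<close>
lemma en_taylor:
  assumes X: "RV \<Omega> X" and Y: "RV \<Omega> Y"
  shows "\<bar>en (distr \<Omega> borel Y) - en (distr \<Omega> borel X) + (\<integral>\<omega>. v (distr \<Omega> borel X) (X \<omega>) \<bullet> (Y \<omega> - X \<omega>) \<partial>\<Omega>)\<bar>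
     \<le> 2 * L * (\<integral>\<omega>. (norm (X \<omega> - Y \<omega>))\<^sup>2 \<partial>\<Omega>)"
proof -
  interpret prob_space \<Omega> using RV_D(1)[OF X] .
  interpret PP: pair_prob_space \<Omega> \<Omega> ..
  note [measurable] = RV_D(2)[OF X] RV_D(2)[OF Y]
  let ?f = "\<lambda>\<omega>. (norm (X \<omega> - Y \<omega>))\<^sup>2"
  define D where "D \<omega> = Y \<omega> - X \<omega>" for \<omega>
  define g where "g p = grad W (X (fst p) - X (snd p))" for p
  have [measurable]: "D \<in> borel_measurable \<Omega>" "g \<in> borel_measurable (\<Omega> \<Otimes>\<^sub>M \<Omega>)"
    unfolding D_def[abs_def] g_def[abs_def] by measurable
  note i = integral_pair_sum[OF prob_space_axioms RV_diff(2)[OF X Y]]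
  have gK: "norm (g p) \<le> K" for p unfolding g_def by (intro K diam_M RV_D[OF X])
  have DR: "norm (D \<omega>) \<le> R" for \<omega> unfolding D_def by (intro diam_M RV_D[OF X] RV_D[OF Y])
  have gD: "\<bar>g p \<bullet> D \<omega>\<bar> \<le> K * R" for p \<omega>
  proof -
    have "\<bar>g p \<bullet> D \<omega>\<bar> \<le> norm (g p) * norm (D \<omega>)" by (rule Cauchy_Schwarz_ineq2)
    also have "\<dots> \<le> K * R" using gK[of p] DR[of \<omega>] K(1) by (intro mult_mono) auto
    finally show ?thesis .
  qed
  have i1: "integrable (\<Omega> \<Otimes>\<^sub>M \<Omega>) (\<lambda>p. g p \<bullet> D (fst p))"
    using gD by (intro integrable_bounded[OF PP.prob_space_axioms, of _ "K * R"]) auto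
  have i2: "integrable (\<Omega> \<Otimes>\<^sub>M \<Omega>) (\<lambda>p. g p \<bullet> D (snd p))"
    using gD by (intro integrable_bounded[OF PP.prob_space_axioms, of _ "K * R"]) auto
  have gi: "integrable \<Omega> (\<lambda>\<omega>'. g (\<omega>, \<omega>'))" for \<omega>
  proof (rule integrable_bounded[OF prob_space_axioms, of _ K])
    show "(\<lambda>\<omega>'. g (\<omega>, \<omega>')) \<in> borel_measurable \<Omega>" unfolding g_def by simp
  qed (use gK in auto)
  have A: "(\<integral>p. g p \<bullet> D (fst p) \<partial>(\<Omega> \<Otimes>\<^sub>M \<Omega>)) = - (\<integral>\<omega>. v (distr \<Omega> borel X) (X \<omega>) \<bullet> D \<omega> \<partial>\<Omega>)"
  proof -
    have "(\<integral>p. g p \<bullet> D (fst p) \<partial>(\<Omega> \<Otimes>\<^sub>M \<Omega>)) = (\<integral>\<omega>. (\<integral>\<omega>'. g (\<omega>, \<omega>') \<bullet> D \<omega> \<partial>\<Omega>) \<partial>\<Omega>)"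
      using PP.integral_fst'[OF i1] by simp
    also have "\<dots> = (\<integral>\<omega>. - (v (distr \<Omega> borel X) (X \<omega>) \<bullet> D \<omega>) \<partial>\<Omega>)"
      using gi by (intro Bochner_Integration.integral_cong)
        (auto simp: v_def convgrad_distr[OF X] g_def)
    finally show ?thesis by simp
  qed
  have B: "(\<integral>p. g p \<bullet> D (snd p) \<partial>(\<Omega> \<Otimes>\<^sub>M \<Omega>)) = - (\<integral>p. g p \<bullet> D (fst p) \<partial>(\<Omega> \<Otimes>\<^sub>M \<Omega>))"
  proof -
    have "(\<integral>p. g p \<bullet> D (snd p) \<partial>(\<Omega> \<Otimes>\<^sub>M \<Omega>)) = (\<integral>p. (case p of (x, y) \<Rightarrow> g (y, x) \<bullet> D x) \<partial>(\<Omega> \<Otimes>\<^sub>M \<Omega>))"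
      using PP.integral_product_swap[of "\<lambda>p. g p \<bullet> D (snd p)"] by simp
    also have "\<dots> = (\<integral>p. - (g p \<bullet> D (fst p)) \<partial>(\<Omega> \<Otimes>\<^sub>M \<Omega>))"
    proof (intro Bochner_Integration.integral_cong refl)
      fix p
      have "g (snd p, fst p) = - g p" unfolding g_def
        using grad_odd[of "X (fst p) - X (snd p)"] by simp
      then show "(case p of (x, y) \<Rightarrow> g (y, x) \<bullet> D x) = - (g p \<bullet> D (fst p))" by (simp add: split_beta)
    qed
    finally show ?thesis by simp
  qed
  have arith: "t = 2 * a - 2 * b + 2 * c \<Longrightarrow> 2 * \<bar>a - b + c\<bar> = \<bar>t\<bar>" for a b c t :: real
  proof -
    assume "t = 2 * a - 2 * b + 2 * c"
    then have "t = 2 * (a - b + c)" by simp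
    then show "2 * \<bar>a - b + c\<bar> = \<bar>t\<bar>" by (simp only: abs_mult abs_numeral)
  qed
  let ?T = "\<lambda>p. W (Y (fst p) - Y (snd p)) - W (X (fst p) - X (snd p)) - (g p \<bullet> D (fst p) - g p \<bullet> D (snd p))"
  have iT: "integrable (\<Omega> \<Otimes>\<^sub>M \<Omega>) ?T" using integrable_W[OF X] integrable_W[OF Y] i1 i2 by simp
  have "(\<integral>p. ?T p \<partial>(\<Omega> \<Otimes>\<^sub>M \<Omega>)) = 2 * en (distr \<Omega> borel Y) - 2 * en (distr \<Omega> borel X)
      + 2 * (\<integral>\<omega>. v (distr \<Omega> borel X) (X \<omega>) \<bullet> D \<omega> \<partial>\<Omega>)"
    using integrable_W[OF X] integrable_W[OF Y] i1 i2 A B by (simp add: en_distr X Y)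
  then have "2 * \<bar>en (distr \<Omega> borel Y) - en (distr \<Omega> borel X) + (\<integral>\<omega>. v (distr \<Omega> borel X) (X \<omega>) \<bullet> D \<omega> \<partial>\<Omega>)\<bar>
     = norm (\<integral>p. ?T p \<partial>(\<Omega> \<Otimes>\<^sub>M \<Omega>))"
    unfolding real_norm_def by (rule arith)
  also have "\<dots> \<le> (\<integral>p. norm (?T p) \<partial>(\<Omega> \<Otimes>\<^sub>M \<Omega>))" by (rule integral_norm_bound)
  also have "\<dots> \<le> (\<integral>p. 2 * L * (?f (fst p) + ?f (snd p)) \<partial>(\<Omega> \<Otimes>\<^sub>M \<Omega>))"
  proof (rule integral_mono)
    show "integrable (\<Omega> \<Otimes>\<^sub>M \<Omega>) (\<lambda>p. norm (?T p))" using iT by (rule integrable_norm)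
    show "integrable (\<Omega> \<Otimes>\<^sub>M \<Omega>) (\<lambda>p. 2 * L * (?f (fst p) + ?f (snd p)))" using i(1) by simp
    fix p
    have e: "(Y (fst p) - Y (snd p)) - (X (fst p) - X (snd p)) = D (fst p) - D (snd p)" by (simp add: D_def)
    have "norm (?T p) \<le> L * (norm (D (fst p) - D (snd p)))\<^sup>2"
      using W_taylor[OF diam_M[OF RV_D(3)[OF X] RV_D(3)[OF X]] diam_M[OF RV_D(3)[OF Y] RV_D(3)[OF Y]], of "fst p" "snd p" "fst p" "snd p"]
      unfolding e by (simp add: g_def inner_diff_right)
    \<comment> \<open>Separating the two slots of the squared difference costs the factor 2 in the
      constant \<open>2 * L\<close>.\<close>
    also have "(norm (D (fst p) - D (snd p)))\<^sup>2 \<le> 2 * (?f (fst p) + ?f (snd p))"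
    proof -
      have "(norm (D (fst p) - D (snd p)))\<^sup>2 \<le> (norm (D (fst p)) + norm (D (snd p)))\<^sup>2"
        by (intro power_mono norm_triangle_ineq4) auto
      also have "\<dots> \<le> 2 * ((norm (D (fst p)))\<^sup>2 + (norm (D (snd p)))\<^sup>2)"
        using sum_squares_bound[of "norm (D (fst p))" "norm (D (snd p))"] by (simp add: power2_sum)
      finally show ?thesis by (simp add: D_def norm_minus_commute)
    qed
    then have "L * (norm (D (fst p) - D (snd p)))\<^sup>2 \<le> L * (2 * (?f (fst p) + ?f (snd p)))"
      using L(1) by (rule mult_left_mono)
    also have "L * (2 * (?f (fst p) + ?f (snd p))) = 2 * L * (?f (fst p) + ?f (snd p))" by (rule mult.left_commute[THEN trans], rule mult.assoc[symmetric])
    finally show "norm (?T p) \<le> 2 * L * (?f (fst p) + ?f (snd p))" .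
  qed
  also have "\<dots> = 2 * (2 * L * (\<integral>\<omega>. ?f \<omega> \<partial>\<Omega>))" using i by simp
  finally show ?thesis by (simp add: D_def)
qed

end

section \<open>The projected Euler step\<close>

context prox_energy
begin

text \<open>Apply \<open>P_normal\<close> at \<open>x\<close> against \<open>P y\<close> and at
  \<open>y\<close> against \<open>P x\<close>. In sum, the inner product of \<open>x - y\<close>
  with \<open>P x - P y\<close> is at least \<open>1 - s / r\<close> times the squared norm of
  \<open>P x - P y\<close>, and Cauchy-Schwarz concludes.\<close>

lemma P_lipschitz:
  assumes x: "infdist x M \<le> s" and y: "infdist y M \<le> s" and s: "s < r"
  shows "(1 - s / r) * norm (P x - P y) \<le> norm (x - y)"
proof (cases "P x = P y")
  case False
  define D where "D = norm (P x - P y)"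
  have D: "D > 0" using False by (simp add: D_def)
  have *: "- (s * D\<^sup>2) / (2 * r) \<le> (u - P u) \<bullet> (P u - P w)"
    if "infdist u M \<le> s" "infdist w M \<le> s" "norm (P w - P u) = D" for u w
  proof -
    have "2 * r * ((u - P u) \<bullet> (P w - P u)) \<le> norm (u - P u) * D\<^sup>2"
      using P_normal[of u "P w"] P_in[of w] that s by simp
    also have "\<dots> \<le> s * D\<^sup>2" using P_dist[of u] that s by (intro mult_right_mono) auto
    finally have "(u - P u) \<bullet> (P w - P u) \<le> s * D\<^sup>2 / (2 * r)" using r by (simp add: field_simps)
    moreover have "(u - P u) \<bullet> (P u - P w) = - ((u - P u) \<bullet> (P w - P u))"
      by (simp add: inner_diff_right)
    ultimately show ?thesis by simp
  qed
  have 1: "- (s * D\<^sup>2) / (2 * r) \<le> (x - P x) \<bullet> (P x - P y)"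
    using *[OF x y] by (simp add: D_def norm_minus_commute)
  have 2: "- (s * D\<^sup>2) / (2 * r) \<le> (y - P y) \<bullet> (P y - P x)"
    using *[OF y x] by (simp add: D_def)
  have "(x - y) \<bullet> (P x - P y) = (x - P x) \<bullet> (P x - P y) + (y - P y) \<bullet> (P y - P x) + D\<^sup>2"
    unfolding D_def power2_norm_eq_inner by (simp add: inner_diff_left inner_diff_right inner_commute)
  then have "D\<^sup>2 - s * D\<^sup>2 / r \<le> (x - y) \<bullet> (P x - P y)" using 1 2 by (simp add: field_simps)
  also have "\<dots> \<le> norm (x - y) * D" unfolding D_def by (rule norm_cauchy_schwarz)
  finally have "((1 - s / r) * D) * D \<le> norm (x - y) * D" by (simp add: algebra_simps power2_eq_square)
  then show ?thesis using D unfolding D_def[symmetric] by simp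
qed simp

lemma P_near:
  assumes x: "x \<in> M" and p: "norm (p - x) < r"
  shows "infdist p M \<le> norm (p - x)" "P p \<in> M" "norm (p - P p) \<le> norm (p - x)" "norm (P p - x) \<le> 2 * norm (p - x)"
proof -
  show i: "infdist p M \<le> norm (p - x)" using infdist_le[OF x, of p] by (simp add: dist_norm)
  then have lt: "infdist p M < r" using p by simp
  show "P p \<in> M" by (rule P_in[OF lt])
  show n: "norm (p - P p) \<le> norm (p - x)" using P_dist[OF lt] i by simp
  have "norm (P p - x) \<le> norm (P p - p) + norm (p - x)" by (rule norm_diff_triangle_ineq[of "P p" p p x, simplified])
  then show "norm (P p - x) \<le> 2 * norm (p - x)" using n by (simp add: norm_minus_commute)
qed

text \<open>Average the normal inequalities at \<open>w\<close> against both endpoints with weights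
  \<open>1 - s\<close> and \<open>s\<close>; since \<open>n\<close> is the same average of
  \<open>x - P w\<close> and \<open>y - P w\<close>, the left side becomes
  \<open>2 * r * (norm n)\<^sup>2\<close>. The factor \<open>s\<close> in the bound is essential:
  dividing by \<open>s\<close>, the projected chord leaves \<open>x\<close> in the direction
  \<open>y - x\<close> up to an error quadratic in the length of the chord.\<close>

lemma P_interpolate:
  assumes x: "x \<in> M" and y: "y \<in> M" and s: "0 \<le> s" "s \<le> 1" and xy: "norm (x - y) < r"
  defines "w \<equiv> x + s *\<^sub>R (y - x)"
  shows "infdist w M < r" "r * norm (w - P w) \<le> s * (norm (x - y))\<^sup>2"
proof -
  have "norm (w - x) = s * norm (x - y)" using s by (simp add: w_def norm_minus_commute)
  also have "\<dots> \<le> norm (x - y)" using s by (simp add: mult_left_le_one_le)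
  finally have wx: "norm (w - x) < r" using xy by simp
  then show lt: "infdist w M < r" using P_near(1)[OF x wx] by simp
  define n where "n = w - P w"
  have nr: "norm n < r" using P_near(3)[OF x wx] wx by (simp add: n_def)
  have a: "2 * r * (n \<bullet> (x - P w)) \<le> norm n * (norm (x - P w))\<^sup>2"
    and b: "2 * r * (n \<bullet> (y - P w)) \<le> norm n * (norm (y - P w))\<^sup>2"
    using P_normal[OF lt x] P_normal[OF lt y] by (simp_all add: n_def)
  have nn: "n = (1 - s) *\<^sub>R (x - P w) + s *\<^sub>R (y - P w)"
    unfolding n_def by (simp add: w_def algebra_simps)
  have "2 * r * (norm n)\<^sup>2 = (1 - s) * (2 * r * (n \<bullet> (x - P w))) + s * (2 * r * (n \<bullet> (y - P w)))"
  proof -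
    have "(norm n)\<^sup>2 = n \<bullet> ((1 - s) *\<^sub>R (x - P w) + s *\<^sub>R (y - P w))"
      using nn by (simp add: power2_norm_eq_inner)
    also have "\<dots> = (1 - s) * (n \<bullet> (x - P w)) + s * (n \<bullet> (y - P w))"
      by (simp only: inner_add_right inner_scaleR_right)
    finally have e: "(norm n)\<^sup>2 = (1 - s) * (n \<bullet> (x - P w)) + s * (n \<bullet> (y - P w))" .
    show ?thesis unfolding e by (simp add: algebra_simps)
  qed
  also have "\<dots> \<le> (1 - s) * (norm n * (norm (x - P w))\<^sup>2) + s * (norm n * (norm (y - P w))\<^sup>2)"
    using a b s by (intro add_mono mult_left_mono) auto
  also have "\<dots> = norm n * ((1 - s) * (norm (x - P w))\<^sup>2 + s * (norm (y - P w))\<^sup>2)"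
    by (simp add: algebra_simps)
  also have "(1 - s) * (norm (x - P w))\<^sup>2 + s * (norm (y - P w))\<^sup>2 = (norm n)\<^sup>2 + s * (1 - s) * (norm (x - y))\<^sup>2"
  proof -
    have xy': "x - y = (x - P w) - (y - P w)" by simp
    show ?thesis unfolding nn xy' power2_norm_eq_inner
      by (simp only: inner_add_left inner_add_right inner_diff_left inner_diff_right inner_scaleR_left
          inner_scaleR_right inner_commute) (simp add: algebra_simps)
  qed
  finally have le: "2 * r * (norm n)\<^sup>2 \<le> norm n * ((norm n)\<^sup>2 + s * (1 - s) * (norm (x - y))\<^sup>2)" .
  show "r * norm (w - P w) \<le> s * (norm (x - y))\<^sup>2"
  proof (cases "n = 0")
    case True
    then show ?thesis using s by (simp add: n_def)
  next
    case False
    have "norm n * (2 * r * norm n) \<le> norm n * ((norm n)\<^sup>2 + s * (1 - s) * (norm (x - y))\<^sup>2)"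
      using le by (simp add: power2_eq_square algebra_simps)
    then have "2 * r * norm n \<le> (norm n)\<^sup>2 + s * (1 - s) * (norm (x - y))\<^sup>2"
      using False by simp
    \<comment> \<open>Since \<open>norm n < r\<close>, the left side absorbs this term.\<close>
    moreover have "(norm n)\<^sup>2 \<le> r * norm n" using nr by (simp add: power2_eq_square mult_right_mono)
    moreover have "s * (1 - s) * (norm (x - y))\<^sup>2 \<le> s * (norm (x - y))\<^sup>2"
      using s by (intro mult_right_mono) (auto simp: mult_left_le)
    ultimately show ?thesis by (simp add: n_def)
  qed
qed

definition z :: "'a measure \<Rightarrow> real \<Rightarrow> 'a \<Rightarrow> 'a" where "z \<nu> h x = P (x + h *\<^sub>R v \<nu> x)"

definition euler :: "'a measure \<Rightarrow> real \<Rightarrow> 'a measure" where "euler \<nu> h = distr \<nu> borel (z \<nu> h)"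

text \<open>The integrand \<open>2 * h * (v \<nu> x \<bullet> (z \<nu> h x - x)) - (norm (z \<nu> h
  x - x))\<^sup>2\<close> after completing the square. This form involves the projection only
  through the distance to M, whose 1-Lipschitz continuity yields measurability and the dependence on
  the measure.\<close>

definition j :: "'a measure \<Rightarrow> real \<Rightarrow> 'a \<Rightarrow> real" where
  "j \<nu> h x = h\<^sup>2 * (norm (v \<nu> x))\<^sup>2 - (infdist (x + h *\<^sub>R v \<nu> x) M)\<^sup>2"

definition J :: "'a measure \<Rightarrow> real \<Rightarrow> real" where "J \<nu> h = (\<integral>x. j \<nu> h x \<partial>\<nu>)"

text \<open>The factor 4 makes \<open>1 - K * h / r\<close> at least 3/4, so that it can be inverted
  at the cost of \<open>1 + 2 * (K * h / r)\<close>; it also puts \<open>z \<nu> h x\<close> closer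
  than \<open>r\<close> to \<open>x\<close>, as \<open>P_interpolate\<close> requires.\<close>

definition small :: "real \<Rightarrow> bool" where "small h \<longleftrightarrow> 0 < h \<and> 4 * K * h \<le> r"

lemma smallD: assumes "small h" shows "0 < h" "K * h < r" "K * h / r \<le> 1 / 4" "0 \<le> K * h / r" "2 * (K * h) < r"
  "K * h / r \<le> 1"
proof -
  show h: "0 < h" using assms by (simp add: small_def)
  then have p: "0 < K * h" using K(1) by simp
  then show "K * h < r" "K * h / r \<le> 1 / 4" "0 \<le> K * h / r" "2 * (K * h) < r" "K * h / r \<le> 1"
    using assms r by (auto simp: small_def field_simps)
qed

lemma z_measurable: "\<nu> \<in> PM M \<Longrightarrow> z \<nu> h \<in> borel_measurable borel"
  unfolding z_def[abs_def] using v_measurable[of \<nu>] by measurable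

lemma euler_point:
  assumes \<nu>: "\<nu> \<in> PM M" and x: "x \<in> M" and h: "small h"
  defines "p \<equiv> x + h *\<^sub>R v \<nu> x"
  shows "norm (p - x) \<le> K * h" "infdist p M \<le> K * h" "infdist p M < r" "z \<nu> h x \<in> M"
    "norm (z \<nu> h x - x) \<le> 2 * K * h" "norm (p - z \<nu> h x) = infdist p M"
    "j \<nu> h x = 2 * h * (v \<nu> x \<bullet> (z \<nu> h x - x)) - (norm (z \<nu> h x - x))\<^sup>2"
    "0 \<le> j \<nu> h x" "j \<nu> h x \<le> h\<^sup>2 * K\<^sup>2"
proof -
  have px: "norm (p - x) = h * norm (v \<nu> x)" using smallD[OF h] by (simp add: p_def)
  show 1: "norm (p - x) \<le> K * h"
    using v_bound[OF \<nu> x] smallD(1)[OF h] unfolding px by (simp add: mult.commute mult_right_mono)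
  then have lt: "norm (p - x) < r" using smallD[OF h] by simp
  note N = P_near[OF x lt]
  show "infdist p M \<le> K * h" using N 1 by simp
  then show i: "infdist p M < r" using smallD[OF h] by simp
  have zp: "z \<nu> h x = P p" by (simp add: z_def p_def)
  show "z \<nu> h x \<in> M" unfolding zp by (rule N)
  show "norm (z \<nu> h x - x) \<le> 2 * K * h" using N(4) 1 unfolding zp by simp
  show d: "norm (p - z \<nu> h x) = infdist p M" unfolding zp by (rule P_dist[OF i])
  have pz: "p - z \<nu> h x = h *\<^sub>R v \<nu> x - (z \<nu> h x - x)" by (simp add: p_def)
  have "(infdist p M)\<^sup>2 = h\<^sup>2 * (norm (v \<nu> x))\<^sup>2 - 2 * h * (v \<nu> x \<bullet> (z \<nu> h x - x)) + (norm (z \<nu> h x - x))\<^sup>2"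
    unfolding d[symmetric] pz power2_norm_eq_inner
    by (simp only: inner_diff_left inner_diff_right inner_scaleR_left inner_scaleR_right inner_commute)
       (simp add: power2_eq_square algebra_simps)
  then show "j \<nu> h x = 2 * h * (v \<nu> x \<bullet> (z \<nu> h x - x)) - (norm (z \<nu> h x - x))\<^sup>2"
    by (simp add: j_def p_def)
  have "(infdist p M)\<^sup>2 \<le> (h * norm (v \<nu> x))\<^sup>2" using N(1) px by (intro power_mono infdist_nonneg) auto
  then show "0 \<le> j \<nu> h x" by (simp add: j_def p_def power_mult_distrib)
  have "h\<^sup>2 * (norm (v \<nu> x))\<^sup>2 \<le> h\<^sup>2 * K\<^sup>2" using v_bound[OF \<nu> x] by (intro mult_left_mono power_mono) auto
  then show "j \<nu> h x \<le> h\<^sup>2 * K\<^sup>2"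
    unfolding j_def using zero_le_power2[of "infdist (x + h *\<^sub>R v \<nu> x) M"] by linarith
qed

text \<open>Expand the square of \<open>p - y\<close> twice, once through \<open>x\<close> and once
  through the projection \<open>q\<close>. In the second expansion the cross term is controlled by
  the normal inequality at \<open>p\<close>; its defect is the \<open>K * h / r\<close> on the
  left.\<close>

lemma euler_step_point:
  assumes \<nu>: "\<nu> \<in> PM M" and x: "x \<in> M" and y: "y \<in> M" and h: "small h"
  shows "(1 - K * h / r) * (norm (z \<nu> h x - y))\<^sup>2 \<le> (norm (x - y))\<^sup>2 + 2 * h * (v \<nu> x \<bullet> (x - y)) + j \<nu> h x"
proof -
  define p where "p = x + h *\<^sub>R v \<nu> x"
  define q where "q = z \<nu> h x"
  note E = euler_point[OF \<nu> x h, folded p_def q_def]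
  have q: "q = P p" by (simp add: q_def p_def z_def)
  have dd: "norm (p - q) \<le> K * h" using E by simp
  have "2 * r * ((p - q) \<bullet> (y - q)) \<le> norm (p - q) * (norm (y - q))\<^sup>2"
    using P_normal[OF E(3) y] by (simp add: q)
  also have "\<dots> \<le> (K * h) * (norm (y - q))\<^sup>2" using dd by (intro mult_right_mono) auto
  finally have n: "2 * ((p - q) \<bullet> (y - q)) \<le> K * h / r * (norm (q - y))\<^sup>2"
    using r by (simp add: field_simps norm_minus_commute)
  have "(norm (p - y))\<^sup>2 = (norm (p - q))\<^sup>2 + (norm (q - y))\<^sup>2 - 2 * ((p - q) \<bullet> (y - q))"
    unfolding power2_norm_eq_inner by (simp add: inner_diff_left inner_diff_right inner_commute algebra_simps)
  moreover have "(norm (p - y))\<^sup>2 = (norm (x - y))\<^sup>2 + 2 * h * (v \<nu> x \<bullet> (x - y)) + h\<^sup>2 * (norm (v \<nu> x))\<^sup>2"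
  proof -
    have "p - y = h *\<^sub>R v \<nu> x + (x - y)" by (simp add: p_def)
    then show ?thesis unfolding power2_norm_eq_inner
      by (simp only: inner_add_left inner_add_right inner_scaleR_left inner_scaleR_right inner_commute)
        (simp add: power2_eq_square algebra_simps)
  qed
  moreover have "j \<nu> h x = h\<^sup>2 * (norm (v \<nu> x))\<^sup>2 - (norm (p - q))\<^sup>2"
    using E(6) by (simp add: j_def p_def)
  ultimately show ?thesis using n unfolding q_def[symmetric] left_diff_distrib by linarith
qed

lemma RV_z:
  assumes \<nu>: "\<nu> \<in> PM M" and X: "RV \<Omega> X" and h: "small h"
  shows "RV \<Omega> (\<lambda>\<omega>. z \<nu> h (X \<omega>))"
  using z_measurable[OF \<nu>, of h] RV_D(2)[OF X] euler_point(4)[OF \<nu> _ h] X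
  by (auto simp: RV_def intro: measurable_compose)

lemma distr_z:
  assumes "\<nu> \<in> PM M" "RV \<Omega> X" "distr \<Omega> borel X = \<nu>"
  shows "euler \<nu> h = distr \<Omega> borel (\<lambda>\<omega>. z \<nu> h (X \<omega>))"
  unfolding euler_def assms(3)[symmetric]
  using z_measurable[OF assms(1), of h] RV_D(2)[OF assms(2)] assms(3)
  by (subst distr_distr) (auto simp: comp_def)

lemma euler_PM:
  assumes \<nu>: "\<nu> \<in> PM M" and h: "small h" shows "euler \<nu> h \<in> PM M"
proof -
  obtain \<Omega> :: "('a \<times> 'a) measure" and X Y where X: "RV \<Omega> X" "RV \<Omega> Y" "distr \<Omega> borel X = \<nu>"
    by (rule realize[OF \<nu> \<nu>, of 1]) auto
  show ?thesis unfolding distr_z[OF \<nu> X(1,3)] by (rule RV_PM[OF RV_z[OF \<nu> X(1) h]])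
qed

lemma j_measurable: "\<nu> \<in> PM M \<Longrightarrow> j \<nu> h \<in> borel_measurable borel"
proof -
  assume "\<nu> \<in> PM M"
  note [measurable] = v_measurable[OF this]
  have [measurable]: "(\<lambda>x. infdist x M) \<in> borel_measurable borel"
    by (intro borel_measurable_continuous_onI continuous_intros)
  show ?thesis unfolding j_def[abs_def] by measurable
qed

lemma J_distr:
  assumes \<nu>: "\<nu> \<in> PM M" and X: "RV \<Omega> X" and d: "distr \<Omega> borel X = \<nu>" and h: "small h"
  shows "J \<nu> h = (\<integral>\<omega>. j \<nu> h (X \<omega>) \<partial>\<Omega>)" "integrable \<Omega> (\<lambda>\<omega>. j \<nu> h (X \<omega>))"
proof -
  note [measurable] = j_measurable[OF \<nu>, of h] RV_D(2)[OF X]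
  have "J \<nu> h = (\<integral>x. j \<nu> h x \<partial>distr \<Omega> borel X)" by (simp add: J_def d)
  also have "\<dots> = (\<integral>\<omega>. j \<nu> h (X \<omega>) \<partial>\<Omega>)" by (intro integral_distr) auto
  finally show "J \<nu> h = (\<integral>\<omega>. j \<nu> h (X \<omega>) \<partial>\<Omega>)" .
  show "integrable \<Omega> (\<lambda>\<omega>. j \<nu> h (X \<omega>))"
  proof (rule integrable_bounded[OF RV_D(1)[OF X], of _ "h\<^sup>2 * K\<^sup>2"])
    show "\<forall>\<omega>. norm (j \<nu> h (X \<omega>)) \<le> h\<^sup>2 * K\<^sup>2"
      using euler_point(8,9)[OF \<nu> RV_D(3)[OF X] h] by simp
  qed measurable
qed

lemma J_bounds:
  assumes \<nu>: "\<nu> \<in> PM M" and h: "small h"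
  shows "0 \<le> J \<nu> h" "J \<nu> h \<le> h\<^sup>2 * K\<^sup>2"
proof -
  obtain \<Omega> :: "('a \<times> 'a) measure" and X Y where X: "RV \<Omega> X" "RV \<Omega> Y" and d: "distr \<Omega> borel X = \<nu>"
    by (rule realize[OF \<nu> \<nu>, of 1]) auto
  interpret prob_space \<Omega> by (rule RV_D(1)[OF X(1)])
  show "0 \<le> J \<nu> h" unfolding J_distr(1)[OF \<nu> X(1) d h]
    using euler_point(8)[OF \<nu> RV_D(3)[OF X(1)] h] by simp
  have "J \<nu> h \<le> (\<integral>\<omega>. h\<^sup>2 * K\<^sup>2 \<partial>\<Omega>)" unfolding J_distr(1)[OF \<nu> X(1) d h]
    using euler_point(9)[OF \<nu> RV_D(3)[OF X(1)] h] J_distr(2)[OF \<nu> X(1) d h] by (intro integral_mono) auto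
  then show "J \<nu> h \<le> h\<^sup>2 * K\<^sup>2" by (simp add: prob_space)
qed

lemma integrable_v_inner:
  assumes \<nu>: "\<nu> \<in> PM M" and X: "RV \<Omega> X" and Y: "RV \<Omega> Y" and Z: "RV \<Omega> Z"
  shows "integrable \<Omega> (\<lambda>\<omega>. v \<nu> (X \<omega>) \<bullet> (Y \<omega> - Z \<omega>))"
proof (rule integrable_bounded[OF RV_D(1)[OF X], of _ "K * R"])
  note [measurable] = v_measurable[OF \<nu>] RV_D(2)[OF X] RV_D(2)[OF Y] RV_D(2)[OF Z]
  show "(\<lambda>\<omega>. v \<nu> (X \<omega>) \<bullet> (Y \<omega> - Z \<omega>)) \<in> borel_measurable \<Omega>" by measurable
  show "\<forall>\<omega>. norm (v \<nu> (X \<omega>) \<bullet> (Y \<omega> - Z \<omega>)) \<le> K * R"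
  proof
    fix \<omega>
    have "norm (v \<nu> (X \<omega>) \<bullet> (Y \<omega> - Z \<omega>)) \<le> norm (v \<nu> (X \<omega>)) * norm (Y \<omega> - Z \<omega>)"
      using Cauchy_Schwarz_ineq2 by simp
    also have "\<dots> \<le> K * R"
      using v_bound[OF \<nu> RV_D(3)[OF X]] diam_M[OF RV_D(3)[OF Y] RV_D(3)[OF Z]] K(1) by (intro mult_mono) auto
    finally show "norm (v \<nu> (X \<omega>) \<bullet> (Y \<omega> - Z \<omega>)) \<le> K * R" .
  qed
qed

text \<open>The pointwise inequality integrated over a near-optimal coupling.
  \<open>en_taylor\<close> trades the velocity term for the energy difference; its error
  \<open>2 * L * Q\<close>, multiplied by \<open>2 * h\<close>, is the origin of
  \<open>4 * L * h\<close>.\<close>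

lemma euler_evi:
  assumes \<nu>: "\<nu> \<in> PM M" and \<sigma>: "\<sigma> \<in> PM M" and h: "small h"
  shows "(1 - K * h / r) * (d2 (euler \<nu> h) \<sigma>)\<^sup>2 \<le> (1 + 4 * L * h) * (d2 \<nu> \<sigma>)\<^sup>2 + 2 * h * (en \<sigma> - en \<nu>) + J \<nu> h"
proof -
  note s = smallD[OF h]
  have le: "(1 - K * h / r) * (d2 (euler \<nu> h) \<sigma>)\<^sup>2 \<le>
      ((1 + 4 * L * h) * (d2 \<nu> \<sigma>)\<^sup>2 + 2 * h * (en \<sigma> - en \<nu>) + J \<nu> h) + (1 + 4 * L * h) * e" if e: "e > 0" for e
  proof -
    obtain \<Omega> :: "('a \<times> 'a) measure" and X Y where X: "RV \<Omega> X" and Y: "RV \<Omega> Y"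
      and d: "distr \<Omega> borel X = \<nu>" "distr \<Omega> borel Y = \<sigma>"
      and c: "(\<integral>\<omega>. (norm (X \<omega> - Y \<omega>))\<^sup>2 \<partial>\<Omega>) \<le> (d2 \<nu> \<sigma>)\<^sup>2 + e"
      by (rule realize[OF \<nu> \<sigma> e])
    define Q where "Q = (\<integral>\<omega>. (norm (X \<omega> - Y \<omega>))\<^sup>2 \<partial>\<Omega>)"
    note Z = RV_z[OF \<nu> X h]
    have "(d2 (euler \<nu> h) \<sigma>)\<^sup>2 \<le> (sqrt (\<integral>\<omega>. (norm (z \<nu> h (X \<omega>) - Y \<omega>))\<^sup>2 \<partial>\<Omega>))\<^sup>2"
      using RV_diff(3)[OF Z Y] d2_nonneg by (intro power_mono) (auto simp: distr_z[OF \<nu> X d(1)] d)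
    then have "(1 - K * h / r) * (d2 (euler \<nu> h) \<sigma>)\<^sup>2 \<le> (1 - K * h / r) * (\<integral>\<omega>. (norm (z \<nu> h (X \<omega>) - Y \<omega>))\<^sup>2 \<partial>\<Omega>)"
      using s by (intro mult_left_mono) auto
    also have "\<dots> = (\<integral>\<omega>. (1 - K * h / r) * (norm (z \<nu> h (X \<omega>) - Y \<omega>))\<^sup>2 \<partial>\<Omega>)" by simp
    also have "\<dots> \<le> (\<integral>\<omega>. (norm (X \<omega> - Y \<omega>))\<^sup>2 + 2 * h * (v \<nu> (X \<omega>) \<bullet> (X \<omega> - Y \<omega>)) + j \<nu> h (X \<omega>) \<partial>\<Omega>)"
      using RV_diff(2)[OF Z Y] RV_diff(2)[OF X Y] J_distr(2)[OF \<nu> X d(1) h] integrable_v_inner[OF \<nu> X X Y]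
      by (intro integral_mono euler_step_point[OF \<nu> RV_D(3)[OF X] RV_D(3)[OF Y] h]) auto
    also have "\<dots> = Q + 2 * h * (\<integral>\<omega>. v \<nu> (X \<omega>) \<bullet> (X \<omega> - Y \<omega>) \<partial>\<Omega>) + J \<nu> h"
      using RV_diff(2)[OF X Y] J_distr[OF \<nu> X d(1) h] integrable_v_inner[OF \<nu> X X Y]
      by (simp add: Q_def)
    also have "(\<integral>\<omega>. v \<nu> (X \<omega>) \<bullet> (X \<omega> - Y \<omega>) \<partial>\<Omega>) \<le> en \<sigma> - en \<nu> + 2 * L * Q"
    proof -
      have "(\<integral>\<omega>. v \<nu> (X \<omega>) \<bullet> (Y \<omega> - X \<omega>) \<partial>\<Omega>) = (\<integral>\<omega>. - (v \<nu> (X \<omega>) \<bullet> (X \<omega> - Y \<omega>)) \<partial>\<Omega>)"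
        by (intro Bochner_Integration.integral_cong) (auto simp: inner_diff_right)
      then show ?thesis using en_taylor[OF X Y] by (simp add: d Q_def abs_le_iff)
    qed
    then have "Q + 2 * h * (\<integral>\<omega>. v \<nu> (X \<omega>) \<bullet> (X \<omega> - Y \<omega>) \<partial>\<Omega>) + J \<nu> h
        \<le> Q + 2 * h * (en \<sigma> - en \<nu> + 2 * L * Q) + J \<nu> h"
      using s(1) by (intro add_mono mult_left_mono order_refl) auto
    also have "\<dots> = (1 + 4 * L * h) * Q + 2 * h * (en \<sigma> - en \<nu>) + J \<nu> h" by (simp add: algebra_simps)
    also have "(1 + 4 * L * h) * Q \<le> (1 + 4 * L * h) * ((d2 \<nu> \<sigma>)\<^sup>2 + e)"
      using c L(1) s(1) by (intro mult_left_mono) (auto simp: Q_def)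
    finally show ?thesis by (simp add: algebra_simps)
  qed
  show ?thesis
  proof (rule field_le_epsilon)
    fix e :: real assume e: "e > 0"
    have p: "1 + 4 * L * h > 0" using L(1) s(1) by (simp add: add_pos_nonneg)
    show "(1 - K * h / r) * (d2 (euler \<nu> h) \<sigma>)\<^sup>2 \<le>
      ((1 + 4 * L * h) * (d2 \<nu> \<sigma>)\<^sup>2 + 2 * h * (en \<sigma> - en \<nu>) + J \<nu> h) + e"
      using le[of "e / (1 + 4 * L * h)"] p e by simp
  qed
qed

text \<open>Before the projection, distances grow by \<open>h * L\<close> through the point and by
  another \<open>h * L\<close> through the measure, because the mean distance is at most the
  quadratic one. The projection costs the factor of \<open>P_lipschitz\<close>. The exponential form
  is the one that multiplies over many steps.\<close>

lemma euler_stable: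
  assumes \<nu>: "\<nu> \<in> PM M" and \<sigma>: "\<sigma> \<in> PM M" and h: "small h"
  shows "d2 (euler \<nu> h) (euler \<sigma> h) \<le> exp ((2 * K / r + 2 * L) * h) * d2 \<nu> \<sigma>"
proof -
  note s = smallD[OF h]
  have "(1 - K * h / r) * d2 (euler \<nu> h) (euler \<sigma> h) \<le> (1 + 2 * L * h) * d2 \<nu> \<sigma>"
  proof (rule le_of_le_sqrt_add[OF _ d2_nonneg])
    fix e :: real assume e: "e > 0"
    obtain \<Omega> :: "('a \<times> 'a) measure" and X Y where X: "RV \<Omega> X" and Y: "RV \<Omega> Y"
      and d: "distr \<Omega> borel X = \<nu>" "distr \<Omega> borel Y = \<sigma>"
      and c: "(\<integral>\<omega>. (norm (X \<omega> - Y \<omega>))\<^sup>2 \<partial>\<Omega>) \<le> (d2 \<nu> \<sigma>)\<^sup>2 + e"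
      by (rule realize[OF \<nu> \<sigma> e])
    interpret prob_space \<Omega> by (rule RV_D(1)[OF X])
    define Q m where "Q = sqrt (\<integral>\<omega>. (norm (X \<omega> - Y \<omega>))\<^sup>2 \<partial>\<Omega>)" and "m = (\<integral>\<omega>. norm (X \<omega> - Y \<omega>) \<partial>\<Omega>)"
    have mQ: "0 \<le> m" "m \<le> Q" using RV_diff(4)[OF X Y] by (auto simp: Q_def m_def)
    note Z = RV_z[OF \<nu> X h] and Z' = RV_z[OF \<sigma> Y h]
    let ?f = "\<lambda>\<omega>. (1 + h * L) * norm (X \<omega> - Y \<omega>)"
    have i2: "integrable \<Omega> (\<lambda>\<omega>. (?f \<omega>)\<^sup>2)" using RV_diff(2)[OF X Y] by (simp add: power_mult_distrib)
    have i1: "integrable \<Omega> (\<lambda>\<omega>. ?f \<omega> * (h * L * m))" using RV_diff(1)[OF X Y] by simp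
    have pt: "(1 - K * h / r) * norm (z \<nu> h (X \<omega>) - z \<sigma> h (Y \<omega>)) \<le> ?f \<omega> + h * L * m" for \<omega>
    proof -
      have "(1 - K * h / r) * norm (z \<nu> h (X \<omega>) - z \<sigma> h (Y \<omega>))
          \<le> norm ((X \<omega> + h *\<^sub>R v \<nu> (X \<omega>)) - (Y \<omega> + h *\<^sub>R v \<sigma> (Y \<omega>)))"
        unfolding z_def using euler_point(2)[OF \<nu> RV_D(3)[OF X] h] euler_point(2)[OF \<sigma> RV_D(3)[OF Y] h] s
        by (intro P_lipschitz)
      also have "(X \<omega> + h *\<^sub>R v \<nu> (X \<omega>)) - (Y \<omega> + h *\<^sub>R v \<sigma> (Y \<omega>)) = (X \<omega> - Y \<omega>) + h *\<^sub>R (v \<nu> (X \<omega>) - v \<sigma> (Y \<omega>))"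
        by (simp add: algebra_simps)
      also have "norm \<dots> \<le> norm (X \<omega> - Y \<omega>) + h * norm (v \<nu> (X \<omega>) - v \<sigma> (Y \<omega>))"
        using norm_triangle_ineq[of "X \<omega> - Y \<omega>" "h *\<^sub>R (v \<nu> (X \<omega>) - v \<sigma> (Y \<omega>))"] s(1) by simp
      also have "\<dots> \<le> norm (X \<omega> - Y \<omega>) + h * (L * (norm (X \<omega> - Y \<omega>) + m))"
        using v_diff[OF X Y RV_D(3)[OF X] RV_D(3)[OF Y]] s(1)
        by (intro add_mono mult_left_mono order_refl) (auto simp: d m_def)
      finally show ?thesis by (simp add: algebra_simps)
    qed
    have "(1 - K * h / r) * d2 (euler \<nu> h) (euler \<sigma> h)
        \<le> (1 - K * h / r) * sqrt (\<integral>\<omega>. (norm (z \<nu> h (X \<omega>) - z \<sigma> h (Y \<omega>)))\<^sup>2 \<partial>\<Omega>)"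
      using RV_diff(3)[OF Z Z'] s by (intro mult_left_mono) (auto simp: distr_z[OF \<nu> X d(1)] distr_z[OF \<sigma> Y d(2)])
    also have "\<dots> = sqrt ((1 - K * h / r)\<^sup>2 * (\<integral>\<omega>. (norm (z \<nu> h (X \<omega>) - z \<sigma> h (Y \<omega>)))\<^sup>2 \<partial>\<Omega>))"
      using s by (simp add: real_sqrt_mult)
    also have "\<dots> = sqrt (\<integral>\<omega>. ((1 - K * h / r) * norm (z \<nu> h (X \<omega>) - z \<sigma> h (Y \<omega>)))\<^sup>2 \<partial>\<Omega>)"
      by (simp add: power_mult_distrib)
    also have "\<dots> \<le> sqrt (\<integral>\<omega>. (?f \<omega> + h * L * m)\<^sup>2 \<partial>\<Omega>)"
    proof (intro real_sqrt_le_mono integral_mono)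
      show "integrable \<Omega> (\<lambda>\<omega>. ((1 - K * h / r) * norm (z \<nu> h (X \<omega>) - z \<sigma> h (Y \<omega>)))\<^sup>2)"
        using RV_diff(2)[OF Z Z'] by (simp add: power_mult_distrib)
      show "integrable \<Omega> (\<lambda>\<omega>. (?f \<omega> + h * L * m)\<^sup>2)"
        unfolding power2_sum using i1 i2 by (simp add: mult.assoc)
      show "((1 - K * h / r) * norm (z \<nu> h (X \<omega>) - z \<sigma> h (Y \<omega>)))\<^sup>2 \<le> (?f \<omega> + h * L * m)\<^sup>2" for \<omega>
        using pt s by (intro power_mono) auto
    qed
    also have "\<dots> \<le> sqrt (\<integral>\<omega>. (?f \<omega>)\<^sup>2 \<partial>\<Omega>) + sqrt (\<integral>\<omega>. (h * L * m)\<^sup>2 \<partial>\<Omega>)"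
      using i2 i1 by (intro L2_triangle) auto
    also have "sqrt (\<integral>\<omega>. (?f \<omega>)\<^sup>2 \<partial>\<Omega>) = (1 + h * L) * Q"
      using s(1) L(1) by (simp add: power_mult_distrib real_sqrt_mult Q_def)
    also have "sqrt (\<integral>\<omega>. (h * L * m)\<^sup>2 \<partial>\<Omega>) = h * L * m"
      using s(1) L(1) mQ by (simp add: prob_space)
    also have "(1 + h * L) * Q + h * L * m \<le> (1 + h * L) * Q + h * L * Q"
      using mQ s(1) L(1) by (intro add_mono mult_left_mono order_refl) auto
    also have "\<dots> = (1 + 2 * L * h) * Q" by (simp add: algebra_simps)
    also have "\<dots> \<le> (1 + 2 * L * h) * sqrt ((d2 \<nu> \<sigma>)\<^sup>2 + e)"
      using c s(1) L(1) by (intro mult_left_mono) (auto simp: Q_def)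
    finally show "(1 - K * h / r) * d2 (euler \<nu> h) (euler \<sigma> h) \<le> (1 + 2 * L * h) * sqrt ((d2 \<nu> \<sigma>)\<^sup>2 + e)" .
  qed
  moreover have "1 \<le> (1 - K * h / r) * (1 + 2 * (K * h / r))"
  proof -
    define q where "q = K * h / r"
    have "q * q \<le> q * (1/4)" using s(3,4) unfolding q_def[symmetric] by (intro mult_left_mono)
    then show ?thesis unfolding q_def[symmetric] using s(4)[folded q_def] by (simp add: algebra_simps)
  qed
  ultimately have "d2 (euler \<nu> h) (euler \<sigma> h) \<le> (1 + 2 * (K * h / r)) * ((1 + 2 * L * h) * d2 \<nu> \<sigma>)"
  proof -
    assume a: "(1 - K * h / r) * d2 (euler \<nu> h) (euler \<sigma> h) \<le> (1 + 2 * L * h) * d2 \<nu> \<sigma>"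
      and b: "1 \<le> (1 - K * h / r) * (1 + 2 * (K * h / r))"
    have "1 * d2 (euler \<nu> h) (euler \<sigma> h) \<le> ((1 - K * h / r) * (1 + 2 * (K * h / r))) * d2 (euler \<nu> h) (euler \<sigma> h)"
      using b d2_nonneg by (rule mult_right_mono)
    also have "\<dots> = (1 + 2 * (K * h / r)) * ((1 - K * h / r) * d2 (euler \<nu> h) (euler \<sigma> h))"
      by (simp only: mult.commute mult.left_commute mult.assoc)
    also have "\<dots> \<le> (1 + 2 * (K * h / r)) * ((1 + 2 * L * h) * d2 \<nu> \<sigma>)"
      using a s by (intro mult_left_mono) auto
    finally show ?thesis by simp
  qed
  also have "\<dots> \<le> exp (2 * (K * h / r)) * (exp (2 * L * h) * d2 \<nu> \<sigma>)"
    using s L(1) d2_nonneg exp_ge_add_one_self[of "2 * (K * h / r)"] exp_ge_add_one_self[of "2 * L * h"]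
    by (intro mult_mono) auto
  also have "\<dots> = exp ((2 * K / r + 2 * L) * h) * d2 \<nu> \<sigma>"
    by (simp add: exp_add[symmetric] algebra_simps)
  finally show ?thesis .
qed

text \<open>The squared distance to M contributes the term \<open>2 * h * K\<close>, only of first
  order in \<open>h\<close>, whereas \<open>J\<close> is of second order. After division by
  \<open>h\<^sup>2\<close> there remains continuity along the curve for fixed \<open>h\<close>, but
  nothing uniform in \<open>h\<close>.\<close>

lemma J_lipschitz:
  assumes \<nu>: "\<nu> \<in> PM M" and \<sigma>: "\<sigma> \<in> PM M" and h: "small h"
  shows "\<bar>J \<nu> h - J \<sigma> h\<bar> \<le> (2 * h * K + 8 * h\<^sup>2 * K * L) * d2 \<nu> \<sigma>"
proof (rule le_of_le_sqrt_add[OF _ d2_nonneg])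
  note s = smallD[OF h]
  fix e :: real assume e: "e > 0"
  obtain \<Omega> :: "('a \<times> 'a) measure" and X Y where X: "RV \<Omega> X" and Y: "RV \<Omega> Y"
    and d: "distr \<Omega> borel X = \<nu>" "distr \<Omega> borel Y = \<sigma>"
    and c: "(\<integral>\<omega>. (norm (X \<omega> - Y \<omega>))\<^sup>2 \<partial>\<Omega>) \<le> (d2 \<nu> \<sigma>)\<^sup>2 + e"
    by (rule realize[OF \<nu> \<sigma> e])
  interpret prob_space \<Omega> by (rule RV_D(1)[OF X])
  define m where "m = (\<integral>\<omega>. norm (X \<omega> - Y \<omega>) \<partial>\<Omega>)"
  define C where "C = 4 * h\<^sup>2 * K * L"
  have C: "0 \<le> C" using L(1) K(1) by (simp add: C_def)
  have sqd: "\<bar>a\<^sup>2 - b\<^sup>2\<bar> \<le> 2 * c * t" if "0 \<le> a" "0 \<le> b" "a \<le> c" "b \<le> c" "\<bar>a - b\<bar> \<le> t" for a b c t :: real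
  proof -
    have "\<bar>a\<^sup>2 - b\<^sup>2\<bar> = (a + b) * \<bar>a - b\<bar>"
      using that by (simp add: square_diff_square_factored power2_eq_square abs_mult)
    also have "\<dots> \<le> (2 * c) * t" using that by (intro mult_mono) auto
    finally show ?thesis by simp
  qed
  have pt: "\<bar>j \<nu> h (X \<omega>) - j \<sigma> h (Y \<omega>)\<bar> \<le> (2 * h * K + C) * norm (X \<omega> - Y \<omega>) + C * m" for \<omega>
  proof -
    define t where "t = L * (norm (X \<omega> - Y \<omega>) + m)"
    have vd: "norm (v \<nu> (X \<omega>) - v \<sigma> (Y \<omega>)) \<le> t"
      using v_diff[OF X Y RV_D(3)[OF X] RV_D(3)[OF Y], of \<omega> \<omega>] by (simp add: d m_def t_def)
    have 1: "\<bar>(norm (v \<nu> (X \<omega>)))\<^sup>2 - (norm (v \<sigma> (Y \<omega>)))\<^sup>2\<bar> \<le> 2 * K * t"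
      using v_bound[OF \<nu> RV_D(3)[OF X]] v_bound[OF \<sigma> RV_D(3)[OF Y]]
        order_trans[OF norm_triangle_ineq3 vd] by (intro sqd) auto
    let ?p = "X \<omega> + h *\<^sub>R v \<nu> (X \<omega>)" and ?q = "Y \<omega> + h *\<^sub>R v \<sigma> (Y \<omega>)"
    have "dist ?p ?q \<le> norm (X \<omega> - Y \<omega>) + h * t"
    proof -
      have e: "?p - ?q = (X \<omega> - Y \<omega>) + h *\<^sub>R (v \<nu> (X \<omega>) - v \<sigma> (Y \<omega>))" by (simp add: algebra_simps)
      have "dist ?p ?q \<le> norm (X \<omega> - Y \<omega>) + h * norm (v \<nu> (X \<omega>) - v \<sigma> (Y \<omega>))"
        unfolding dist_norm e using norm_triangle_ineq[of "X \<omega> - Y \<omega>" "h *\<^sub>R (v \<nu> (X \<omega>) - v \<sigma> (Y \<omega>))"] s(1) by simp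
      also have "\<dots> \<le> norm (X \<omega> - Y \<omega>) + h * t" using vd s(1) by simp
      finally show ?thesis .
    qed
    moreover have "\<bar>infdist ?p M - infdist ?q M\<bar> \<le> dist ?p ?q"
      using infdist_triangle_abs by blast
    ultimately have 2: "\<bar>(infdist ?p M)\<^sup>2 - (infdist ?q M)\<^sup>2\<bar> \<le> 2 * (K * h) * (norm (X \<omega> - Y \<omega>) + h * t)"
      using euler_point(2)[OF \<nu> RV_D(3)[OF X] h] euler_point(2)[OF \<sigma> RV_D(3)[OF Y] h]
      by (intro sqd infdist_nonneg) auto
    have "\<bar>j \<nu> h (X \<omega>) - j \<sigma> h (Y \<omega>)\<bar> \<le> h\<^sup>2 * \<bar>(norm (v \<nu> (X \<omega>)))\<^sup>2 - (norm (v \<sigma> (Y \<omega>)))\<^sup>2\<bar> + \<bar>(infdist ?p M)\<^sup>2 - (infdist ?q M)\<^sup>2\<bar>"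
    proof -
      have "j \<nu> h (X \<omega>) - j \<sigma> h (Y \<omega>) = h\<^sup>2 * ((norm (v \<nu> (X \<omega>)))\<^sup>2 - (norm (v \<sigma> (Y \<omega>)))\<^sup>2) - ((infdist ?p M)\<^sup>2 - (infdist ?q M)\<^sup>2)"
        by (simp add: j_def algebra_simps)
      then show ?thesis using abs_triangle_ineq4 by (metis abs_mult abs_power2)
    qed
    also have "\<dots> \<le> h\<^sup>2 * (2 * K * t) + 2 * (K * h) * (norm (X \<omega> - Y \<omega>) + h * t)"
      using 1 2 by (intro add_mono mult_left_mono) auto
    also have "\<dots> = (2 * h * K + C) * norm (X \<omega> - Y \<omega>) + C * m"
      by (simp add: t_def C_def power2_eq_square algebra_simps)
    finally show ?thesis .
  qed
  have "\<bar>J \<nu> h - J \<sigma> h\<bar> = norm (\<integral>\<omega>. j \<nu> h (X \<omega>) - j \<sigma> h (Y \<omega>) \<partial>\<Omega>)"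
    using J_distr[OF \<nu> X d(1) h] J_distr[OF \<sigma> Y d(2) h] by simp
  also have "\<dots> \<le> (\<integral>\<omega>. norm (j \<nu> h (X \<omega>) - j \<sigma> h (Y \<omega>)) \<partial>\<Omega>)" by (rule integral_norm_bound)
  also have "\<dots> \<le> (\<integral>\<omega>. (2 * h * K + C) * norm (X \<omega> - Y \<omega>) + C * m \<partial>\<Omega>)"
    using pt RV_diff(1)[OF X Y] J_distr(2)[OF \<nu> X d(1) h] J_distr(2)[OF \<sigma> Y d(2) h]
    by (intro integral_mono) auto
  also have "\<dots> = (2 * h * K + C) * m + C * m"
    using RV_diff(1)[OF X Y] by (simp add: prob_space m_def)
  also have "\<dots> = (2 * h * K + 8 * h\<^sup>2 * K * L) * m" by (simp add: C_def algebra_simps)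
  also have "\<dots> \<le> (2 * h * K + 8 * h\<^sup>2 * K * L) * sqrt ((d2 \<nu> \<sigma>)\<^sup>2 + e)"
    using order_trans[OF RV_diff(4)[OF X Y] real_sqrt_le_mono[OF c]] s(1) K(1) L(1)
    by (intro mult_left_mono) (auto simp: m_def)
  finally show "\<bar>J \<nu> h - J \<sigma> h\<bar> \<le> (2 * h * K + 8 * h\<^sup>2 * K * L) * sqrt ((d2 \<nu> \<sigma>)\<^sup>2 + e)" .
qed

end

section \<open>Comparison of the flow step with the Euler step\<close>

text \<open>The complement of the support is a union of null balls, and by Lindelof countably many
  of them suffice.\<close>

lemma AE_msupp:
  fixes \<mu> :: "'a::euclidean_space measure"
  assumes [measurable_cong]: "sets \<mu> = sets borel"
  shows "AE x in \<mu>. x \<in> msupp \<mu>"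
proof -
  define F where "F = {ball x e | x e. e > 0 \<and> emeasure \<mu> (ball x e) = 0}"
  have "\<And>S. S \<in> F \<Longrightarrow> open S" by (auto simp: F_def)
  then obtain F' where F': "F' \<subseteq> F" "countable F'" "\<Union>F' = \<Union>F" by (rule Lindelof)
  have "\<Union>F' \<in> null_sets \<mu>"
    using F' by (intro null_sets_UN'[where N="\<lambda>x. x" and I=F', simplified]) (auto simp: F_def null_sets_def assms)
  moreover have "x \<in> \<Union>F'" if xn: "x \<notin> msupp \<mu>" for x
  proof -
    obtain e where "e > 0" "emeasure \<mu> (ball x e) = 0" using xn by (auto simp: msupp_def not_less)
    then have "x \<in> ball x e" "ball x e \<in> F" by (auto simp: F_def)
    then show ?thesis using F' by blast
  qed
  ultimately show ?thesis by (intro AE_I') auto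
qed

text \<open>The bound \<open>B\<close> is asked for at interior times because the exit time argument
  in \<open>Phi_near\<close> controls the velocity only before the exit.\<close>

lemma norm_diff_le_of_vector_derivative:
  fixes f :: "real \<Rightarrow> 'a::euclidean_space"
  assumes ab: "0 \<le> b" and d: "\<And>t. t \<ge> 0 \<Longrightarrow> (f has_vector_derivative f' t) (at t within {0..})"
    and B: "\<And>t. 0 < t \<Longrightarrow> t < b \<Longrightarrow> norm (f' t) \<le> B"
  shows "norm (f b - f 0) \<le> B * b"
proof (cases "b = 0")
  case False
  then have b: "0 < b" using ab by simp
  have "norm (f b - f 0) \<le> B * b - B * 0"
  proof (rule differentiable_bound_general[OF b, where f' = f' and \<phi>' = "\<lambda>_. B"])
    have "(f has_vector_derivative f' t) (at t within {0..b})" if "t \<in> {0..b}" for t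
      by (rule has_vector_derivative_within_subset[OF d]) (use that in auto)
    then show "continuous_on {0..b} f" by (rule continuous_on_vector_derivative)
    fix t assume t: "0 < t" "t < b"
    show "(f has_vector_derivative f' t) (at t)"
    proof -
      have "(f has_vector_derivative f' t) (at t within {0<..})"
        by (rule has_vector_derivative_within_subset[OF d]) (use t in auto)
      then show ?thesis using has_vector_derivative_within_open[of t "{0<..}" f "f' t"] t by auto
    qed
    show "((\<lambda>t. B * t) has_vector_derivative B) (at t)"
      by (auto intro!: derivative_eq_intros simp: has_real_derivative_iff_has_vector_derivative[symmetric])
    show "norm (f' t) \<le> B" using B t by simp
  qed (auto intro!: continuous_intros)
  then show ?thesis by simp
qed simp

locale prox_flow = prox_energy +
  fixes Phi :: "'a measure \<Rightarrow> real \<Rightarrow> 'a \<Rightarrow> 'a" and \<tau>0 :: real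
  assumes flow: "\<nu> \<in> PM M \<Longrightarrow> is_flow W \<nu> (Phi \<nu>)"
    and supp: "\<nu> \<in> PM M \<Longrightarrow> 0 \<le> t \<Longrightarrow> t \<le> \<tau>0 \<Longrightarrow> msupp (distr \<nu> borel (Phi \<nu> t)) \<subseteq> {x. infdist x M < r}"
begin

lemma Phi_meas: "\<nu> \<in> PM M \<Longrightarrow> 0 \<le> t \<Longrightarrow> Phi \<nu> t \<in> borel_measurable borel"
  using flow by (auto simp: is_flow_def)

lemma Phi_0: "\<nu> \<in> PM M \<Longrightarrow> Phi \<nu> 0 x = x"
  using flow by (auto simp: is_flow_def)

lemma Phi_AE:
  assumes \<nu>: "\<nu> \<in> PM M" and t: "0 \<le> t" "t \<le> \<tau>0"
  shows "AE y in \<nu>. infdist (Phi \<nu> t y) M < r"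
proof -
  have m: "Phi \<nu> t \<in> measurable \<nu> borel"
    using Phi_meas[OF \<nu> t(1)] PM_D(2)[OF \<nu>] by (simp cong: measurable_cong_sets)
  have "AE y in distr \<nu> borel (Phi \<nu> t). infdist y M < r"
    using AE_msupp[of "distr \<nu> borel (Phi \<nu> t)"] supp[OF \<nu> t] by (auto elim!: eventually_mono)
  then show ?thesis by (rule AE_distrD[OF m])
qed

lemma convgrad_Phi:
  assumes \<nu>: "\<nu> \<in> PM M" and t: "0 \<le> t"
  shows "convgrad W (distr \<nu> borel (Phi \<nu> t)) x = (\<integral>y. grad W (x - Phi \<nu> t y) \<partial>\<nu>)"
proof -
  have m: "Phi \<nu> t \<in> measurable \<nu> borel"
    using Phi_meas[OF \<nu> t(1)] PM_D(2)[OF \<nu>] by (simp cong: measurable_cong_sets)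
  show ?thesis unfolding convgrad_def by (rule integral_distr[OF m]) measurable
qed

lemma near_diam: "x \<in> M \<Longrightarrow> norm (p - x) \<le> 1 \<Longrightarrow> infdist y M < r \<Longrightarrow> norm (p - y) \<le> R"
  using diam[of x y] r norm_triangle_ineq[of "p - x" "x - y"] by simp

lemma velocity_bound:
  assumes \<nu>: "\<nu> \<in> PM M" and t: "0 \<le> t" "t \<le> \<tau>0" and x: "x \<in> M" and p: "norm (p - x) \<le> 1"
  shows "norm (- convgrad W (distr \<nu> borel (Phi \<nu> t)) p) \<le> K"
proof -
  interpret prob_space \<nu> using PM_D[OF \<nu>] by simp
  note [measurable_cong] = PM_D(2)[OF \<nu>]
  note [measurable] = Phi_meas[OF \<nu> t(1)]
  have "AE y in \<nu>. norm (grad W (p - Phi \<nu> t y)) \<le> K"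
    using Phi_AE[OF \<nu> t] by eventually_elim (auto intro!: K near_diam[OF x p])
  then have "norm (\<integral>y. grad W (p - Phi \<nu> t y) \<partial>\<nu>) \<le> K"
    by (intro norm_integral_le) measurable
  then show ?thesis by (simp add: convgrad_Phi[OF \<nu> t(1)])
qed

lemma Phi_deriv:
  assumes "\<nu> \<in> PM M" "t \<ge> 0"
  shows "((\<lambda>s. Phi \<nu> s x) has_vector_derivative - convgrad W (distr \<nu> borel (Phi \<nu> t)) (Phi \<nu> t x)) (at t within {0..})"
  using flow[OF assms(1)] assms(2) by (auto simp: is_flow_def)

text \<open>First exit time argument: the flow cannot leave the unit ball around x before time 1/K.\<close>
lemma Phi_near:
  assumes \<nu>: "\<nu> \<in> PM M" and x: "x \<in> M" and h: "0 \<le> h" "h \<le> \<tau>0" "K * h < 1"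
  shows "norm (Phi \<nu> h x - x) \<le> K * h"
proof -
  let ?f = "\<lambda>s. Phi \<nu> s x"
  have "(?f has_vector_derivative - convgrad W (distr \<nu> borel (Phi \<nu> t)) (Phi \<nu> t x)) (at t within {0..h})"
    if "t \<in> {0..h}" for t
    by (rule has_vector_derivative_within_subset[OF Phi_deriv[OF \<nu>]]) (use that in auto)
  then have cont: "continuous_on {0..h} ?f" by (rule continuous_on_vector_derivative)
  have bd: "norm (?f s - x) \<le> K * s" if s: "0 \<le> s" "s \<le> h" and b: "\<And>t. 0 < t \<Longrightarrow> t < s \<Longrightarrow> norm (?f t - x) \<le> 1" for s
  proof -
    have "norm (?f s - ?f 0) \<le> K * s"
    proof (rule norm_diff_le_of_vector_derivative[OF s(1) Phi_deriv[OF \<nu>]])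
      fix t assume "0 < t" "t < s"
      then show "norm (- convgrad W (distr \<nu> borel (Phi \<nu> t)) (Phi \<nu> t x)) \<le> K"
        using s h b by (intro velocity_bound[OF \<nu> _ _ x]) auto
    qed
    then show ?thesis using Phi_0[OF \<nu>] by simp
  qed
  define S where "S = {s \<in> {0..h}. 1 \<le> norm (?f s - x)}"
  have "S = {}"
  proof (rule ccontr)
    assume ne: "S \<noteq> {}"
    have "S = {0..h} \<inter> (\<lambda>s. norm (?f s - x)) -` {1..}" by (auto simp: S_def)
    moreover have "continuous_on {0..h} (\<lambda>s. norm (?f s - x))" by (intro continuous_intros cont)
    ultimately have "closed S" by (simp only: continuous_closed_preimage[OF _ closed_atLeastAtMost closed_atLeast])
    moreover have bb: "bdd_below S" by (auto simp: S_def)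
    ultimately have s: "Inf S \<in> S" using ne by (intro closed_contains_Inf)
    have "norm (?f t - x) \<le> 1" if "0 < t" "t < Inf S" for t
    proof -
      have "t \<notin> S" using that cInf_lower[OF _ bb, of t] by auto
      then show ?thesis using that s by (auto simp: S_def)
    qed
    then have "norm (?f (Inf S) - x) \<le> K * Inf S" using s by (intro bd) (auto simp: S_def)
    also have "\<dots> \<le> K * h" using s K(1) by (intro mult_left_mono) (auto simp: S_def)
    finally show False using s h by (auto simp: S_def)
  qed
  then have notS: "t \<notin> S" for t by simp
  have "norm (?f t - x) \<le> 1" if "0 < t" "t < h" for t
    using that notS[of t] by (simp add: S_def)
  then show ?thesis using h by (intro bd) auto
qed

text \<open>Subtract the motion with velocity frozen at time 0. Up to time \<open>h\<close> the
  point and every transported point of M have moved by at most \<open>K * h\<close>, so the argument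
  of \<open>grad W\<close> changes by at most \<open>2 * K * h\<close> and the velocity by
  \<open>2 * L * K * h\<close>.\<close>

lemma Phi_euler:
  assumes \<nu>: "\<nu> \<in> PM M" and x: "x \<in> M" and h: "0 \<le> h" "h \<le> \<tau>0" "K * h < 1"
  shows "norm (Phi \<nu> h x - (x + h *\<^sub>R v \<nu> x)) \<le> 2 * L * K * h\<^sup>2"
proof -
  interpret prob_space \<nu> using PM_D[OF \<nu>] by simp
  note [measurable_cong] = PM_D(2)[OF \<nu>]
  let ?g = "\<lambda>s. Phi \<nu> s x - s *\<^sub>R v \<nu> x"
  let ?g' = "\<lambda>t. - convgrad W (distr \<nu> borel (Phi \<nu> t)) (Phi \<nu> t x) - v \<nu> x"
  have "norm (?g h - ?g 0) \<le> (2 * L * K * h) * h"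
  proof (rule norm_diff_le_of_vector_derivative[OF h(1), where f' = ?g'])
    fix t :: real assume t: "0 \<le> t"
    show "(?g has_vector_derivative ?g' t) (at t within {0..})"
      using Phi_deriv[OF \<nu> t, of x] by (auto intro!: derivative_eq_intros)
  next
    fix t assume t: "0 < t" "t < h"
    then have t': "0 \<le> t" "t \<le> \<tau>0" and Kt: "K * t < 1" "K * t \<le> K * h"
      using h K(1) by (auto intro!: le_less_trans[OF _ h(3)])
    note [measurable] = Phi_meas[OF \<nu> t'(1)]
    note near = Phi_near[OF \<nu> _ t' Kt(1)]
    have AEM: "AE y in \<nu>. y \<in> M" by (rule PM_AE[OF \<nu> M_closed])
    have n1: "norm (Phi \<nu> t x - x) \<le> 1" using near[OF x] Kt by simp
    have i1: "integrable \<nu> (\<lambda>y. grad W (Phi \<nu> t x - Phi \<nu> t y))"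
    proof (rule integrable_const_bound[where B=K])
      show "AE y in \<nu>. norm (grad W (Phi \<nu> t x - Phi \<nu> t y)) \<le> K"
        using Phi_AE[OF \<nu> t'] by eventually_elim (auto intro!: K near_diam[OF x n1])
    qed measurable
    have i2: "integrable \<nu> (\<lambda>y. grad W (x - y))"
    proof (rule integrable_const_bound[where B=K])
      show "AE y in \<nu>. norm (grad W (x - y)) \<le> K"
        using AEM by eventually_elim (auto intro!: K diam_M x)
    qed measurable
    have "?g' t = - (\<integral>y. grad W (Phi \<nu> t x - Phi \<nu> t y) - grad W (x - y) \<partial>\<nu>)"
      unfolding convgrad_Phi[OF \<nu> t'(1)] v_def convgrad_def[of W \<nu>] using i1 i2 by simp
    moreover have "norm (\<integral>y. grad W (Phi \<nu> t x - Phi \<nu> t y) - grad W (x - y) \<partial>\<nu>) \<le> 2 * L * K * h"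
    proof (rule norm_integral_le)
      show "AE y in \<nu>. norm (grad W (Phi \<nu> t x - Phi \<nu> t y) - grad W (x - y)) \<le> 2 * L * K * h"
        using Phi_AE[OF \<nu> t'] AEM
      proof eventually_elim
        case (elim y)
        have "norm (grad W (Phi \<nu> t x - Phi \<nu> t y) - grad W (x - y)) \<le> L * norm ((Phi \<nu> t x - Phi \<nu> t y) - (x - y))"
          using elim by (intro L near_diam[OF x n1] diam_M x)
        also have "(Phi \<nu> t x - Phi \<nu> t y) - (x - y) = (Phi \<nu> t x - x) - (Phi \<nu> t y - y)" by simp
        also have "L * norm \<dots> \<le> L * (K * h + K * h)"
          using norm_triangle_ineq4[of "Phi \<nu> t x - x" "Phi \<nu> t y - y"] near[OF x] near[OF elim(2)] Kt L(1)
          by (intro mult_left_mono) auto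
        finally show ?case by (simp add: algebra_simps)
      qed
    qed measurable
    ultimately show "norm (?g' t) \<le> 2 * L * K * h" by simp
  qed
  then show ?thesis using Phi_0[OF \<nu>] by (simp add: power2_eq_square algebra_simps)
qed

definition step :: "'a measure \<Rightarrow> real \<Rightarrow> 'a measure" where
  "step \<nu> h = distr (distr \<nu> borel (Phi \<nu> h)) borel P"

text \<open>\<open>h \<le> \<tau>0\<close> makes the support condition available along the step, and
  \<open>K * h < 1\<close> keeps flow lines within the unit of room in \<open>diam\<close>.\<close>

definition tiny :: "real \<Rightarrow> bool" where "tiny h \<longleftrightarrow> small h \<and> h \<le> \<tau>0 \<and> K * h < 1"

lemma step_distr:
  assumes "\<nu> \<in> PM M" "RV \<Omega> X" "distr \<Omega> borel X = \<nu>" "0 \<le> h"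
  shows "step \<nu> h = distr \<Omega> borel (\<lambda>\<omega>. P (Phi \<nu> h (X \<omega>)))"
proof -
  note [measurable] = RV_D(2)[OF assms(2)] Phi_meas[OF assms(1,4)]
  have "distr \<nu> borel (Phi \<nu> h) = distr (distr \<Omega> borel X) borel (Phi \<nu> h)" by (simp add: assms(3))
  also have "\<dots> = distr \<Omega> borel (\<lambda>\<omega>. Phi \<nu> h (X \<omega>))"
    by (subst distr_distr) (auto simp: comp_def)
  finally show ?thesis unfolding step_def by (simp add: distr_distr comp_def)
qed

lemma RV_step:
  assumes \<nu>: "\<nu> \<in> PM M" and X: "RV \<Omega> X" and h: "tiny h"
  shows "RV \<Omega> (\<lambda>\<omega>. P (Phi \<nu> h (X \<omega>)))"
proof -
  have h': "0 \<le> h" "h \<le> \<tau>0" "K * h < 1" "K * h < r" using h smallD[of h] by (auto simp: tiny_def)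
  note [measurable] = RV_D(2)[OF X] Phi_meas[OF \<nu> h'(1)]
  have "P (Phi \<nu> h (X \<omega>)) \<in> M" for \<omega>
    using Phi_near[OF \<nu> RV_D(3)[OF X] h'(1-3)] h'(4) by (intro P_near(2)[OF RV_D(3)[OF X]]) (rule le_less_trans)
  then show ?thesis using RV_D(1)[OF X] by (simp add: RV_def)
qed

lemma step_PM:
  assumes \<nu>: "\<nu> \<in> PM M" and h: "tiny h" shows "step \<nu> h \<in> PM M"
proof -
  obtain \<Omega> :: "('a \<times> 'a) measure" and X Y where X: "RV \<Omega> X" "RV \<Omega> Y" "distr \<Omega> borel X = \<nu>"
    by (rule realize[OF \<nu> \<nu>, of 1]) auto
  have "0 \<le> h" using h smallD(1)[of h] by (simp add: tiny_def)
  from step_distr[OF \<nu> X(1,3) this] show ?thesis using RV_PM[OF RV_step[OF \<nu> X(1) h]] by simp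
qed

lemma d2_le_of_norm_le:
  assumes X: "RV \<Omega> X" and Y: "RV \<Omega> Y" and C: "\<And>\<omega>. norm (X \<omega> - Y \<omega>) \<le> C"
  shows "d2 (distr \<Omega> borel X) (distr \<Omega> borel Y) \<le> C"
proof -
  interpret prob_space \<Omega> by (rule RV_D(1)[OF X])
  have C0: "0 \<le> C" using order_trans[OF norm_ge_zero C] .
  have "(\<integral>\<omega>. (norm (X \<omega> - Y \<omega>))\<^sup>2 \<partial>\<Omega>) \<le> (\<integral>\<omega>. C\<^sup>2 \<partial>\<Omega>)"
    using RV_diff(2)[OF X Y] C by (intro integral_mono power_mono) auto
  then have "sqrt (\<integral>\<omega>. (norm (X \<omega> - Y \<omega>))\<^sup>2 \<partial>\<Omega>) \<le> sqrt (C\<^sup>2)"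
    by (intro real_sqrt_le_mono) (simp add: prob_space)
  then show ?thesis using RV_diff(3)[OF X Y] C0 by simp
qed

text \<open>The discrepancy is of second order, so exchanging flow steps for Euler steps costs first
  order over a bounded time. The 4 is twice the constant of \<open>Phi_euler\<close>, because the
  projection factor \<open>1 - K * h / r\<close> is at least 1/2.\<close>

lemma step_euler:
  assumes \<nu>: "\<nu> \<in> PM M" and h: "tiny h"
  shows "d2 (step \<nu> h) (euler \<nu> h) \<le> 4 * L * K * h\<^sup>2"
proof -
  have sm: "small h" and h': "0 \<le> h" "h \<le> \<tau>0" "K * h < 1" using h smallD(1)[of h] by (auto simp: tiny_def)
  note s = smallD[OF sm]
  obtain \<Omega> :: "('a \<times> 'a) measure" and X Y where X: "RV \<Omega> X" "RV \<Omega> Y" and d: "distr \<Omega> borel X = \<nu>"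
    by (rule realize[OF \<nu> \<nu>, of 1]) auto
  have "norm (P (Phi \<nu> h (X \<omega>)) - z \<nu> h (X \<omega>)) \<le> 4 * L * K * h\<^sup>2" for \<omega>
  proof -
    note x = RV_D(3)[OF X(1), of \<omega>]
    have n: "norm (Phi \<nu> h (X \<omega>) - X \<omega>) \<le> K * h" by (rule Phi_near[OF \<nu> x h'])
    then have "norm (Phi \<nu> h (X \<omega>) - X \<omega>) < r" using s by simp
    from P_near(1)[OF x this] n have i: "infdist (Phi \<nu> h (X \<omega>)) M \<le> K * h" by simp
    have "(1 - K * h / r) * norm (P (Phi \<nu> h (X \<omega>)) - z \<nu> h (X \<omega>))
        \<le> norm (Phi \<nu> h (X \<omega>) - (X \<omega> + h *\<^sub>R v \<nu> (X \<omega>)))"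
      unfolding z_def using i euler_point(2)[OF \<nu> x sm] s by (intro P_lipschitz)
    also have "\<dots> \<le> 2 * L * K * h\<^sup>2" by (rule Phi_euler[OF \<nu> x h'])
    finally have a: "(1 - K * h / r) * norm (P (Phi \<nu> h (X \<omega>)) - z \<nu> h (X \<omega>)) \<le> 2 * L * K * h\<^sup>2" .
    have "1 / 2 * norm (P (Phi \<nu> h (X \<omega>)) - z \<nu> h (X \<omega>)) \<le> (1 - K * h / r) * norm (P (Phi \<nu> h (X \<omega>)) - z \<nu> h (X \<omega>))"
    proof (rule mult_right_mono)
      show "1 / 2 \<le> 1 - K * h / r" using s(3) by linarith
    qed simp
    then show ?thesis using a by linarith
  qed
  then show ?thesis
    using d2_le_of_norm_le[OF RV_step[OF \<nu> X(1) h] RV_z[OF \<nu> X(1) sm]]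
    unfolding step_distr[OF \<nu> X(1) d h'(1)] distr_z[OF \<nu> X(1) d] by blast
qed

lemma step_near:
  assumes \<nu>: "\<nu> \<in> PM M" and h: "tiny h"
  shows "d2 (step \<nu> h) \<nu> \<le> 2 * K * h"
proof -
  have sm: "small h" and h': "0 \<le> h" "h \<le> \<tau>0" "K * h < 1" using h smallD(1)[of h] by (auto simp: tiny_def)
  note s = smallD[OF sm]
  obtain \<Omega> :: "('a \<times> 'a) measure" and X Y where X: "RV \<Omega> X" "RV \<Omega> Y" and d: "distr \<Omega> borel X = \<nu>"
    by (rule realize[OF \<nu> \<nu>, of 1]) auto
  have "norm (P (Phi \<nu> h (X \<omega>)) - X \<omega>) \<le> 2 * K * h" for \<omega>
  proof -
    note x = RV_D(3)[OF X(1), of \<omega>]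
    have n: "norm (Phi \<nu> h (X \<omega>) - X \<omega>) \<le> K * h" by (rule Phi_near[OF \<nu> x h'])
    then have lt: "norm (Phi \<nu> h (X \<omega>) - X \<omega>) < r" using s by simp
    from P_near(4)[OF x lt] n show ?thesis by simp
  qed
  then show ?thesis
    using d2_le_of_norm_le[OF RV_step[OF \<nu> X(1) h] X(1)]
    unfolding step_distr[OF \<nu> X(1) d h'(1)] d by blast
qed

end

section \<open>Local slope and energy dissipation\<close>

context prox_energy
begin

text \<open>The competitor is the projected chord \<open>Y\<close> from \<open>X\<close> towards
  \<open>Z\<close>. To first order in \<open>s\<close> its energy drop is at least
  \<open>s * (a - K * Q / r)\<close>, and its distance is at most \<open>s * c * D\<close>; hence
  \<open>a \<le> K * Q / r + S * c * D\<close> in the limit. Since \<open>J\<close> equals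
  \<open>2 * h * a - Q\<close>, Young's inequality for \<open>2 * h * (S * c * D)\<close> yields a
  \<open>Q\<close> that cancels the negative one.\<close>

lemma J_le_slope_real:
  assumes \<nu>: "\<nu> \<in> PM M" and h: "small h" and S: "0 \<le> S" and \<delta>: "0 < \<delta>"
    and slope: "\<And>\<mu>. \<mu> \<in> PM M \<Longrightarrow> 0 < d2 \<nu> \<mu> \<Longrightarrow> d2 \<nu> \<mu> < \<delta> \<Longrightarrow> en \<nu> - en \<mu> \<le> S * d2 \<nu> \<mu>"
  shows "J \<nu> h \<le> 8 * K ^ 3 * h ^ 3 / r + h\<^sup>2 * S\<^sup>2 * (1 + 2 * K * h / r)\<^sup>2"
proof -
  note sm = smallD[OF h]
  obtain \<Omega> :: "('a \<times> 'a) measure" and X Y where X: "RV \<Omega> X" and "RV \<Omega> Y" and d: "distr \<Omega> borel X = \<nu>"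
    by (rule realize[OF \<nu> \<nu>, of 1]) auto
  interpret prob_space \<Omega> by (rule RV_D(1)[OF X])
  define Z where "Z \<omega> = z \<nu> h (X \<omega>)" for \<omega>
  have Z: "RV \<Omega> Z" unfolding Z_def[abs_def] by (rule RV_z[OF \<nu> X h])
  \<comment> \<open>The projection may lengthen the chord by the factor
    \<open>1 + norm (X \<omega> - Z \<omega>) / r\<close>; here the bound \<open>2 * K * h\<close>
    for the chord is inserted.\<close>
  define c where "c = 1 + 2 * K * h / r"
  have c1: "1 \<le> c" using sm(1) K(1) r by (simp add: c_def)
  define Q where "Q = (\<integral>\<omega>. (norm (X \<omega> - Z \<omega>))\<^sup>2 \<partial>\<Omega>)"
  define D where "D = sqrt Q"
  have Q0: "0 \<le> Q" by (simp add: Q_def)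
  have D2: "D\<^sup>2 = Q" "0 \<le> D" using Q0 by (auto simp: D_def)
  define a where "a = (\<integral>\<omega>. v \<nu> (X \<omega>) \<bullet> (Z \<omega> - X \<omega>) \<partial>\<Omega>)"
  have nZ: "norm (X \<omega> - Z \<omega>) \<le> 2 * K * h" for \<omega>
    using euler_point(5)[OF \<nu> RV_D(3)[OF X] h] by (simp add: Z_def norm_minus_commute)
  have QK: "Q \<le> 4 * K\<^sup>2 * h\<^sup>2"
  proof -
    have "Q \<le> (\<integral>\<omega>. (2 * K * h)\<^sup>2 \<partial>\<Omega>)"
      unfolding Q_def using RV_diff(2)[OF X Z] nZ by (intro integral_mono power_mono) auto
    then show ?thesis by (simp add: prob_space power_mult_distrib)
  qed
  have JQ: "J \<nu> h = 2 * h * a - Q"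
  proof -
    have "J \<nu> h = (\<integral>\<omega>. 2 * h * (v \<nu> (X \<omega>) \<bullet> (Z \<omega> - X \<omega>)) - (norm (X \<omega> - Z \<omega>))\<^sup>2 \<partial>\<Omega>)"
      unfolding J_distr(1)[OF \<nu> X d h] using euler_point(7)[OF \<nu> RV_D(3)[OF X] h]
      by (intro Bochner_Integration.integral_cong) (auto simp: Z_def norm_minus_commute)
    then show ?thesis using RV_diff(2)[OF X Z] integrable_v_inner[OF \<nu> X Z X] by (simp add: a_def Q_def)
  qed
  have step: "a \<le> K * Q / r + S * c * D + 2 * L * c\<^sup>2 * Q * s" if s: "0 < s" "s \<le> 1" "s * c * D < \<delta>" for s
  proof -
    define Y where "Y \<omega> = P (X \<omega> + s *\<^sub>R (Z \<omega> - X \<omega>))" for \<omega>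
    have lt: "norm (X \<omega> - Z \<omega>) < r" for \<omega> using nZ[of \<omega>] sm(5) by simp
    note I = P_interpolate[OF RV_D(3)[OF X] RV_D(3)[OF Z] less_imp_le[OF s(1)] s(2) lt]
    note [measurable] = RV_D(2)[OF X] RV_D(2)[OF Z]
    have "Y \<in> borel_measurable \<Omega>" unfolding Y_def[abs_def] by measurable
    then have Y: "RV \<Omega> Y" using RV_D(1)[OF X] P_in[OF I(1)] by (simp add: RV_def Y_def)
    have n: "norm (X \<omega> + s *\<^sub>R (Z \<omega> - X \<omega>) - Y \<omega>) \<le> s * (norm (X \<omega> - Z \<omega>))\<^sup>2 / r" for \<omega>
      using I(2)[of \<omega>] r by (simp add: Y_def field_simps)
    have nY: "norm (X \<omega> - Y \<omega>) \<le> s * c * norm (X \<omega> - Z \<omega>)" for \<omega>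
    proof -
      have "X \<omega> - Y \<omega> = (X \<omega> + s *\<^sub>R (Z \<omega> - X \<omega>) - Y \<omega>) + s *\<^sub>R (X \<omega> - Z \<omega>)" by (simp add: algebra_simps)
      then have "norm (X \<omega> - Y \<omega>) \<le> norm (X \<omega> + s *\<^sub>R (Z \<omega> - X \<omega>) - Y \<omega>) + norm (s *\<^sub>R (X \<omega> - Z \<omega>))"
        by (metis norm_triangle_ineq)
      also have "\<dots> \<le> s * (norm (X \<omega> - Z \<omega>))\<^sup>2 / r + s * norm (X \<omega> - Z \<omega>)" using n[of \<omega>] s(1) by simp
      also have "\<dots> = s * (1 + norm (X \<omega> - Z \<omega>) / r) * norm (X \<omega> - Z \<omega>)"
        using r by (simp add: power2_eq_square field_simps)
      also have "\<dots> \<le> s * c * norm (X \<omega> - Z \<omega>)"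
        unfolding c_def using nZ[of \<omega>] s(1) r
        by (intro mult_right_mono mult_left_mono add_left_mono divide_right_mono) auto
      finally show ?thesis .
    qed
    have i: "(\<integral>\<omega>. (norm (X \<omega> - Y \<omega>))\<^sup>2 \<partial>\<Omega>) \<le> (s * c)\<^sup>2 * Q"
    proof -
      have "(\<integral>\<omega>. (norm (X \<omega> - Y \<omega>))\<^sup>2 \<partial>\<Omega>) \<le> (\<integral>\<omega>. (s * c)\<^sup>2 * (norm (X \<omega> - Z \<omega>))\<^sup>2 \<partial>\<Omega>)"
        unfolding power_mult_distrib[of "s * c", symmetric]
        using RV_diff(2)[OF X Y] RV_diff(2)[OF X Z] nY
        by (intro integral_mono power_mono) (auto simp: power_mult_distrib)
      then show ?thesis by (simp add: Q_def)
    qed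
    have dd: "d2 \<nu> (distr \<Omega> borel Y) \<le> s * c * D"
    proof -
      have "d2 \<nu> (distr \<Omega> borel Y) \<le> sqrt ((s * c)\<^sup>2 * Q)"
        using order_trans[OF RV_diff(3)[OF X Y] real_sqrt_le_mono[OF i]] by (simp add: d)
      also have "\<dots> = s * c * D" using s(1) c1 by (simp add: real_sqrt_mult D_def)
      finally show ?thesis .
    qed
    have "en \<nu> - en (distr \<Omega> borel Y) \<le> S * d2 \<nu> (distr \<Omega> borel Y)"
    proof (cases "d2 \<nu> (distr \<Omega> borel Y) = 0")
      case True
      then show ?thesis using en_lipschitz[OF \<nu> RV_PM[OF Y]] by simp
    next
      case False
      then have "0 < d2 \<nu> (distr \<Omega> borel Y)" using d2_nonneg[of \<nu> "distr \<Omega> borel Y"] by simp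
      then show ?thesis using slope[OF RV_PM[OF Y]] dd s(3) by simp
    qed
    also have "\<dots> \<le> S * (s * c * D)" using dd S by (rule mult_left_mono)
    finally have 1: "en \<nu> - en (distr \<Omega> borel Y) \<le> S * (s * c * D)" .
    have 2: "(\<integral>\<omega>. v \<nu> (X \<omega>) \<bullet> (Y \<omega> - X \<omega>) \<partial>\<Omega>) \<le> en \<nu> - en (distr \<Omega> borel Y) + 2 * L * ((s * c)\<^sup>2 * Q)"
    proof -
      have "2 * L * (\<integral>\<omega>. (norm (X \<omega> - Y \<omega>))\<^sup>2 \<partial>\<Omega>) \<le> 2 * L * ((s * c)\<^sup>2 * Q)" using i L(1) by (intro mult_left_mono) auto
      then show ?thesis using en_taylor[OF X Y] unfolding d by linarith
    qed
    have 3: "s * a - s * K * Q / r \<le> (\<integral>\<omega>. v \<nu> (X \<omega>) \<bullet> (Y \<omega> - X \<omega>) \<partial>\<Omega>)"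
    proof -
      have "s * a - s * K * Q / r = (\<integral>\<omega>. s * (v \<nu> (X \<omega>) \<bullet> (Z \<omega> - X \<omega>)) - s * K / r * (norm (X \<omega> - Z \<omega>))\<^sup>2 \<partial>\<Omega>)"
        using RV_diff(2)[OF X Z] integrable_v_inner[OF \<nu> X Z X] by (simp add: a_def Q_def)
      also have "\<dots> \<le> (\<integral>\<omega>. v \<nu> (X \<omega>) \<bullet> (Y \<omega> - X \<omega>) \<partial>\<Omega>)"
      proof (rule integral_mono)
        show "integrable \<Omega> (\<lambda>\<omega>. s * (v \<nu> (X \<omega>) \<bullet> (Z \<omega> - X \<omega>)) - s * K / r * (norm (X \<omega> - Z \<omega>))\<^sup>2)"
          using RV_diff(2)[OF X Z] integrable_v_inner[OF \<nu> X Z X] by simp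
        show "integrable \<Omega> (\<lambda>\<omega>. v \<nu> (X \<omega>) \<bullet> (Y \<omega> - X \<omega>))" by (rule integrable_v_inner[OF \<nu> X Y X])
        fix \<omega>
        define n where "n = X \<omega> + s *\<^sub>R (Z \<omega> - X \<omega>) - Y \<omega>"
        have "v \<nu> (X \<omega>) \<bullet> n \<le> norm (v \<nu> (X \<omega>)) * norm n" by (rule norm_cauchy_schwarz)
        also have "\<dots> \<le> K * (s * (norm (X \<omega> - Z \<omega>))\<^sup>2 / r)"
          using n[of \<omega>] v_bound[OF \<nu> RV_D(3)[OF X]] K(1) unfolding n_def by (intro mult_mono) auto
        finally have "v \<nu> (X \<omega>) \<bullet> n \<le> s * K / r * (norm (X \<omega> - Z \<omega>))\<^sup>2" by (simp add: mult.commute mult.left_commute)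
        moreover have "v \<nu> (X \<omega>) \<bullet> (Y \<omega> - X \<omega>) = s * (v \<nu> (X \<omega>) \<bullet> (Z \<omega> - X \<omega>)) - v \<nu> (X \<omega>) \<bullet> n"
        proof -
          have "Y \<omega> - X \<omega> = s *\<^sub>R (Z \<omega> - X \<omega>) - n" by (simp add: n_def)
          then show ?thesis by (simp only: inner_diff_right inner_scaleR_right)
        qed
        ultimately show "s * (v \<nu> (X \<omega>) \<bullet> (Z \<omega> - X \<omega>)) - s * K / r * (norm (X \<omega> - Z \<omega>))\<^sup>2
            \<le> v \<nu> (X \<omega>) \<bullet> (Y \<omega> - X \<omega>)" by linarith
      qed
      finally show ?thesis .
    qed
    have "s * a \<le> s * K * Q / r + (S * (s * c * D) + 2 * L * ((s * c)\<^sup>2 * Q))" using 1 2 3 by linarith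
    also have "\<dots> = s * (K * Q / r + S * c * D + 2 * L * c\<^sup>2 * Q * s)"
      using r by (simp add: field_simps power2_eq_square)
    finally show ?thesis using s(1) by simp
  qed
  have "a \<le> K * Q / r + S * c * D"
  proof -
    have lim: "((\<lambda>s. K * Q / r + S * c * D + 2 * L * c\<^sup>2 * Q * s) \<longlongrightarrow> K * Q / r + S * c * D + 2 * L * c\<^sup>2 * Q * 0) (at_right 0)"
      by (intro tendsto_intros)
    have "eventually (\<lambda>s::real. s \<in> {0<..<1}) (at_right 0)" by (rule eventually_at_right_real) simp
    moreover have "((\<lambda>s. s * c * D) \<longlongrightarrow> 0 * c * D) (at_right 0)" by (intro tendsto_intros)
    then have "eventually (\<lambda>s. s * c * D < \<delta>) (at_right 0)" using \<delta> by (intro order_tendstoD) auto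
    ultimately have "eventually (\<lambda>s. a \<le> K * Q / r + S * c * D + 2 * L * c\<^sup>2 * Q * s) (at_right 0)"
      by eventually_elim (rule step, auto)
    then have "a \<le> K * Q / r + S * c * D + 2 * L * c\<^sup>2 * Q * 0" by (rule tendsto_lowerbound[OF lim]) simp
    then show ?thesis by simp
  qed
  then have "2 * h * a \<le> 2 * h * (K * Q / r + S * c * D)" using sm(1) by (intro mult_left_mono) auto
  moreover have "2 * h * (S * c * D) \<le> h\<^sup>2 * S\<^sup>2 * c\<^sup>2 + Q"
    using sum_squares_bound[of "h * S * c" D] by (simp add: power_mult_distrib D2 mult.assoc)
  \<comment> \<open>The one error left by the curvature of M, of third order because
    \<open>Q\<close> is of second order.\<close>
  moreover have "2 * h * (K * Q / r) \<le> 8 * K ^ 3 * h ^ 3 / r"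
  proof -
    have "2 * h * (K * Q / r) = 2 * h * K / r * Q" by simp
    also have "\<dots> \<le> 2 * h * K / r * (4 * K\<^sup>2 * h\<^sup>2)" using QK sm(1) K(1) r by (intro mult_left_mono) auto
    also have "\<dots> = 8 * K ^ 3 * h ^ 3 / r" by (simp add: power2_eq_square power3_eq_cube)
    finally show ?thesis .
  qed
  ultimately have "2 * h * a - Q \<le> 8 * K ^ 3 * h ^ 3 / r + h\<^sup>2 * S\<^sup>2 * c\<^sup>2"
    unfolding distrib_left by linarith
  then show ?thesis unfolding JQ c_def .
qed

definition F :: "real \<Rightarrow> 'a measure \<Rightarrow> real" where "F h \<nu> = J \<nu> h / h\<^sup>2"

text \<open>13 is 8 + 5: with \<open>q = K * h / r\<close>, the 8 comes from
  \<open>J_le_slope_real\<close> and the 5 from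
  \<open>(1 + 2 * q)\<^sup>2 \<le> 1 + 5 * q\<close>.\<close>

definition slope_const :: real where "slope_const = 13 * K ^ 3 / r"

lemma F_bounds: "\<nu> \<in> PM M \<Longrightarrow> small h \<Longrightarrow> 0 \<le> F h \<nu>" "\<nu> \<in> PM M \<Longrightarrow> small h \<Longrightarrow> F h \<nu> \<le> K\<^sup>2"
  using J_bounds[of \<nu> h] smallD(1)[of h] by (auto simp: F_def field_simps)

text \<open>The factor \<open>(1 + 2 * q)\<^sup>2\<close> multiplies \<open>S\<^sup>2\<close>, for
  which no upper bound is at hand. It is moved to the side of \<open>F\<close>, which is at most
  \<open>K\<^sup>2\<close>, and there it becomes an additive error.\<close>

lemma F_le_slope_real:
  assumes \<nu>: "\<nu> \<in> PM M" and h: "small h" and S: "0 \<le> S" and \<delta>: "0 < \<delta>"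
    and slope: "\<And>\<mu>. \<mu> \<in> PM M \<Longrightarrow> 0 < d2 \<nu> \<mu> \<Longrightarrow> d2 \<nu> \<mu> < \<delta> \<Longrightarrow> en \<nu> - en \<mu> \<le> S * d2 \<nu> \<mu>"
  shows "F h \<nu> - slope_const * h \<le> S\<^sup>2"
proof -
  note sm = smallD[OF h]
  define q where "q = K * h / r"
  have q: "0 \<le> q" "q \<le> 1/4" using sm by (auto simp: q_def)
  define B where "B = F h \<nu> - 8 * K\<^sup>2 * q"
  have KK: "8 * K ^ 3 * h ^ 3 / r = h\<^sup>2 * (8 * K\<^sup>2 * q)" by (simp add: q_def power2_eq_square power3_eq_cube)
  have "h\<^sup>2 * F h \<nu> \<le> h\<^sup>2 * (8 * K\<^sup>2 * q) + h\<^sup>2 * (S\<^sup>2 * (1 + 2 * q)\<^sup>2)"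
    using J_le_slope_real[OF \<nu> h S \<delta> slope] sm(1) unfolding KK F_def q_def by (simp add: mult.assoc)
  then have "h\<^sup>2 * F h \<nu> \<le> h\<^sup>2 * (8 * K\<^sup>2 * q + S\<^sup>2 * (1 + 2 * q)\<^sup>2)" by (simp only: distrib_left)
  then have "F h \<nu> \<le> 8 * K\<^sup>2 * q + S\<^sup>2 * (1 + 2 * q)\<^sup>2" using sm(1) by simp
  then have B: "B \<le> S\<^sup>2 * (1 + 2 * q)\<^sup>2" by (simp add: B_def)
  have BK: "B \<le> K\<^sup>2" using F_bounds(2)[OF \<nu> h] q by (simp add: B_def add_increasing2 diff_le_eq)
  have slope_const_h: "slope_const * h = 13 * K\<^sup>2 * q" by (simp add: slope_const_def q_def power2_eq_square power3_eq_cube)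
  have "B - 5 * K\<^sup>2 * q \<le> S\<^sup>2"
  proof (cases "B \<le> 0")
    case True
    have "0 \<le> 5 * K\<^sup>2 * q" using q by simp
    then show ?thesis using True zero_le_power2[of S] by linarith
  next
    case False
    have qq: "(1 + 2 * q)\<^sup>2 \<le> 1 + 5 * q"
    proof -
      have "q * q \<le> q * (1/4)" using q by (intro mult_left_mono) auto
      then show ?thesis by (simp add: power2_eq_square algebra_simps)
    qed
    have "B \<le> S\<^sup>2 * (1 + 5 * q)" using order_trans[OF B mult_left_mono[OF qq zero_le_power2]] .
    then have SB: "B * (1 - 5 * q) \<le> S\<^sup>2 * (1 + 5 * q) * (1 - 5 * q)" if "1 - 5 * q \<ge> 0"
      using that by (rule mult_right_mono)
    have "B * (1 - 5 * q) \<le> S\<^sup>2"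
    proof (cases "1 - 5 * q \<ge> 0")
      case True
      have "S\<^sup>2 * (1 + 5 * q) * (1 - 5 * q) = S\<^sup>2 * (1 - 25 * (q * q))" by (simp add: algebra_simps)
      also have "\<dots> \<le> S\<^sup>2 * 1" by (intro mult_left_mono) auto
      finally show ?thesis using SB[OF True] by simp
    next
      case False': False
      then have "B * (1 - 5 * q) \<le> 0" using False by (intro mult_nonneg_nonpos) auto
      then show ?thesis using zero_le_power2[of S] by linarith
    qed
    moreover have "B * q \<le> K\<^sup>2 * q" using BK q by (intro mult_right_mono) auto
    ultimately show ?thesis by (simp add: algebra_simps)
  qed
  then show ?thesis unfolding slope_const_h B_def by linarith
qed

text \<open>A slope below \<open>S0 + e\<close> provides one radius \<open>\<delta>\<close> at which
  all difference quotients are at most \<open>S0 + e\<close>; then \<open>e\<close> tends to 0.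
  Where the left side is negative, \<open>ennreal\<close> makes it 0.\<close>

lemma F_le_slope:
  assumes \<nu>: "\<nu> \<in> PM M" and h: "small h"
  shows "ennreal (F h \<nu> - slope_const * h) \<le> (e2ennreal (slope M W \<nu>))\<^sup>2"
proof -
  define G where "G \<delta> = max 0 (SUP \<mu>\<in>{\<mu> \<in> PM M. 0 < d2 \<nu> \<mu> \<and> d2 \<nu> \<mu> < \<delta>}.
          (energy M W \<nu> - energy M W \<mu>) / ereal (d2 \<nu> \<mu>))" for \<delta> :: real
  have sl: "slope M W \<nu> = (INF \<delta>\<in>{0<..}. G \<delta>)" using \<nu> by (simp add: slope_def G_def)
  have "0 \<le> slope M W \<nu>" unfolding sl by (intro INF_greatest) (simp add: G_def)
  then consider "slope M W \<nu> = \<infinity>" | S0 where "slope M W \<nu> = ereal S0" "0 \<le> S0"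
    by (cases "slope M W \<nu>") auto
  then show ?thesis
  proof cases
    case 1
    then show ?thesis by (simp add: power2_eq_square ennreal_top_mult)
  next
    case 2
    have le: "F h \<nu> - slope_const * h \<le> (S0 + e)\<^sup>2" if e: "e > 0" for e
    proof -
      have "(INF \<delta>\<in>{0<..}. G \<delta>) < ereal (S0 + e)" using 2 e unfolding sl by simp
      then obtain \<delta> where \<delta>: "0 < \<delta>" "G \<delta> < ereal (S0 + e)" unfolding INF_less_iff by auto
      show ?thesis
      proof (rule F_le_slope_real[OF \<nu> h _ \<delta>(1)])
        show "0 \<le> S0 + e" using 2 e by simp
        fix \<mu> assume \<mu>: "\<mu> \<in> PM M" "0 < d2 \<nu> \<mu>" "d2 \<nu> \<mu> < \<delta>"
        have "(energy M W \<nu> - energy M W \<mu>) / ereal (d2 \<nu> \<mu>) \<le> G \<delta>"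
          unfolding G_def using \<mu> by (intro max.coboundedI2 SUP_upper) auto
        also have "\<dots> \<le> ereal (S0 + e)" using \<delta> by simp
        finally have "(en \<nu> - en \<mu>) / d2 \<nu> \<mu> \<le> S0 + e" using \<mu> by (simp add: energy_eq[OF \<nu>] energy_eq[OF \<mu>(1)])
        then show "en \<nu> - en \<mu> \<le> (S0 + e) * d2 \<nu> \<mu>" using \<mu> by (simp add: field_simps)
      qed
    qed
    have "((\<lambda>e. (S0 + e)\<^sup>2) \<longlongrightarrow> (S0 + 0)\<^sup>2) (at_right 0)" by (intro tendsto_intros)
    then have "F h \<nu> - slope_const * h \<le> (S0 + 0)\<^sup>2"
      by (rule tendsto_lowerbound) (use le in \<open>auto simp: eventually_at_filter\<close>)
    then show ?thesis using 2 by (simp add: e2ennreal_ereal ennreal_power ennreal_leI)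
  qed
qed

end

section \<open>Lower bounds for nonnegative integrals over an interval\<close>

lemma nn_set_integral_eq_set_integral:
  fixes f :: "'a \<Rightarrow> real"
  assumes f: "set_integrable M A f" and nn: "\<And>x. 0 \<le> f x"
  shows "(\<integral>\<^sup>+ x\<in>A. ennreal (f x) \<partial>M) = ennreal (LINT x:A|M. f x)"
proof -
  have "(\<integral>\<^sup>+ x\<in>A. ennreal (f x) \<partial>M) = (\<integral>\<^sup>+ x. ennreal (indicator A x *\<^sub>R f x) \<partial>M)"
    by (intro nn_integral_cong) (auto simp: indicator_def)
  also have "\<dots> = ennreal (LINT x:A|M. f x)"
    unfolding set_lebesgue_integral_def
    using f nn by (intro nn_integral_eq_integral) (auto simp: set_integrable_def)
  finally show ?thesis .
qed

text \<open>The inequality 2 a q <= q^2 + a^2 with a = d / (t - s) replaces the Cauchy-Schwarz inequality.\<close>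
lemma nn_integral_square_ge:
  fixes q :: "real \<Rightarrow> real"
  assumes q: "integrable lborel q" "\<And>u. 0 \<le> q u" and st: "s < t" and d: "0 \<le> d" "d \<le> (LINT u:{s..t}|lborel. q u)"
  shows "ennreal (d\<^sup>2 / (t - s)) \<le> (\<integral>\<^sup>+ u\<in>{s..t}. ennreal ((q u)\<^sup>2) \<partial>lborel)"
proof -
  define a where "a = d / (t - s)"
  have a0: "0 \<le> a" using d st by (simp add: a_def)
  have [measurable]: "q \<in> borel_measurable borel" using borel_measurable_integrable[OF q(1)] by simp
  have qi: "set_integrable lborel {s..t} q" using q(1) by (intro integrable_imp_set_integrable) auto
  have "ennreal (2 * a * d) \<le> ennreal (2 * a * (LINT u:{s..t}|lborel. q u))"
    using d a0 by (intro ennreal_leI mult_left_mono) auto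
  also have "\<dots> = ennreal (LINT u:{s..t}|lborel. 2 * a * q u)" by simp
  also have "\<dots> = (\<integral>\<^sup>+ u\<in>{s..t}. ennreal (2 * a * q u) \<partial>lborel)"
    using qi q(2) a0 by (intro nn_set_integral_eq_set_integral[symmetric] set_integrable_mult_right) auto
  also have "\<dots> \<le> (\<integral>\<^sup>+ u. ennreal ((q u)\<^sup>2) * indicator {s..t} u + ennreal (a\<^sup>2) * indicator {s..t} u \<partial>lborel)"
  proof (rule nn_integral_mono)
    fix u
    have "2 * a * q u \<le> (q u)\<^sup>2 + a\<^sup>2" using sum_squares_bound[of a "q u"] by simp
    then have "ennreal (2 * a * q u) \<le> ennreal ((q u)\<^sup>2) + ennreal (a\<^sup>2)"
      by (simp add: ennreal_plus[symmetric] ennreal_leI del: ennreal_plus)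
    then show "ennreal (2 * a * q u) * indicator {s..t} u
      \<le> ennreal ((q u)\<^sup>2) * indicator {s..t} u + ennreal (a\<^sup>2) * indicator {s..t} u"
      by (auto simp: indicator_def)
  qed
  also have "\<dots> = (\<integral>\<^sup>+ u\<in>{s..t}. ennreal ((q u)\<^sup>2) \<partial>lborel) + ennreal (a\<^sup>2 * (t - s))"
    using st by (subst nn_integral_add) (auto simp: nn_integral_cmult_indicator ennreal_mult)
  finally have "ennreal (2 * a * d) \<le> (\<integral>\<^sup>+ u\<in>{s..t}. ennreal ((q u)\<^sup>2) \<partial>lborel) + ennreal (a\<^sup>2 * (t - s))" .
  then have "ennreal (2 * a * d) - ennreal (a\<^sup>2 * (t - s)) \<le> (\<integral>\<^sup>+ u\<in>{s..t}. ennreal ((q u)\<^sup>2) \<partial>lborel)"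
    by (simp add: ennreal_minus_le_iff add.commute)
  moreover have "ennreal (2 * a * d) - ennreal (a\<^sup>2 * (t - s)) = ennreal (2 * a * d - a\<^sup>2 * (t - s))"
    using st by (intro ennreal_minus) auto
  moreover have "2 * a * d - a\<^sup>2 * (t - s) = d\<^sup>2 / (t - s)"
  proof -
    have aw: "a * (t - s) = d" using st by (simp add: a_def)
    have "a\<^sup>2 * (t - s) = a * (a * (t - s))" by (simp add: power2_eq_square)
    then have "2 * a * d - a\<^sup>2 * (t - s) = a * d" by (simp add: aw)
    then show ?thesis by (simp add: a_def power2_eq_square)
  qed
  ultimately show ?thesis by simp
qed

text \<open>Since \<open>ennreal\<close> truncates negative values to 0, the right side can only be
  larger. The application has \<open>F h\<close> minus a multiple of \<open>h\<close> for
  \<open>f\<close>, which may be negative.\<close>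

lemma nn_integral_ge_integral:
  fixes f :: "real \<Rightarrow> real"
  assumes f: "continuous_on {s..t} f"
  shows "ennreal (integral {s..t} f) \<le> (\<integral>\<^sup>+ u\<in>{s..t}. ennreal (f u) \<partial>lborel)"
proof -
  have c: "continuous_on {s..t} (\<lambda>u. max 0 (f u))" using f by (intro continuous_intros)
  have i: "set_integrable lborel {s..t} (\<lambda>u. max 0 (f u))"
    using c borel_integrable_compact[of "{s..t}" "\<lambda>u. max 0 (f u)"] by (simp add: set_integrable_def)
  have "integral {s..t} f \<le> integral {s..t} (\<lambda>u. max 0 (f u))"
    using f c by (intro integral_le integrable_continuous_real) auto
  also have "\<dots> = (LINT u:{s..t}|lborel. max 0 (f u))"
    by (rule set_borel_integral_eq_integral(2)[OF i, symmetric])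
  finally have "ennreal (integral {s..t} f) \<le> ennreal (LINT u:{s..t}|lborel. max 0 (f u))" by (rule ennreal_leI)
  also have "\<dots> = (\<integral>\<^sup>+ u\<in>{s..t}. ennreal (max 0 (f u)) \<partial>lborel)"
    using i by (intro nn_set_integral_eq_set_integral[symmetric]) auto
  also have "\<dots> = (\<integral>\<^sup>+ u\<in>{s..t}. ennreal (f u) \<partial>lborel)" 
    by (intro nn_integral_cong) (auto simp: max_def ennreal_neg)
  finally show ?thesis .
qed

section \<open>Error of the scheme\<close>

lemma exists_offset_Riemann_sum_le:
  fixes g :: "real \<Rightarrow> real"
  assumes g: "continuous_on {0..} g" and h: "0 < h"
  obtains s where "0 \<le> s" "s \<le> h" "(\<Sum>k<N. h * g (real k * h + s)) \<le> integral {0..real N * h} g"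
proof -
  define q where "q s = (\<Sum>k<N. g (real k * h + s))" for s
  have gk: "continuous_on {0..h} (\<lambda>s. g (real k * h + s))" for k
    by (rule continuous_on_compose2[OF g]) (use h in \<open>auto intro!: continuous_intros\<close>)
  have cq: "continuous_on {0..h} q" unfolding q_def by (intro continuous_intros gk)
  \<comment> \<open>The minimum of \<open>q\<close> over one step is at most its mean.\<close>
  obtain s where s: "s \<in> {0..h}" "\<And>u. u \<in> {0..h} \<Longrightarrow> q s \<le> q u"
    using continuous_attains_inf[OF compact_Icc _ cq] h by auto
  have "h * q s = integral {0..h} (\<lambda>_. q s)" using h by simp
  also have "\<dots> \<le> integral {0..h} q"
    using s cq by (intro integral_le integrable_continuous_real) auto
  also have "\<dots> = (\<Sum>k<N. integral {0..h} (\<lambda>s. g (real k * h + s)))"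
    unfolding q_def by (intro integral_sum integrable_continuous_real gk) auto
  also have "\<dots> = integral {0..real N * h} g"
  proof (induction N)
    case (Suc N)
    have sub: "continuous_on {a..b} g" if "0 \<le> a" for a b
      using g by (rule continuous_on_subset) (use that in auto)
    have "integral {0..h} (\<lambda>s. g (real N * h + s)) = integral {0..h} (g \<circ> (\<lambda>s. s + real N * h))"
      by (simp add: comp_def add.commute)
    also have "\<dots> = integral {0 + real N * h..h + real N * h} g"
      using h by (intro integral_shift sub) auto
    also have "\<dots> = integral {real N * h..real (Suc N) * h} g" by (simp add: algebra_simps)
    finally have "(\<Sum>k<Suc N. integral {0..h} (\<lambda>s. g (real k * h + s)))
        = integral {0..real N * h} g + integral {real N * h..real (Suc N) * h} g"
      using Suc by simp
    also have "\<dots> = integral {0..real (Suc N) * h} g"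
      using h by (intro Henstock_Kurzweil_Integration.integral_combine integrable_continuous_real sub)
        (auto simp: algebra_simps)
    finally show ?case .
  qed simp
  finally have "h * q s \<le> integral {0..real N * h} g" .
  then show thesis using s by (intro that[of s]) (auto simp: q_def sum_distrib_left)
qed

lemma discrete_gronwall:
  fixes b c :: "nat \<Rightarrow> real"
  assumes step: "\<And>k. k < n \<Longrightarrow> b (Suc k) \<le> E * b k + c k" and E: "1 \<le> E"
    and c: "\<And>k. 0 \<le> c k"
  shows "b n \<le> E ^ n * (b 0 + (\<Sum>k<n. c k))"
  using step
proof (induction n)
  case (Suc n)
  have IH: "b n \<le> E ^ n * (b 0 + (\<Sum>k<n. c k))" using Suc by simp
  have "b (Suc n) \<le> E * b n + c n" using Suc by simp
  also have "\<dots> \<le> E * (E ^ n * (b 0 + (\<Sum>k<n. c k))) + E ^ Suc n * c n"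
    using IH E c one_le_power[OF E, of "Suc n"] mult_right_mono[of 1 "E ^ Suc n" "c n"]
    by (intro add_mono mult_left_mono) auto
  also have "\<dots> = E ^ Suc n * (b 0 + (\<Sum>k<Suc n. c k))" by (simp add: algebra_simps)
  finally show ?case .
qed simp

locale prox_gradient_flow = prox_flow +
  fixes \<rho> :: "real \<Rightarrow> 'a measure"
  assumes \<rho>: "t \<ge> 0 \<Longrightarrow> \<rho> t \<in> PM M" and gf: "grad_flow M W \<rho>"
begin

lemma d2_commute:
  assumes "\<mu> \<in> PM M" "\<nu> \<in> PM M" shows "d2 \<mu> \<nu> = d2 \<nu> \<mu>"
proof -
  obtain m0 where m0: "m0 \<in> M" using M_ne by auto
  show ?thesis
    by (rule antisym[OF d2_le_commute[OF M_compact assms(2,1) m0] d2_le_commute[OF M_compact assms m0]])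
qed

text \<open>The value of a \<open>Lim\<close> is informative only where the limit exists;
  \<open>metric_derivative\<close> provides this almost everywhere, together with the integral
  bound. The modulus in \<open>AC2\<close> is merely square integrable on the half-line, so it is
  cut off at \<open>T\<close> to become integrable.\<close>

lemma mderiv_density:
  assumes T: "0 < T"
  obtains q where "integrable lborel q" "\<And>u. 0 \<le> q u" "AE t in lborel. t \<in> {0<..<T} \<longrightarrow> mderiv \<rho> t = q t"
    "\<And>s t. 0 \<le> s \<Longrightarrow> s \<le> t \<Longrightarrow> t \<le> T \<Longrightarrow> d2 (\<rho> s) (\<rho> t) \<le> (LINT u:{s..t}|lborel. q u)"
proof -
  obtain m :: "real \<Rightarrow> real" where m[measurable]: "m \<in> borel_measurable lborel" and m0: "\<forall>t. 0 \<le> m t"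
    and m2: "(\<integral>\<^sup>+ t\<in>{0..}. ennreal ((m t)\<^sup>2) \<partial>lborel) < \<infinity>"
    and md: "\<forall>s t. 0 \<le> s \<and> s \<le> t \<longrightarrow> ennreal (d2 (\<rho> s) (\<rho> t)) \<le> (\<integral>\<^sup>+ u\<in>{s..t}. ennreal (m u) \<partial>lborel)"
  proof -
    have "AC2 \<rho>" using gf unfolding grad_flow_def by (rule conjunct1)
    then show ?thesis using that unfolding AC2_def by blast
  qed
  define w where "w u = indicator {0..T} u * m u" for u
  have w0: "0 \<le> w u" for u using m0 by (simp add: w_def)
  have wi: "integrable lborel w"
  proof (rule integrableI_nonneg)
    show "w \<in> borel_measurable lborel" unfolding w_def[abs_def] by measurable
    have "(\<integral>\<^sup>+ u. ennreal (w u) \<partial>lborel) \<le> (\<integral>\<^sup>+ u. indicator {0..T} u + ennreal ((m u)\<^sup>2) * indicator {0..} u \<partial>lborel)"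
    proof (rule nn_integral_mono)
      fix u
      have "m u \<le> 1 + (m u)\<^sup>2" using sum_squares_bound[of 1 "m u"] m0[rule_format, of u] zero_le_power2[of "m u"] by simp
      then have "ennreal (m u) \<le> ennreal (1 + (m u)\<^sup>2)" by (rule ennreal_leI)
      then have "ennreal (m u) \<le> 1 + ennreal ((m u)\<^sup>2)" by simp
      then show "ennreal (w u) \<le> indicator {0..T} u + ennreal ((m u)\<^sup>2) * indicator {0..} u"
        by (auto simp: w_def indicator_def)
    qed
    also have "\<dots> = ennreal T + (\<integral>\<^sup>+ t\<in>{0..}. ennreal ((m t)\<^sup>2) \<partial>lborel)"
      using T by (subst nn_integral_add) auto
    also have "\<dots> < \<infinity>" using m2 by simp
    finally show "(\<integral>\<^sup>+ u. ennreal (w u) \<partial>lborel) < \<infinity>" .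
  qed (use w0 in auto)
  have dw: "d2 (\<rho> s) (\<rho> t) \<le> (LINT u:{s..t}|lborel. w u)" if st: "0 \<le> s" "s \<le> t" "t \<le> T" for s t
  proof -
    have "ennreal (d2 (\<rho> s) (\<rho> t)) \<le> (\<integral>\<^sup>+ u\<in>{s..t}. ennreal (m u) \<partial>lborel)" using md st by blast
    also have "\<dots> = (\<integral>\<^sup>+ u\<in>{s..t}. ennreal (w u) \<partial>lborel)"
      using st by (intro nn_integral_cong) (auto simp: w_def indicator_def)
    also have "\<dots> = ennreal (LINT u:{s..t}|lborel. w u)"
      using wi w0 by (intro nn_set_integral_eq_set_integral integrable_imp_set_integrable) auto
    finally show ?thesis
      using w0 by (subst (asm) ennreal_le_iff) (auto simp: set_lebesgue_integral_def)
  qed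
  show thesis
  proof (rule metric_derivative[of w T "\<lambda>s t. d2 (\<rho> s) (\<rho> t)"])
    fix q :: "real \<Rightarrow> real"
    assume q: "\<And>t. 0 \<le> q t" "integrable lborel q"
      and AEq: "AE t in lborel. t \<in> {0<..<T} \<longrightarrow> ((\<lambda>h. d2 (\<rho> t) (\<rho> (t + h)) / \<bar>h\<bar>) \<longlongrightarrow> q t) (at 0)"
      and dq: "\<And>s t. 0 \<le> s \<Longrightarrow> s \<le> t \<Longrightarrow> t \<le> T \<Longrightarrow> d2 (\<rho> s) (\<rho> t) \<le> (LINT u:{s..t}|lborel. q u)"
    have "AE t in lborel. t \<in> {0<..<T} \<longrightarrow> mderiv \<rho> t = q t"
      using AEq
    proof eventually_elim
      case (elim t)
      then show ?case unfolding mderiv_def by (auto intro!: tendsto_Lim)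
    qed
    then show thesis using q dq by (intro that[of q]) auto
  next
    show "d2 (\<rho> s) (\<rho> s) = 0" if "s \<in> {0..T}" for s using that by (intro d2_refl[of _ M] \<rho>) auto
    show "d2 (\<rho> s) (\<rho> t) = d2 (\<rho> t) (\<rho> s)" if "s \<in> {0..T}" "t \<in> {0..T}" for s t
      using that by (intro d2_commute \<rho>) auto
    show "d2 (\<rho> s) (\<rho> u) \<le> d2 (\<rho> s) (\<rho> t) + d2 (\<rho> t) (\<rho> u)"
      if "s \<in> {0..T}" "t \<in> {0..T}" "u \<in> {0..T}" for s t u
      using that by (intro d2_triangle[OF M_compact] \<rho>) auto
  qed (use wi w0 dw T in auto)
qed

text \<open>Turns the dissipation inequality into one about distances: the metric derivative is
  replaced by squared distance over elapsed time, by \<open>nn_integral_square_ge\<close>, and the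
  squared slope by a continuous minorant \<open>f\<close>.\<close>

lemma dissipation:
  assumes s: "0 \<le> s" and t: "s < t" and f: "continuous_on {s..t} f"
    and fs: "\<And>u. u \<in> {s..t} \<Longrightarrow> ennreal (f u) \<le> (e2ennreal (slope M W (\<rho> u)))\<^sup>2"
  shows "(d2 (\<rho> s) (\<rho> t))\<^sup>2 / (t - s) + integral {s..t} f \<le> 2 * (en (\<rho> s) - en (\<rho> t))"
proof -
  obtain q where q: "integrable lborel q" "\<And>u. 0 \<le> q u"
    and mq: "AE u in lborel. u \<in> {0<..<t} \<longrightarrow> mderiv \<rho> u = q u"
    and dq: "\<And>s' t'. 0 \<le> s' \<Longrightarrow> s' \<le> t' \<Longrightarrow> t' \<le> t \<Longrightarrow> d2 (\<rho> s') (\<rho> t') \<le> (LINT u:{s'..t'}|lborel. q u)"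
    by (rule mderiv_density[of t]) (use s t in auto)
  have [measurable]: "q \<in> borel_measurable borel" using borel_measurable_integrable[OF q(1)] by simp
  define I where "I = (\<integral>\<^sup>+ u\<in>{s..t}. (e2ennreal (slope M W (\<rho> u)))\<^sup>2 + ennreal ((mderiv \<rho> u)\<^sup>2) \<partial>lborel)"
  have EI: "ereal (en (\<rho> t)) + ereal (1/2) * enn2ereal I \<le> ereal (en (\<rho> s))"
  proof -
    have "\<forall>s t. 0 \<le> s \<and> s \<le> t \<longrightarrow> energy M W (\<rho> t) + ereal (1/2) * enn2ereal (\<integral>\<^sup>+ u\<in>{s..t}.
           (e2ennreal (slope M W (\<rho> u)))\<^sup>2 + ennreal ((mderiv \<rho> u)\<^sup>2) \<partial>lborel) \<le> energy M W (\<rho> s)"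
      using gf unfolding grad_flow_def by blast
    from this[rule_format, of s t]
    have "energy M W (\<rho> t) + ereal (1/2) * enn2ereal I \<le> energy M W (\<rho> s)"
      using s t unfolding I_def by simp
    moreover have "energy M W (\<rho> s) = ereal (en (\<rho> s))" "energy M W (\<rho> t) = ereal (en (\<rho> t))"
      using s t by (auto intro!: energy_eq \<rho>)
    ultimately show ?thesis by (simp only:)
  qed
  define A B where "A = integral {s..t} f" and "B = (d2 (\<rho> s) (\<rho> t))\<^sup>2 / (t - s)"
  have m1: "(\<lambda>u. ennreal (f u) * indicator {s..t} u) \<in> borel_measurable lborel"
  proof -
    have "(\<lambda>u. ennreal (indicator {s..t} u *\<^sub>R f u)) \<in> borel_measurable lborel"
      using borel_measurable_continuous_on_indicator[OF _ f] by measurable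
    moreover have "(\<lambda>u. ennreal (f u) * indicator {s..t} u) = (\<lambda>u. ennreal (indicator {s..t} u *\<^sub>R f u))"
      by (auto simp: indicator_def)
    ultimately show ?thesis by simp
  qed
  \<comment> \<open>\<open>A\<close> may be negative, in which case \<open>ennreal A\<close> is 0;
    the inequality survives the truncation.\<close>
  have "ennreal (A + B) \<le> ennreal A + ennreal B"
    by (cases "0 \<le> A"; cases "0 \<le> B") (auto simp: ennreal_plus[symmetric] ennreal_neg intro!: ennreal_leI simp del: ennreal_plus)
  also have "\<dots> \<le> (\<integral>\<^sup>+ u\<in>{s..t}. ennreal (f u) \<partial>lborel) + (\<integral>\<^sup>+ u\<in>{s..t}. ennreal ((q u)\<^sup>2) \<partial>lborel)"
    unfolding A_def B_def using dq[of s t] s t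
    by (intro add_mono nn_integral_ge_integral[OF f] nn_integral_square_ge[OF q t d2_nonneg]) auto
  also have "\<dots> = (\<integral>\<^sup>+ u. ennreal (f u) * indicator {s..t} u + ennreal ((q u)\<^sup>2) * indicator {s..t} u \<partial>lborel)"
    using m1 by (intro nn_integral_add[symmetric]) auto
  \<comment> \<open>The slope enters through monotonicity of \<open>nn_integral\<close>, valid for
    arbitrary functions; additivity, which is about measurable ones, has been applied to
    \<open>f\<close> and \<open>q\<close>.\<close>
  also have "\<dots> \<le> I" unfolding I_def
  proof (rule nn_integral_mono_AE)
    have "AE u in lborel. u \<noteq> 0 \<and> u \<noteq> t" using AE_lborel_singleton by auto
    with mq show "AE u in lborel. ennreal (f u) * indicator {s..t} u + ennreal ((q u)\<^sup>2) * indicator {s..t} u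
       \<le> ((e2ennreal (slope M W (\<rho> u)))\<^sup>2 + ennreal ((mderiv \<rho> u)\<^sup>2)) * indicator {s..t} u"
    proof eventually_elim
      case (elim u)
      show ?case
      proof (cases "u \<in> {s..t}")
        case True
        then have "mderiv \<rho> u = q u" using elim s by auto
        then show ?thesis using fs[OF True] True by (simp add: add_mono)
      qed simp
    qed
  qed
  finally have le: "ennreal (A + B) \<le> I" .
  have "I \<noteq> \<infinity>" using EI by (auto simp: infinity_ennreal_def)
  then obtain x where x: "I = ennreal x" "0 \<le> x" by (cases I) auto
  have "A + B \<le> x" using le x by (simp add: ennreal_le_iff)
  moreover have "en (\<rho> t) + 1/2 * x \<le> en (\<rho> s)" using EI x by (simp add: enn2ereal_ennreal)
  ultimately show ?thesis by (simp add: A_def B_def)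
qed

text \<open>Dissipation with \<open>f = 0\<close> bounds \<open>d\<^sup>2 / (t - s)\<close> by twice
  the energy drop, which is at most \<open>2 * (K * d)\<close>; one factor \<open>d\<close>
  cancels.\<close>

lemma \<rho>_lipschitz:
  assumes s: "0 \<le> s" and t: "s \<le> t"
  shows "d2 (\<rho> s) (\<rho> t) \<le> 2 * K * (t - s)"
proof (cases "s = t")
  case True
  then show ?thesis using d2_refl[OF \<rho>[of s]] s by simp
next
  case False
  define d where "d = d2 (\<rho> s) (\<rho> t)"
  have d0: "0 \<le> d" by (simp add: d_def d2_nonneg)
  have "d\<^sup>2 / (t - s) + integral {s..t} (\<lambda>_. 0) \<le> 2 * (en (\<rho> s) - en (\<rho> t))"
    unfolding d_def using s t False by (intro dissipation) auto
  also have "\<dots> \<le> 2 * (K * d)"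
    using en_lipschitz[OF \<rho>[of s] \<rho>[of t]] s t by (simp add: d_def abs_le_iff)
  finally have "d\<^sup>2 / (t - s) \<le> 2 * (K * d)" by simp
  then have "d\<^sup>2 \<le> 2 * (K * d) * (t - s)" using t False by (subst (asm) pos_divide_le_eq) auto
  then have le: "d * d \<le> (2 * K * (t - s)) * d"
    by (simp only: power2_eq_square mult.commute mult.left_commute mult.assoc)
  show ?thesis unfolding d_def[symmetric]
  proof (cases "d = 0")
    case True
    then show "d \<le> 2 * K * (t - s)" using K(1) t by simp
  next
    case False
    then show "d \<le> 2 * K * (t - s)" using le d0 by (intro mult_right_le_imp_le[OF le]) auto
  qed
qed

lemma \<rho>_lipschitz_abs:
  assumes "0 \<le> s" "0 \<le> t"
  shows "d2 (\<rho> s) (\<rho> t) \<le> 2 * K * \<bar>s - t\<bar>"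
  using \<rho>_lipschitz[of s t] \<rho>_lipschitz[of t s] d2_commute[OF \<rho> \<rho>, of s t] assms
  by (cases "s \<le> t") auto

lemma F_continuous:
  assumes h: "small h"
  shows "continuous_on {0..} (\<lambda>u. F h (\<rho> u))"
proof -
  define C where "C = (2 * h * K + 8 * h\<^sup>2 * K * L) * (2 * K)"
  have h0: "0 < h" by (rule smallD[OF h])
  have C0: "0 \<le> C" using K(1) L(1) h0 by (simp add: C_def)
  have "continuous_on {0..} (\<lambda>u. J (\<rho> u) h)"
  proof (rule lipschitz_on_continuous_on[of C], rule lipschitz_onI[OF _ C0])
    fix s t :: real assume st: "s \<in> {0..}" "t \<in> {0..}"
    have "\<bar>J (\<rho> s) h - J (\<rho> t) h\<bar> \<le> (2 * h * K + 8 * h\<^sup>2 * K * L) * d2 (\<rho> s) (\<rho> t)"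
      using st by (intro J_lipschitz \<rho> h) auto
    also have "\<dots> \<le> (2 * h * K + 8 * h\<^sup>2 * K * L) * (2 * K * \<bar>s - t\<bar>)"
      using st K(1) L(1) h0 by (intro mult_left_mono \<rho>_lipschitz_abs) auto
    finally show "dist (J (\<rho> s) h) (J (\<rho> t) h) \<le> C * dist s t" by (simp add: dist_real_def C_def)
  qed
  then show ?thesis unfolding F_def using h0 by (intro continuous_intros) auto
qed

text \<open>The first summand stems from the \<open>4 * L * h\<close> in \<open>euler_evi\<close>,
  the curve moving by at most \<open>2 * K * h\<close> in one step; the second is the defect in
  \<open>F_le_slope\<close>.\<close>

definition error_const :: real where "error_const = 16 * L * K\<^sup>2 + slope_const"

lemma error_const_nonneg: "0 \<le> error_const"
  using K(1) L(1) r by (simp add: error_const_def slope_const_def)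

text \<open>Adding \<open>euler_evi\<close> to \<open>h\<close> times \<open>dissipation\<close>
  eliminates both \<open>d\<^sup>2\<close> and the energy difference, up to third order. The outer
  factor 2 compensates \<open>1 - K * h / r \<ge> 1/2\<close>.\<close>

lemma local_error:
  assumes h: "small h" and t: "0 \<le> t"
  shows "(d2 (euler (\<rho> t) h) (\<rho> (t + h)))\<^sup>2
    \<le> 2 * (h * (h * F h (\<rho> t) - integral {t..t + h} (\<lambda>u. F h (\<rho> u))) + error_const * h ^ 3)"
proof -
  note sm = smallD[OF h]
  note P = \<rho>[OF t] \<rho>[of "t + h"]
  have P2: "\<rho> (t + h) \<in> PM M" using t sm(1) by (intro \<rho>) simp
  define a d I where "a = d2 (euler (\<rho> t) h) (\<rho> (t + h))" and "d = d2 (\<rho> t) (\<rho> (t + h))"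
    and "I = integral {t..t + h} (\<lambda>u. F h (\<rho> u))"
  have cF: "continuous_on {t..t + h} (\<lambda>u. F h (\<rho> u))"
    by (rule continuous_on_subset[OF F_continuous[OF h]]) (use t in auto)
  have "d\<^sup>2 / (t + h - t) + integral {t..t + h} (\<lambda>u. F h (\<rho> u) - slope_const * h) \<le> 2 * (en (\<rho> t) - en (\<rho> (t + h)))"
    unfolding d_def
  proof (rule dissipation[OF t])
    show "continuous_on {t..t + h} (\<lambda>u. F h (\<rho> u) - slope_const * h)" using cF by (intro continuous_intros)
    show "ennreal (F h (\<rho> u) - slope_const * h) \<le> (e2ennreal (slope M W (\<rho> u)))\<^sup>2" if "u \<in> {t..t + h}" for u
      using that t by (intro F_le_slope \<rho> h) auto
  qed (use sm in simp)
  also have "integral {t..t + h} (\<lambda>u. F h (\<rho> u) - slope_const * h) = I - slope_const * h * h"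
    using integrable_continuous_real[OF cF] sm(1) unfolding I_def by (subst Henstock_Kurzweil_Integration.integral_diff) auto
  finally have le: "h * (d\<^sup>2 / h + (I - slope_const * h * h)) \<le> h * (2 * (en (\<rho> t) - en (\<rho> (t + h))))"
    using sm(1) by (intro mult_left_mono) auto
  have 1: "d\<^sup>2 + h * I - slope_const * h ^ 3 \<le> 2 * h * (en (\<rho> t) - en (\<rho> (t + h)))"
  proof -
    have "h * (d\<^sup>2 / h + (I - slope_const * h * h)) = d\<^sup>2 + h * I - slope_const * h ^ 3"
      using sm(1) by (simp add: distrib_left right_diff_distrib power3_eq_cube)
    moreover have "t + h - t = h" by simp
    ultimately show ?thesis using le by (simp only: mult.assoc mult.left_commute[of h 2])
  qed
  have 2: "(1 - K * h / r) * a\<^sup>2 \<le> (1 + 4 * L * h) * d\<^sup>2 + 2 * h * (en (\<rho> (t + h)) - en (\<rho> t)) + J (\<rho> t) h"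
    unfolding a_def d_def by (rule euler_evi[OF P(1) P2 h])
  have "d \<le> 2 * K * h" unfolding d_def using \<rho>_lipschitz[OF t, of "t + h"] sm(1) by simp
  then have "d\<^sup>2 \<le> (2 * K * h)\<^sup>2" unfolding d_def by (intro power_mono d2_nonneg)
  then have "4 * L * h * d\<^sup>2 \<le> 4 * L * h * (2 * K * h)\<^sup>2" using L(1) sm(1) by (intro mult_left_mono) auto
  also have "\<dots> = 16 * L * K\<^sup>2 * h ^ 3" by (simp add: power2_eq_square power3_eq_cube)
  finally have 3: "4 * L * h * d\<^sup>2 \<le> 16 * L * K\<^sup>2 * h ^ 3" .
  have 4: "J (\<rho> t) h = h * (h * F h (\<rho> t))" using sm(1) by (simp add: F_def power2_eq_square)
  have 5: "1/2 * a\<^sup>2 \<le> (1 - K * h / r) * a\<^sup>2"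
  proof (rule mult_right_mono)
    show "1/2 \<le> 1 - K * h / r" using sm(3) by linarith
  qed simp
  have 6: "(1 + 4 * L * h) * d\<^sup>2 = d\<^sup>2 + 4 * L * h * d\<^sup>2" by (simp add: algebra_simps)
  have 7: "2 * h * (en (\<rho> (t + h)) - en (\<rho> t)) = - (2 * h * (en (\<rho> t) - en (\<rho> (t + h))))" by (simp add: algebra_simps)
  have 8: "error_const * h ^ 3 = 16 * L * K\<^sup>2 * h ^ 3 + slope_const * h ^ 3" by (simp add: error_const_def algebra_simps)
  have arith: "A \<le> 2 * (j - m + (c + c'))"
    if "D + m - c' \<le> E" "A' \<le> (D + D') + - E + j" "D' \<le> c" "1/2 * A \<le> A'" for A A' D D' E j m c c' :: real
    using that by auto
  show ?thesis
    unfolding a_def[symmetric] I_def[symmetric] 8 right_diff_distrib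
    by (rule arith[OF 1 2[unfolded 6 7 4] 3 5])
qed

abbreviation scheme :: "real \<Rightarrow> nat \<Rightarrow> 'a measure" where "scheme \<tau> \<equiv> nu_seq Phi P (\<rho> 0) \<tau>"

lemma scheme_Suc: "scheme \<tau> (Suc n) = step (scheme \<tau> n) \<tau>"
  by (simp add: step_def)

lemma scheme_PM: "tiny \<tau> \<Longrightarrow> scheme \<tau> n \<in> PM M"
proof (induction n)
  case (Suc n)
  then show ?case unfolding scheme_Suc by (intro step_PM)
qed (simp add: \<rho>)

text \<open>The three terms are the initial shift of the time grid, the accumulated local errors,
  and the exchange of flow steps for Euler steps; the exponential is the stability factor up to time
  \<open>t\<close>.\<close>

definition err :: "real \<Rightarrow> real \<Rightarrow> real" where
  "err t \<tau> = exp ((2 * K / r + 2 * L) * t) *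
     (2 * K * \<tau> + sqrt (2 * t * (K\<^sup>2 + error_const * t) * \<tau>) + 4 * L * K * t * \<tau>)"

text \<open>Summing the local errors along a well-chosen time offset makes the leading terms telescope.\<close>
lemma scheme_error:
  assumes \<tau>: "tiny \<tau>" and n: "real n * \<tau> \<le> t"
  obtains s where "0 \<le> s" "s \<le> \<tau>" "d2 (scheme \<tau> n) (\<rho> (real n * \<tau> + s)) \<le> err t \<tau>"
proof -
  have sm: "small \<tau>" using \<tau> by (simp add: tiny_def)
  have h0: "0 < \<tau>" by (rule smallD[OF sm])
  have t0: "0 \<le> t" using n h0 by (meson mult_nonneg_nonneg of_nat_0_le_iff less_imp_le order_trans)
  define g where "g u = F \<tau> (\<rho> u)" for u
  have cg: "continuous_on {0..} g" unfolding g_def by (rule F_continuous[OF sm])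
  have gi: "g integrable_on {a..b}" if "0 \<le> a" for a b
    by (intro integrable_continuous_real continuous_on_subset[OF cg]) (use that in auto)
  have gb: "0 \<le> g u \<and> g u \<le> K\<^sup>2" if "0 \<le> u" for u
    unfolding g_def using F_bounds[OF \<rho>[OF that] sm] by simp
  obtain s where s: "0 \<le> s" "s \<le> \<tau>" and sum: "(\<Sum>k<n. \<tau> * g (real k * \<tau> + s)) \<le> integral {0..real n * \<tau>} g"
    by (rule exists_offset_Riemann_sum_le[OF cg h0])
  define p where "p k = real k * \<tau> + s" for k
  have p0: "0 \<le> p k" for k using s h0 by (simp add: p_def)
  have pS: "p (Suc k) = p k + \<tau>" for k by (simp add: p_def algebra_simps)
  define a where "a k = d2 (euler (\<rho> (p k)) \<tau>) (\<rho> (p (Suc k)))" for k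
  have comb: "integral {s..p m} g = (\<Sum>k<m. integral {p k..p (Suc k)} g)" for m
  proof (induction m)
    case (Suc m)
    have "integral {s..p (Suc m)} g = integral {s..p m} g + integral {p m..p (Suc m)} g"
      using s h0 by (intro Henstock_Kurzweil_Integration.integral_combine[symmetric] gi) (auto simp: p_def algebra_simps)
    then show ?case using Suc by simp
  qed (simp add: p_def)
  \<comment> \<open>The offset was selected with the integral over
    \<open>{0..real n * \<tau>}\<close>, but the pieces cover \<open>{s..p n}\<close>. The missing
    start has length at most \<open>\<tau>\<close>, with \<open>g \<le> K\<^sup>2\<close> there; the
    additional end helps, since \<open>g\<close> is nonnegative.\<close>
  have tele: "(\<Sum>k<n. \<tau> * g (p k) - integral {p k..p (Suc k)} g) \<le> K\<^sup>2 * \<tau>"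
  proof -
    have N0: "0 \<le> real n * \<tau>" using h0 by simp
    have "integral {0..s} g + integral {s..p n} g = integral {0..p n} g"
      using s N0 by (intro Henstock_Kurzweil_Integration.integral_combine gi) (auto simp: p_def)
    moreover have "integral {0..real n * \<tau>} g + integral {real n * \<tau>..p n} g = integral {0..p n} g"
      using s N0 by (intro Henstock_Kurzweil_Integration.integral_combine gi) (auto simp: p_def)
    moreover have "0 \<le> integral {real n * \<tau>..p n} g"
      using gb N0 by (intro integral_nonneg gi) auto
    moreover have "integral {0..s} g \<le> integral {0..s} (\<lambda>_. K\<^sup>2)"
      using gb by (intro integral_le gi) auto
    moreover have "integral {0..s} (\<lambda>_. K\<^sup>2) \<le> K\<^sup>2 * \<tau>" using s by (simp add: mult.commute mult_right_mono)
    moreover have "(\<Sum>k<n. \<tau> * g (p k)) \<le> integral {0..real n * \<tau>} g" using sum by (simp add: p_def)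
    ultimately show ?thesis unfolding sum_subtractf comb[symmetric] by linarith
  qed
  have sumsq: "(\<Sum>k<n. (a k)\<^sup>2) \<le> 2 * \<tau>\<^sup>2 * (K\<^sup>2 + error_const * t)"
  proof -
    have "(\<Sum>k<n. (a k)\<^sup>2) \<le> (\<Sum>k<n. 2 * \<tau> * (\<tau> * g (p k) - integral {p k..p (Suc k)} g) + 2 * error_const * \<tau> ^ 3)"
    proof (rule sum_mono)
      fix k
      show "(a k)\<^sup>2 \<le> 2 * \<tau> * (\<tau> * g (p k) - integral {p k..p (Suc k)} g) + 2 * error_const * \<tau> ^ 3"
        using local_error[OF sm p0[of k]] unfolding a_def pS g_def by simp
    qed
    also have "\<dots> = 2 * \<tau> * (\<Sum>k<n. \<tau> * g (p k) - integral {p k..p (Suc k)} g) + real n * (2 * error_const * \<tau> ^ 3)"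
      by (simp add: sum.distrib sum_distrib_left)
    also have "\<dots> \<le> 2 * \<tau> * (K\<^sup>2 * \<tau>) + (2 * error_const * \<tau>\<^sup>2) * t"
    proof (rule add_mono)
      show "2 * \<tau> * (\<Sum>k<n. \<tau> * g (p k) - integral {p k..p (Suc k)} g) \<le> 2 * \<tau> * (K\<^sup>2 * \<tau>)"
        using tele h0 by (intro mult_left_mono) auto
      have "real n * (2 * error_const * \<tau> ^ 3) = (2 * error_const * \<tau>\<^sup>2) * (real n * \<tau>)" by (simp add: power2_eq_square power3_eq_cube)
      also have "\<dots> \<le> (2 * error_const * \<tau>\<^sup>2) * t" using n error_const_nonneg by (intro mult_left_mono) auto
      finally show "real n * (2 * error_const * \<tau> ^ 3) \<le> (2 * error_const * \<tau>\<^sup>2) * t" .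
    qed
    also have "\<dots> = 2 * \<tau>\<^sup>2 * (K\<^sup>2 + error_const * t)" by (simp add: power2_eq_square algebra_simps)
    finally show ?thesis .
  qed
  \<comment> \<open>Cauchy-Schwarz over \<open>n\<close> terms: \<open>sumsq\<close> is of order
    \<open>\<tau>\<^sup>2\<close> and \<open>n\<close> is at most \<open>t / \<tau>\<close>.\<close>
  have suma: "(\<Sum>k<n. a k) \<le> sqrt (2 * t * (K\<^sup>2 + error_const * t) * \<tau>)"
  proof (rule real_le_rsqrt)
    have "(\<Sum>k<n. a k)\<^sup>2 \<le> (\<Sum>k<n. (a k)\<^sup>2) * real (card {..<n})" by (rule sum_squared_le_sum_of_squares)
    also have "\<dots> \<le> (2 * \<tau>\<^sup>2 * (K\<^sup>2 + error_const * t)) * real n" using sumsq by (simp add: mult_right_mono)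
    also have "\<dots> = (2 * (K\<^sup>2 + error_const * t) * \<tau>) * (real n * \<tau>)" by (simp add: power2_eq_square)
    also have "\<dots> \<le> (2 * (K\<^sup>2 + error_const * t) * \<tau>) * t" using n h0 t0 error_const_nonneg by (intro mult_left_mono) auto
    finally show "(\<Sum>k<n. a k)\<^sup>2 \<le> 2 * t * (K\<^sup>2 + error_const * t) * \<tau>" by (simp only: mult.commute mult.left_commute mult.assoc)
  qed
  define A where "A = 2 * K / r + 2 * L"
  have A0: "0 \<le> A" using K(1) L(1) r by (simp add: A_def)
  \<comment> \<open>The scheme after \<open>k\<close> steps is compared with the flow at the shifted
    time \<open>p k\<close>, so \<open>b 0\<close> need not vanish; it is at most
    \<open>2 * K * s\<close>.\<close>
  define b where "b k = d2 (scheme \<tau> k) (\<rho> (p k))" for k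
  have "b n \<le> exp (A * \<tau>) ^ n * (b 0 + (\<Sum>k<n. a k + 4 * L * K * \<tau>\<^sup>2))"
  proof (rule discrete_gronwall)
    fix k
    note S = scheme_PM[OF \<tau>, of k] and R1 = \<rho>[OF p0[of k]] and R2 = \<rho>[OF p0[of "Suc k"]]
    \<comment> \<open>The intermediate measures are the Euler steps from the scheme and from the
      flow. The three distances are consistency, stability and local error.\<close>
    have "b (Suc k) \<le> d2 (step (scheme \<tau> k) \<tau>) (euler (scheme \<tau> k) \<tau>) + d2 (euler (scheme \<tau> k) \<tau>) (\<rho> (p (Suc k)))"
      unfolding b_def scheme_Suc by (rule d2_triangle[OF M_compact step_PM[OF S \<tau>] euler_PM[OF S sm] R2])
    also have "d2 (euler (scheme \<tau> k) \<tau>) (\<rho> (p (Suc k))) \<le> d2 (euler (scheme \<tau> k) \<tau>) (euler (\<rho> (p k)) \<tau>) + a k"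
      unfolding a_def by (rule d2_triangle[OF M_compact euler_PM[OF S sm] euler_PM[OF R1 sm] R2])
    also have "d2 (euler (scheme \<tau> k) \<tau>) (euler (\<rho> (p k)) \<tau>) \<le> exp (A * \<tau>) * b k"
      unfolding A_def b_def by (rule euler_stable[OF S R1 sm])
    also have "d2 (step (scheme \<tau> k) \<tau>) (euler (scheme \<tau> k) \<tau>) \<le> 4 * L * K * \<tau>\<^sup>2" by (rule step_euler[OF S \<tau>])
    finally show "b (Suc k) \<le> exp (A * \<tau>) * b k + (a k + 4 * L * K * \<tau>\<^sup>2)" by simp
  next
    show "1 \<le> exp (A * \<tau>)" using A0 h0 by simp
    show "0 \<le> a k + 4 * L * K * \<tau>\<^sup>2" for k using L(1) K(1) by (simp add: a_def d2_nonneg)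
  qed
  also have "\<dots> \<le> exp (A * t) * (2 * K * \<tau> + (sqrt (2 * t * (K\<^sup>2 + error_const * t) * \<tau>) + 4 * L * K * t * \<tau>))"
  proof (rule mult_mono)
    have "exp (A * \<tau>) ^ n = exp (A * (real n * \<tau>))" by (simp add: exp_of_nat_mult[symmetric] mult.left_commute)
    also have "\<dots> \<le> exp (A * t)" using n A0 by (simp add: mult_left_mono)
    finally show "exp (A * \<tau>) ^ n \<le> exp (A * t)" .
    have "b 0 \<le> 2 * K * s" using \<rho>_lipschitz[of 0 s] s by (simp add: b_def p_def)
    also have "\<dots> \<le> 2 * K * \<tau>" using s K(1) by simp
    finally have 1: "b 0 \<le> 2 * K * \<tau>" .
    have "(\<Sum>k<n. 4 * L * K * \<tau>\<^sup>2) = (4 * L * K * \<tau>) * (real n * \<tau>)" by (simp add: power2_eq_square)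
    also have "\<dots> \<le> (4 * L * K * \<tau>) * t" using n L(1) K(1) h0 by (intro mult_left_mono) auto
    finally have 2: "(\<Sum>k<n. 4 * L * K * \<tau>\<^sup>2) \<le> 4 * L * K * t * \<tau>" by (simp only: mult.commute mult.left_commute mult.assoc)
    show "b 0 + (\<Sum>k<n. a k + 4 * L * K * \<tau>\<^sup>2) \<le> 2 * K * \<tau> + (sqrt (2 * t * (K\<^sup>2 + error_const * t) * \<tau>) + 4 * L * K * t * \<tau>)"
      unfolding sum.distrib using 1 2 suma by linarith
    show "0 \<le> b 0 + (\<Sum>k<n. a k + 4 * L * K * \<tau>\<^sup>2)"
      using L(1) K(1) by (intro add_nonneg_nonneg sum_nonneg) (auto simp: a_def b_def d2_nonneg)
  qed simp
  finally have "b n \<le> err t \<tau>" by (simp add: err_def A_def add.assoc)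
  then show thesis using s by (intro that[of s]) (auto simp: b_def p_def)
qed

text \<open>Two contributions of at most \<open>2 * K * \<tau>\<close> join \<open>err\<close>: the
  last partial step of length \<open>h\<close>, and the time mismatch between
  \<open>real n * \<tau> + s\<close> and \<open>t\<close>, both of which lie within one step after
  \<open>real n * \<tau>\<close>.\<close>

lemma interpolation_error:
  assumes \<tau>: "tiny \<tau>" and t: "0 < t"
  shows "d2 (nu_interp Phi P (\<rho> 0) \<tau> t) (\<rho> t) \<le> 4 * K * \<tau> + err t \<tau>"
proof -
  have h0: "0 < \<tau>" using \<tau> smallD(1)[of \<tau>] by (simp add: tiny_def)
  \<comment> \<open>The ceiling minus one makes \<open>t - real n * \<tau>\<close> positive and at
    most \<open>\<tau>\<close>, so the last partial step is itself \<open>tiny\<close>.\<close>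
  define n where "n = nat (\<lceil>t / \<tau>\<rceil> - 1)"
  have "0 < t / \<tau>" using t h0 by simp
  then have "1 \<le> \<lceil>t / \<tau>\<rceil>" by (simp add: le_ceiling_iff)
  then have "real n = real_of_int \<lceil>t / \<tau>\<rceil> - 1" by (simp add: n_def)
  then have "real n < t / \<tau>" "t / \<tau> \<le> real n + 1" using ceiling_correct[of "t / \<tau>"] by linarith+
  then have n: "real n * \<tau> < t" "t \<le> real n * \<tau> + \<tau>" using h0 by (auto simp: field_simps)
  define h where "h = t - real n * \<tau>"
  have h: "0 < h" "h \<le> \<tau>" using n by (auto simp: h_def)
  have "K * h \<le> K * \<tau>" using h K(1) by simp
  then have ht: "tiny h" using \<tau> h by (auto simp: tiny_def small_def)
  obtain s where s: "0 \<le> s" "s \<le> \<tau>" and e: "d2 (scheme \<tau> n) (\<rho> (real n * \<tau> + s)) \<le> err t \<tau>"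
    by (rule scheme_error[OF \<tau> less_imp_le[OF n(1)]])
  have p0: "0 \<le> real n * \<tau> + s" using s h0 by simp
  note S = scheme_PM[OF \<tau>, of n] and R1 = \<rho>[OF p0] and R2 = \<rho>[OF less_imp_le[OF t]]
  have "nu_interp Phi P (\<rho> 0) \<tau> t = step (scheme \<tau> n) h"
    using t by (simp add: nu_interp_def Let_def n_def h_def step_def)
  then have "d2 (nu_interp Phi P (\<rho> 0) \<tau> t) (\<rho> t) \<le> d2 (step (scheme \<tau> n) h) (scheme \<tau> n) + d2 (scheme \<tau> n) (\<rho> t)"
    using d2_triangle[OF M_compact step_PM[OF S ht] S R2] by simp
  also have "d2 (step (scheme \<tau> n) h) (scheme \<tau> n) \<le> 2 * K * h" by (rule step_near[OF S ht])
  also have "d2 (scheme \<tau> n) (\<rho> t) \<le> d2 (scheme \<tau> n) (\<rho> (real n * \<tau> + s)) + d2 (\<rho> (real n * \<tau> + s)) (\<rho> t)"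
    by (rule d2_triangle[OF M_compact S R1 R2])
  also have "d2 (\<rho> (real n * \<tau> + s)) (\<rho> t) \<le> 2 * K * \<bar>real n * \<tau> + s - t\<bar>"
    using p0 t by (intro \<rho>_lipschitz_abs) auto
  also have "2 * K * \<bar>real n * \<tau> + s - t\<bar> \<le> 2 * K * \<tau>" using n s K(1) by (intro mult_left_mono) auto
  also have "2 * K * h \<le> 2 * K * \<tau>" using h K(1) by (intro mult_left_mono) auto
  finally show ?thesis using e by simp
qed

lemma err_tendsto: "((\<lambda>\<tau>. 4 * K * \<tau> + err t \<tau>) \<longlongrightarrow> 0) (at_right 0)"
proof -
  have "((\<lambda>\<tau>. 4 * K * \<tau> + err t \<tau>) \<longlongrightarrow> 4 * K * 0 + err t 0) (at_right 0)"
    unfolding err_def by (intro tendsto_intros)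
  then show ?thesis by (simp add: err_def)
qed

end

section \<open>Gradients of smooth even potentials, and the conclusion\<close>

lemma GDERIV_grad:
  fixes W :: "'a::euclidean_space \<Rightarrow> real"
  assumes "W differentiable (at x)"
  shows "GDERIV W x :> grad W x"
proof -
  obtain f where f: "(W has_derivative f) (at x)" using assms by (auto simp: differentiable_def)
  \<comment> \<open>The adjoint of a linear functional, evaluated at 1, is its Riesz vector.\<close>
  have "f = (\<lambda>h. h \<bullet> adjoint f 1)"
    using adjoint_works[OF has_derivative_linear[OF f], of _ 1] by (auto simp: fun_eq_iff)
  then have "\<exists>D. GDERIV W x :> D" using f unfolding gderiv_def by metis
  then show ?thesis unfolding grad_def by (rule someI_ex)
qed

lemma grad_uminus:
  fixes W :: "'a::euclidean_space \<Rightarrow> real"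
  assumes W: "\<And>x. W differentiable (at x)" and sym: "\<And>x. W (- x) = W x"
  shows "grad W (- x) = - grad W x"
proof -
  have "(W has_derivative (\<lambda>h. h \<bullet> grad W (- x))) (at (- x))"
    using GDERIV_grad[OF W] by (simp add: gderiv_def)
  then have "(W \<circ> uminus has_derivative (\<lambda>h. h \<bullet> grad W (- x)) \<circ> uminus) (at x)"
    by (intro diff_chain_at) (auto intro!: derivative_eq_intros)
  moreover have "W \<circ> uminus = W" by (simp add: fun_eq_iff sym)
  ultimately have "(W has_derivative (\<lambda>h. - h \<bullet> grad W (- x))) (at x)" by (simp add: comp_def)
  moreover have "(W has_derivative (\<lambda>h. h \<bullet> grad W x)) (at x)"
    using GDERIV_grad[OF W] by (simp add: gderiv_def)
  ultimately have "(\<lambda>h. - h \<bullet> grad W (- x)) = (\<lambda>h. h \<bullet> grad W x)" by (rule has_derivative_unique)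
  then have "\<forall>h. h \<bullet> - grad W (- x) = h \<bullet> grad W x" by (simp add: fun_eq_iff)
  then have "- grad W (- x) = grad W x" by (simp only: vector_eq_ldot)
  then show ?thesis by (metis minus_minus)
qed

lemma C2_grad_bounds:
  fixes W :: "'a::euclidean_space \<Rightarrow> real"
  assumes W: "C2 W"
  obtains K L where "0 < K" "0 \<le> L" "continuous_on UNIV (grad W)"
    "\<And>x. norm x \<le> R \<Longrightarrow> norm (grad W x) \<le> K"
    "\<And>x y. norm x \<le> R \<Longrightarrow> norm y \<le> R \<Longrightarrow> norm (grad W x - grad W y) \<le> L * norm (x - y)"
proof -
  obtain D :: "'a \<Rightarrow> 'a \<Rightarrow>\<^sub>L 'a" where D: "continuous_on UNIV D"
    and dD: "\<forall>x. (grad W has_derivative blinfun_apply (D x)) (at x)" using W unfolding C2_def by blast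
  have cont: "continuous_on UNIV (grad W)"
    using has_derivative_continuous[OF dD[rule_format]] by (simp add: continuous_on_eq_continuous_at)
  have "bounded (grad W ` cball 0 R)" "bounded (D ` cball 0 R)"
    by (intro compact_imp_bounded compact_continuous_image compact_cball continuous_on_subset[OF cont]
        continuous_on_subset[OF D] subset_UNIV)+
  then obtain K L where K: "\<forall>y\<in>grad W ` cball 0 R. norm y \<le> K" and L: "\<forall>y\<in>D ` cball 0 R. norm y \<le> L"
    unfolding bounded_iff by blast
  show thesis
  \<comment> \<open>The maxima supply the sign conditions; \<open>0 < K\<close> matters when step
    sizes are divided by \<open>K\<close>.\<close>
  proof (rule that[of "max K 1" "max L 0", OF _ _ cont])
    show "norm (grad W x) \<le> max K 1" if "norm x \<le> R" for x
    proof -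
      have "norm (grad W x) \<le> K" using K that by simp
      then show ?thesis by simp
    qed
    show "norm (grad W x - grad W y) \<le> max L 0 * norm (x - y)" if "norm x \<le> R" "norm y \<le> R" for x y
    proof (rule differentiable_bound[OF convex_cball[of 0 R]])
      fix u :: 'a assume u: "u \<in> cball 0 R"
      show "(grad W has_derivative blinfun_apply (D u)) (at u within cball 0 R)"
        using dD by (blast intro: has_derivative_at_withinI)
      have "norm (D u) \<le> L" using L u by blast
      then show "onorm (blinfun_apply (D u)) \<le> max L 0" by (simp add: norm_blinfun.rep_eq[symmetric])
    qed (use that in auto)
  qed auto
qed

theorem theorem1p2:
  fixes M :: "'a::euclidean_space set"
    and W :: "'a \<Rightarrow> real"
    and Phi :: "'a measure \<Rightarrow> real \<Rightarrow> 'a \<Rightarrow> 'a"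
    and \<rho>0 :: "'a measure"
    and \<rho> :: "real \<Rightarrow> 'a measure"
    and r R \<tau>0 :: real
  assumes M_compact: "compact M"
    and M_reach: "reach M > 0"
    and W_C2: "C2 W"
    and W_sym: "\<forall>x. W (- x) = W x"
    and W_semiconvex: "\<exists>c::real. convex_on UNIV (\<lambda>x. W x + c * (norm x)\<^sup>2)"
    and W_below: "\<exists>c. \<forall>x. c \<le> W x"
    and W_quadratic: "\<exists>C. \<forall>x. \<bar>W x\<bar> \<le> C * (1 + (norm x)\<^sup>2)"
    and Phi_flow: "\<forall>\<nu>\<in>PM M. is_flow W \<nu> (Phi \<nu>)"
    and \<rho>0_in: "\<rho>0 \<in> PM M"
    and \<rho>_in: "\<forall>t\<ge>0. \<rho> t \<in> PM M"
    and \<rho>_flow: "grad_flow M W \<rho>"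
    and \<rho>_init: "\<rho> 0 = \<rho>0"
    and r_pos: "0 < r" and r_lt: "ereal r < reach M"
    and R_pos: "0 < R"
    and R_ball: "\<forall>x y. infdist x M < r \<and> infdist y M < r \<longrightarrow> x - y \<in> ball 0 R"
    and \<tau>0_pos: "0 < \<tau>0"
    and \<tau>0_le: "ereal (8 * \<tau>0 * (SUP x\<in>ball 0 R. norm (grad W x))) \<le> reach M"
    and \<tau>0_supp: "\<forall>\<nu>\<in>PM M. \<forall>t\<in>{0..\<tau>0}.
                   msupp (distr \<nu> borel (Phi \<nu> t)) \<subseteq> {x. infdist x M < r}"
  shows "\<forall>t\<ge>0. ((\<lambda>\<tau>. d2 (nu_interp Phi (proj_on M r) \<rho>0 \<tau> t) (\<rho> t)) \<longlongrightarrow> 0) (at_right 0)"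
proof (intro allI impI)
  fix t :: real assume t: "0 \<le> t"
  have M_ne: "M \<noteq> {}"
  proof
    assume "M = {}"
    then have "emeasure \<rho>0 (space \<rho>0) = 0" using \<rho>0_in PM_D[OF \<rho>0_in] by (simp add: PM_def)
    then show False using prob_space.emeasure_space_1[OF PM_D(1)[OF \<rho>0_in]] by simp
  qed
  define P0 where "P0 x = (THE y. y \<in> M \<and> dist x y = infdist x M)" for x
  obtain r0 where r0: "r < r0" and U: "unique_projection M r0 P0"
    using reach_unique_projection[OF M_compact M_ne r_lt] unfolding P0_def by blast
  interpret U: unique_projection M r0 P0 by (rule U)
  have P_eq: "proj_on M r x = P0 x" if "infdist x M < r" for x
    using that by (simp add: proj_on_def P0_def)
  \<comment> \<open>Continuous on the open tube and the identity off it, hence Borel.\<close>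
  have P_meas: "proj_on M r \<in> borel_measurable borel"
  proof -
    have "(\<lambda>x. if x \<in> {x. infdist x M < r} then P0 x else x) \<in> borel_measurable borel"
    proof (rule borel_measurable_continuous_on_if)
      have "open {x. infdist x M < r}" by (intro open_Collect_less continuous_intros)
      then show "{x. infdist x M < r} \<in> sets borel" by simp
      show "continuous_on {x. infdist x M < r} P0"
        by (rule continuous_on_subset[OF U.continuous_on_P]) (use r0 in auto)
    qed (rule continuous_on_id)
    moreover have "proj_on M r = (\<lambda>x. if x \<in> {x. infdist x M < r} then P0 x else x)"
      by (rule ext) (simp add: proj_on_def P0_def)
    ultimately show ?thesis by simp
  qed
  have diff: "W differentiable (at x)" for x using W_C2 by (simp add: C2_def)
  \<comment> \<open>The radius \<open>R + 1\<close> provides the unit of room that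
    \<open>diam\<close> demands.\<close>
  obtain K L where K: "0 < K" and L: "0 \<le> L" and cont: "continuous_on UNIV (grad W)"
    and KB: "\<And>x. norm x \<le> R + 1 \<Longrightarrow> norm (grad W x) \<le> K"
    and LB: "\<And>x y. norm x \<le> R + 1 \<Longrightarrow> norm y \<le> R + 1 \<Longrightarrow> norm (grad W x - grad W y) \<le> L * norm (x - y)"
    by (rule C2_grad_bounds[OF W_C2, of "R + 1"]) blast
  interpret prox_gradient_flow M W r K L "R + 1" "proj_on M r" Phi \<tau>0 \<rho>
  proof
    show "proj_on M r x \<in> M" if "infdist x M < r" for x
      using that U.P_in[of x] r0 by (simp add: P_eq)
    show "norm (x - proj_on M r x) = infdist x M" if "infdist x M < r" for x
      using that U.P_dist[of x] r0 by (simp add: P_eq dist_norm)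
    show "2 * r * ((x - proj_on M r x) \<bullet> (y - proj_on M r x)) \<le> norm (x - proj_on M r x) * (norm (y - proj_on M r x))\<^sup>2"
      if "infdist x M < r" "y \<in> M" for x y
      using U.normal_inequality[OF that(1) r0 that(2)] by (simp add: P_eq[OF that(1)])
    show "norm (x - y) + 1 \<le> R + 1" if "infdist x M < r" "infdist y M < r" for x y
      using R_ball[rule_format, of x y] that by simp
    show "grad W (- x) = - grad W x" for x using W_sym by (intro grad_uminus diff) auto
    show "msupp (distr \<nu> borel (Phi \<nu> t)) \<subseteq> {x. infdist x M < r}" if "\<nu> \<in> PM M" "0 \<le> t" "t \<le> \<tau>0" for \<nu> t
      using \<tau>0_supp that by simp
  qed (use M_compact M_ne r_pos P_meas GDERIV_grad[OF diff] cont K KB L LB Phi_flow \<rho>_in \<rho>_flow in auto)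
  show "((\<lambda>\<tau>. d2 (nu_interp Phi (proj_on M r) \<rho>0 \<tau> t) (\<rho> t)) \<longlongrightarrow> 0) (at_right 0)"
  proof (cases "t = 0")
    case True
    then show ?thesis using d2_refl[OF \<rho>0_in] by (simp add: nu_interp_def \<rho>_init)
  next
    case False
    \<comment> \<open>The three bounds are the three parts of \<open>tiny\<close>: the support
      condition up to \<open>\<tau>0\<close>, \<open>small\<close> through
      \<open>r / (4 * K)\<close>, and \<open>K * \<tau> < 1\<close> through
      \<open>1 / (2 * K)\<close>.\<close>
    define b where "b = min \<tau>0 (min (r / (4 * K)) (1 / (2 * K)))"
    have b: "0 < b" using \<tau>0_pos r_pos K by (simp add: b_def)
    have "eventually (\<lambda>\<tau>. \<tau> \<in> {0<..<b}) (at_right 0)" by (rule eventually_at_right_real[OF b])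
    then have "eventually (\<lambda>\<tau>. d2 (nu_interp Phi (proj_on M r) \<rho>0 \<tau> t) (\<rho> t) \<le> 4 * K * \<tau> + err t \<tau>) (at_right 0)"
    proof eventually_elim
      case (elim \<tau>)
      then have "\<tau> \<le> r / (4 * K)" "\<tau> < 1 / (2 * K)" "\<tau> \<le> \<tau>0" by (auto simp: b_def)
      then have "4 * K * \<tau> \<le> r" "2 * (K * \<tau>) < 1" using K by (auto simp: field_simps)
      moreover have "0 < K * \<tau>" using K elim by simp
      ultimately have "tiny \<tau>" using \<open>\<tau> \<le> \<tau>0\<close> elim by (simp add: tiny_def small_def)
      then show ?case using interpolation_error[of \<tau> t] t False by (simp add: \<rho>_init)
    qed
    then show ?thesis
      by (intro tendsto_sandwich[OF _ _ tendsto_const err_tendsto[of t]]) (simp_all add: d2_nonneg)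
  qed
qed

end
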